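(* Let $M_1,\dots,M_r$ be nonzero finitely generated bigraded $S$-modules. Then $\bigoplus_{i=1}^r M_i$ has maximal depth with respect to $Q$ if and only if there exists $j\in\{1,\dots,r\}$ such that $\operatorname{grade}(Q,M_j)\le\operatorname{grade}(Q,M_k)$ for all $k\in\{1,\dots,r\}$ and $M_j$ has maximal depth with respect to $Q$.
   Context: $K$ is a field and $S=K[x_1,\dots,x_m,y_1,\dots,y_n]$ is the standard bigraded polynomial ring: $\deg x_i=(1,0)$, $\deg y_j=(0,1)$. Set $Q=(y_1,\dots,y_n)$. For a nonzero finitely generated bigraded $S$-module $N$, $\operatorname{cd}(Q,N)$ is the largest integer $i$ with $H^i_Q(N)\neq 0$, $\operatorname{grade}(Q,N)$ is the length of a maximal $N$-regular sequence in $Q$ (equivalently the smallest $i$ with $H^i_Q(N)\ne0$), and $\operatorname{mgrade}(Q,N)=\min\{\operatorname{cd}(Q,S/\mathfrak p):\mathfrak p\in\operatorname{Ass}(N)\}$. $N$ has maximal depth with respect to $Q$ if $\operatorname{grade}(Q,N)=\operatorname{mgrade}(Q,N)$. *)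

theory Defs
  imports "HOL-Library.Poly_Mapping" "HOL-Algebra.Module" "HOL-Algebra.QuotRing"
begin

section \<open>Constructions on modules\<close>

text \<open>The record type of modules extends that of rings; its fields \<open>mult\<close> and \<open>one\<close> play no
  role for modules and are left \<open>undefined\<close> below.\<close>

definition nonzero_module :: "('r, 'a, 'c) module_scheme \<Rightarrow> bool" where
  "nonzero_module M \<longleftrightarrow> carrier M \<noteq> {\<zero>\<^bsub>M\<^esub>}"

definition finitely_generated_module :: "('r, 'b) ring_scheme \<Rightarrow> ('r, 'a, 'c) module_scheme \<Rightarrow> bool" where
  "finitely_generated_module R M \<longleftrightarrow>
     (\<exists>A. finite A \<and> A \<subseteq> carrier M \<and>
        (\<forall>x\<in>carrier M. \<exists>c\<in>A \<rightarrow> carrier R. x = (\<Oplus>\<^bsub>M\<^esub>a\<in>A. c a \<odot>\<^bsub>M\<^esub> a)))"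

definition regular_module :: "('r, 'b) ring_scheme \<Rightarrow> ('r, 'r) module" where
  "regular_module R =
     \<lparr>carrier = carrier R, mult = undefined, one = undefined, zero = \<zero>\<^bsub>R\<^esub>, add = add R,
      smult = mult R\<rparr>"

definition quotient_module :: "('r, 'a, 'c) module_scheme \<Rightarrow> 'a set \<Rightarrow> ('r, 'a set) module" where
  "quotient_module M N =
     \<lparr>carrier = a_rcosets\<^bsub>M\<^esub> N, mult = undefined, one = undefined, zero = N, add = set_add M,
      smult = (\<lambda>r X. \<Union>x\<in>X. N +>\<^bsub>M\<^esub> (r \<odot>\<^bsub>M\<^esub> x))\<rparr>"

definition direct_sum :: "'i set \<Rightarrow> ('i \<Rightarrow> ('r, 'a, 'c) module_scheme) \<Rightarrow> ('r, 'i \<Rightarrow> 'a) module" where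
  "direct_sum I M =
     \<lparr>carrier = {x \<in> \<Pi>\<^sub>E i\<in>I. carrier (M i). finite {i \<in> I. x i \<noteq> \<zero>\<^bsub>M i\<^esub>}},
      mult = undefined, one = undefined,
      zero = (\<lambda>i\<in>I. \<zero>\<^bsub>M i\<^esub>),
      add = (\<lambda>x y. \<lambda>i\<in>I. x i \<oplus>\<^bsub>M i\<^esub> y i),
      smult = (\<lambda>r x. \<lambda>i\<in>I. r \<odot>\<^bsub>M i\<^esub> x i)\<rparr>"


section \<open>Localization at the powers of an element\<close>

text \<open>The fraction \<open>a / f\<^sup>k\<close> is the class of the pair \<open>(a, k)\<close>.\<close>

definition frac_rel ::
    "('r, 'b) ring_scheme \<Rightarrow> ('r, 'a, 'c) module_scheme \<Rightarrow> 'r \<Rightarrow> (('a \<times> nat) \<times> ('a \<times> nat)) set" where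
  "frac_rel R M f =
     {((a, k), (b, l)). a \<in> carrier M \<and> b \<in> carrier M \<and>
        (\<exists>t::nat. (f [^]\<^bsub>R\<^esub> (t + l)) \<odot>\<^bsub>M\<^esub> a = (f [^]\<^bsub>R\<^esub> (t + k)) \<odot>\<^bsub>M\<^esub> b)}"

definition frac ::
    "('r, 'b) ring_scheme \<Rightarrow> ('r, 'a, 'c) module_scheme \<Rightarrow> 'r \<Rightarrow> 'a \<Rightarrow> nat \<Rightarrow> ('a \<times> nat) set" where
  "frac R M f a k = frac_rel R M f `` {(a, k)}"

definition localized_module ::
    "('r, 'b) ring_scheme \<Rightarrow> ('r, 'a, 'c) module_scheme \<Rightarrow> 'r \<Rightarrow> ('r, ('a \<times> nat) set) module" where
  "localized_module R M f =
     \<lparr>carrier = (carrier M \<times> UNIV) // frac_rel R M f,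
      mult = undefined, one = undefined,
      zero = frac R M f \<zero>\<^bsub>M\<^esub> 0,
      add = (\<lambda>X Y. \<Union>(a, k)\<in>X. \<Union>(b, l)\<in>Y.
               frac R M f ((f [^]\<^bsub>R\<^esub> l) \<odot>\<^bsub>M\<^esub> a \<oplus>\<^bsub>M\<^esub> (f [^]\<^bsub>R\<^esub> k) \<odot>\<^bsub>M\<^esub> b) (k + l)),
      smult = (\<lambda>r X. \<Union>(a, k)\<in>X. frac R M f (r \<odot>\<^bsub>M\<^esub> a) k)\<rparr>"


section \<open>Local cohomology\<close>

text \<open>For an ideal with generators \<open>f 1, \<dots>, f n\<close>, the local cohomology of \<open>M\<close> is taken to be the
  cohomology of the extended (that is, starting with \<open>M\<close> in degree \<open>0\<close>) Cech complex
  \<open>0 \<rightarrow> M \<rightarrow> \<Oplus>\<^sub>j M\<^bsub>f j\<^esub> \<rightarrow> \<dots> \<rightarrow> M\<^bsub>f 1 \<cdots> f n\<^esub> \<rightarrow> 0\<close>.  In degree \<open>0\<close> the empty product gives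
  \<open>M\<close> localized at \<open>1\<close>.\<close>

definition cech_module ::
    "('r, 'b) ring_scheme \<Rightarrow> ('r, 'a, 'c) module_scheme \<Rightarrow> nat \<Rightarrow> (nat \<Rightarrow> 'r) \<Rightarrow> nat
      \<Rightarrow> ('r, nat set \<Rightarrow> ('a \<times> nat) set) module" where
  "cech_module R M n f i =
     direct_sum {J. J \<subseteq> {1..n} \<and> card J = i} (\<lambda>J. localized_module R M (\<Otimes>\<^bsub>R\<^esub>j\<in>J. f j))"

text \<open>\<open>cech_restrict R M f J j\<close> is the localization map from \<open>M\<close> localized at the product over
  \<open>J - {j}\<close> to \<open>M\<close> localized at the product over \<open>J\<close>, for \<open>j \<in> J\<close>; it sends \<open>a / g\<^sup>k\<close> to
  \<open>(f j)\<^sup>k a / (g f j)\<^sup>k\<close>.\<close>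

definition cech_restrict ::
    "('r, 'b) ring_scheme \<Rightarrow> ('r, 'a, 'c) module_scheme \<Rightarrow> (nat \<Rightarrow> 'r) \<Rightarrow> nat set \<Rightarrow> nat
      \<Rightarrow> ('a \<times> nat) set \<Rightarrow> ('a \<times> nat) set" where
  "cech_restrict R M f J j X =
     (\<Union>(a, k)\<in>X. frac R M (\<Otimes>\<^bsub>R\<^esub>i\<in>J. f i) ((f j [^]\<^bsub>R\<^esub> k) \<odot>\<^bsub>M\<^esub> a) k)"

definition cech_differential ::
    "('r, 'b) ring_scheme \<Rightarrow> ('r, 'a, 'c) module_scheme \<Rightarrow> nat \<Rightarrow> (nat \<Rightarrow> 'r) \<Rightarrow> nat
      \<Rightarrow> (nat set \<Rightarrow> ('a \<times> nat) set) \<Rightarrow> (nat set \<Rightarrow> ('a \<times> nat) set)" where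
  "cech_differential R M n f i c =
     (\<lambda>J\<in>{J. J \<subseteq> {1..n} \<and> card J = Suc i}.
        let L = localized_module R M (\<Otimes>\<^bsub>R\<^esub>j\<in>J. f j)
        in \<Oplus>\<^bsub>L\<^esub>j\<in>J. ((\<ominus>\<^bsub>R\<^esub> \<one>\<^bsub>R\<^esub>) [^]\<^bsub>R\<^esub> card {k \<in> J. k < j})
              \<odot>\<^bsub>L\<^esub> cech_restrict R M f J j (c (J - {j})))"

definition cech_cocycles ::
    "('r, 'b) ring_scheme \<Rightarrow> ('r, 'a, 'c) module_scheme \<Rightarrow> nat \<Rightarrow> (nat \<Rightarrow> 'r) \<Rightarrow> nat
      \<Rightarrow> (nat set \<Rightarrow> ('a \<times> nat) set) set" where
  "cech_cocycles R M n f i =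
     {c \<in> carrier (cech_module R M n f i).
        cech_differential R M n f i c = \<zero>\<^bsub>cech_module R M n f (Suc i)\<^esub>}"

definition cech_coboundaries ::
    "('r, 'b) ring_scheme \<Rightarrow> ('r, 'a, 'c) module_scheme \<Rightarrow> nat \<Rightarrow> (nat \<Rightarrow> 'r) \<Rightarrow> nat
      \<Rightarrow> (nat set \<Rightarrow> ('a \<times> nat) set) set" where
  "cech_coboundaries R M n f i =
     (case i of
        0 \<Rightarrow> {\<zero>\<^bsub>cech_module R M n f 0\<^esub>}
      | Suc h \<Rightarrow> cech_differential R M n f h ` carrier (cech_module R M n f h))"

definition local_cohomology ::
    "('r, 'b) ring_scheme \<Rightarrow> ('r, 'a, 'c) module_scheme \<Rightarrow> nat \<Rightarrow> (nat \<Rightarrow> 'r) \<Rightarrow> nat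
      \<Rightarrow> ('r, (nat set \<Rightarrow> ('a \<times> nat) set) set) module" where
  "local_cohomology R M n f i =
     quotient_module (cech_module R M n f i \<lparr>carrier := cech_cocycles R M n f i\<rparr>)
       (cech_coboundaries R M n f i)"


section \<open>Regular sequences and associated primes\<close>

definition sequence_submodule :: "('r, 'b) ring_scheme \<Rightarrow> ('r, 'a, 'c) module_scheme \<Rightarrow> 'r list \<Rightarrow> 'a set" where
  "sequence_submodule R M fs =
     {\<Oplus>\<^bsub>M\<^esub>i\<in>{..<length fs}. fs ! i \<odot>\<^bsub>M\<^esub> x i | x. x \<in> {..<length fs} \<rightarrow> carrier M}"

definition nonzerodivisor_on :: "('r, 'a, 'c) module_scheme \<Rightarrow> 'r \<Rightarrow> bool" where
  "nonzerodivisor_on M f \<longleftrightarrow> (\<forall>x\<in>carrier M. f \<odot>\<^bsub>M\<^esub> x = \<zero>\<^bsub>M\<^esub> \<longrightarrow> x = \<zero>\<^bsub>M\<^esub>)"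

definition regular_sequence :: "('r, 'b) ring_scheme \<Rightarrow> ('r, 'a, 'c) module_scheme \<Rightarrow> 'r list \<Rightarrow> bool" where
  "regular_sequence R M fs \<longleftrightarrow>
     set fs \<subseteq> carrier R \<and>
     (\<forall>i<length fs.
        nonzerodivisor_on (quotient_module M (sequence_submodule R M (take i fs))) (fs ! i)) \<and>
     nonzero_module (quotient_module M (sequence_submodule R M fs))"

text \<open>The grade is the length of a maximal regular sequence.  For finitely generated \<open>M\<close> over a
  Noetherian ring all maximal \<open>M\<close>-regular sequences in \<open>I\<close> have the same length, so this is the
  length of a longest one.  The entries need not be homogeneous.\<close>

definition grade :: "('r, 'b) ring_scheme \<Rightarrow> 'r set \<Rightarrow> ('r, 'a, 'c) module_scheme \<Rightarrow> nat" where
  "grade R I M = (GREATEST k. \<exists>fs. length fs = k \<and> set fs \<subseteq> I \<and> regular_sequence R M fs)"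

definition associated_primes :: "('r, 'b) ring_scheme \<Rightarrow> ('r, 'a, 'c) module_scheme \<Rightarrow> 'r set set" where
  "associated_primes R M =
     {\<pp>. primeideal \<pp> R \<and> (\<exists>x\<in>carrier M. \<pp> = {r \<in> carrier R. r \<odot>\<^bsub>M\<^esub> x = \<zero>\<^bsub>M\<^esub>})}"


section \<open>The bigraded polynomial ring\<close>

text \<open>An exponent vector is a finitely supported function on the variables; the variable \<open>x\<^sub>i\<close> is
  indexed by \<open>Inl i\<close> and \<open>y\<^sub>j\<close> by \<open>Inr j\<close>.\<close>

type_synonym 'k bipoly = "((nat + nat) \<Rightarrow>\<^sub>0 nat) \<Rightarrow>\<^sub>0 'k"

definition S_ring :: "nat \<Rightarrow> nat \<Rightarrow> 'k::field bipoly ring" where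
  "S_ring m n =
     \<lparr>carrier = {p. \<forall>t\<in>Poly_Mapping.keys p. Poly_Mapping.keys t \<subseteq> Inl ` {1..m} \<union> Inr ` {1..n}},
      mult = (*), one = 1, zero = 0, add = (+)\<rparr>"

definition y_var :: "nat \<Rightarrow> 'k::field bipoly" where
  "y_var j = Poly_Mapping.single (Poly_Mapping.single (Inr j) 1) 1"

definition Q_ideal :: "nat \<Rightarrow> nat \<Rightarrow> 'k::field bipoly set" where
  "Q_ideal m n = Idl\<^bsub>S_ring m n\<^esub> (y_var ` {1..n})"

definition S_component :: "nat \<Rightarrow> nat \<Rightarrow> int \<times> int \<Rightarrow> 'k::field bipoly set" where
  "S_component m n d =
     {p \<in> carrier (S_ring m n). \<forall>t\<in>Poly_Mapping.keys p.
        int (\<Sum>i\<in>{1..m}. Poly_Mapping.lookup t (Inl i)) = fst d \<and>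
        int (\<Sum>j\<in>{1..n}. Poly_Mapping.lookup t (Inr j)) = snd d}"

definition bigraded_module ::
    "nat \<Rightarrow> nat \<Rightarrow> ('k::field bipoly, 'a) module \<Rightarrow> (int \<times> int \<Rightarrow> 'a set) \<Rightarrow> bool" where
  "bigraded_module m n M G \<longleftrightarrow>
     module (S_ring m n) M \<and>
     (\<forall>d. subgroup (G d) (add_monoid M)) \<and>
     (\<forall>x\<in>carrier M. \<exists>!c. (\<forall>d. c d \<in> G d) \<and> finite {d. c d \<noteq> \<zero>\<^bsub>M\<^esub>} \<and>
        x = (\<Oplus>\<^bsub>M\<^esub>d\<in>{d. c d \<noteq> \<zero>\<^bsub>M\<^esub>}. c d)) \<and>
     (\<forall>d e. \<forall>p\<in>S_component m n d. \<forall>x\<in>G e.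
        p \<odot>\<^bsub>M\<^esub> x \<in> G (fst d + fst e, snd d + snd e))"


section \<open>Invariants with respect to \<open>Q\<close>\<close>

text \<open>The modules of the Cech complex vanish in degrees above \<open>n\<close>, so the maximum is over a bounded
  set of degrees.\<close>

definition Q_cd :: "nat \<Rightarrow> nat \<Rightarrow> ('k::field bipoly, 'a) module \<Rightarrow> nat" where
  "Q_cd m n N = (GREATEST i. nonzero_module (local_cohomology (S_ring m n) N n y_var i))"

definition Q_grade :: "nat \<Rightarrow> nat \<Rightarrow> ('k::field bipoly, 'a) module \<Rightarrow> nat" where
  "Q_grade m n N = grade (S_ring m n) (Q_ideal m n) N"

text \<open>On \<^typ>\<open>nat\<close> the infimum of a nonempty set is its minimum.\<close>

definition Q_mgrade :: "nat \<Rightarrow> nat \<Rightarrow> ('k::field bipoly, 'a) module \<Rightarrow> nat" where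
  "Q_mgrade m n N =
     (INF \<pp>\<in>associated_primes (S_ring m n) N.
        Q_cd m n (quotient_module (regular_module (S_ring m n)) \<pp>))"

definition Q_maximal_depth :: "nat \<Rightarrow> nat \<Rightarrow> ('k::field bipoly, 'a) module \<Rightarrow> bool" where
  "Q_maximal_depth m n N \<longleftrightarrow> Q_grade m n N = Q_mgrade m n N"

end

theory Submission
  imports Defs
begin

text \<open>The associated primes of a direct sum are those of the summands, so \<open>mgrade\<close> of the sum is the
  minimum of the \<open>mgrade\<close> of the summands.  The grade is the length of the initial range of degrees in which
  Koszul cohomology at \<open>y\<^sub>1, \<dots>, y\<^sub>n\<close> vanishes, so it too is a minimum over the summands.  The statement
  then follows from \<open>grade(Q,N) \<le> cd(Q,S/\<pp>)\<close> for \<open>\<pp> = ann(x)\<close> associated to \<open>N\<close>.  To see this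
  inequality, suppose that the local cohomology of \<open>S/\<pp>\<close> vanishes in all degrees at least \<open>g = grade(Q,N)\<close>;
  that of \<open>N\<close> vanishes in degrees below \<open>g\<close>.  Then the embedding of \<open>S/\<pp>\<close> as \<open>Sx\<close> induces the zero map
  on derived torsion, hence also after tensoring with the Koszul complex of \<open>y\<^sub>1\<^sup>q, \<dots>, y\<^sub>n\<^sup>q\<close>, and
  so \<open>x\<close> lies in \<open>(y\<^sub>1\<^sup>q, \<dots>, y\<^sub>n\<^sup>q)N\<close> for every \<open>q\<close>, which contradicts the
  grading.\<close>

section \<open>Sums and submodules\<close>

text \<open>Longest regular sequences of different summands need not be compatible, whereas Koszul
  exactness is tested component by component; this is why the grade is converted to Koszul terms.
  The way back, from exactness to a regular sequence, requires nonzerodivisors in Q, hence prime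
  avoidance and the Noetherian property of S. Derived torsion is made concrete as a double complex:
  Cech cochains indexed by I, whose numerators are Koszul cochains of k-th powers with growing k,
  against Koszul chains of the q-th powers indexed by J. The element x becomes a diagonal cochain,
  which is pushed out of the Cech degrees from g on with primitives in Sx, and out of those below g
  with primitives in N; what is left in degree 0 exhibits x as a combination of the y_j^q. Here q is
  fixed, while k grows with the primitives because fractions agree only up to a power of the
  denominator. The grading enters only through the y-degree: it gives a separated filtration that
  each y_j raises by one step, and finite generation makes it start somewhere.\<close>

lemma (in comm_monoid) finprod_swap:
  assumes "finite A" "finite B" "\<And>i j. i \<in> A \<Longrightarrow> j \<in> B \<Longrightarrow> f i j \<in> carrier G"
  shows "(\<Otimes>i\<in>A. \<Otimes>j\<in>B. f i j) = (\<Otimes>j\<in>B. \<Otimes>i\<in>A. f i j)"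
  using assms(1,3)
proof (induction A)
  case empty
  show ?case by simp
next
  case (insert x A)
  then have "(\<Otimes>i\<in>insert x A. \<Otimes>j\<in>B. f i j) = (\<Otimes>j\<in>B. f x j) \<otimes> (\<Otimes>j\<in>B. \<Otimes>i\<in>A. f i j)"
    by (subst finprod_insert) (auto intro!: finprod_closed)
  also have "\<dots> = (\<Otimes>j\<in>B. f x j \<otimes> (\<Otimes>i\<in>A. f i j))"
    using insert by (subst finprod_multf) (auto intro!: finprod_closed)
  also have "\<dots> = (\<Otimes>j\<in>B. \<Otimes>i\<in>insert x A. f i j)"
    using insert by (intro finprod_cong') (auto intro!: finprod_closed)
  finally show ?case .
qed

lemma (in abelian_monoid) finsum_swap:
  assumes "finite A" "finite B" "\<And>i j. i \<in> A \<Longrightarrow> j \<in> B \<Longrightarrow> f i j \<in> carrier G"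
  shows "(\<Oplus>i\<in>A. \<Oplus>j\<in>B. f i j) = (\<Oplus>j\<in>B. \<Oplus>i\<in>A. f i j)"
  by (rule add.finprod_swap[OF assms])

text \<open>The terms at (j, l) and (l, j) cancel; this gives d d = 0 for both differentials below.
  The diagonal stays out of the sum because antisymmetry would only yield 2 F j j = 0 there.\<close>

lemma (in abelian_group) finsum_antisymmetric:
  assumes "finite A"
    and "\<And>j l. j \<in> A \<Longrightarrow> l \<in> A \<Longrightarrow> j \<noteq> l \<Longrightarrow> F j l \<in> carrier G"
    and "\<And>j l. j \<in> A \<Longrightarrow> l \<in> A \<Longrightarrow> j \<noteq> l \<Longrightarrow> F j l = \<ominus> F l j"
  shows "(\<Oplus>j\<in>A. \<Oplus>l\<in>A-{j}. F j l) = \<zero>"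
  using assms
proof (induction A)
  case empty
  show ?case by simp
next
  case ins0: (insert x A)
  note insert = ins0.hyps
  have c: "F j l \<in> carrier G" if "j \<in> insert x A" "l \<in> insert x A" "j \<noteq> l" for j l
    using ins0.prems that by blast
  have "(\<Oplus>l\<in>insert x A-{j}. F j l) = F j x \<oplus> (\<Oplus>l\<in>A-{j}. F j l)" if "j \<in> A" for j
  proof -
    have "insert x A - {j} = insert x (A - {j})" using that insert by auto
    then show ?thesis using insert that
      by (simp, subst finsum_insert) (auto intro: c)
  qed
  then have "(\<Oplus>j\<in>A. \<Oplus>l\<in>insert x A-{j}. F j l) = (\<Oplus>j\<in>A. F j x \<oplus> (\<Oplus>l\<in>A-{j}. F j l))"
    using insert by (intro finsum_cong') (auto intro!: finsum_closed c)
  also have "\<dots> = (\<Oplus>j\<in>A. F j x) \<oplus> (\<Oplus>j\<in>A. \<Oplus>l\<in>A-{j}. F j l)"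
    using insert by (intro finsum_addf) (auto intro!: finsum_closed c)
  also have "(\<Oplus>j\<in>A. \<Oplus>l\<in>A-{j}. F j l) = \<zero>"
    using ins0 by blast
  finally have "(\<Oplus>j\<in>A. \<Oplus>l\<in>insert x A-{j}. F j l) = (\<Oplus>j\<in>A. F j x) \<oplus> \<zero>" .
  moreover have "(\<Oplus>j\<in>A. F j x) \<in> carrier G"
    using insert by (auto intro!: finsum_closed c)
  ultimately have 1: "(\<Oplus>j\<in>A. \<Oplus>l\<in>insert x A-{j}. F j l) = (\<Oplus>j\<in>A. F j x)"
    by simp
  have ins: "insert x A - {x} = A" using insert by auto
  have "(\<Oplus>j\<in>insert x A. \<Oplus>l\<in>insert x A-{j}. F j l)
      = (\<Oplus>l\<in>insert x A-{x}. F x l) \<oplus> (\<Oplus>j\<in>A. \<Oplus>l\<in>insert x A-{j}. F j l)"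
    by (intro finsum_insert insert) (auto intro!: finsum_closed c)
  also have "\<dots> = (\<Oplus>l\<in>A. F x l) \<oplus> (\<Oplus>j\<in>A. F j x)"
    by (simp only: 1 ins)
  also have "\<dots> = (\<Oplus>j\<in>A. F x j \<oplus> F j x)"
    using insert by (subst finsum_addf) (auto intro!: c)
  also have "\<dots> = (\<Oplus>j\<in>A. \<zero>)"
  proof (intro finsum_cong')
    fix j assume "j \<in> A"
    then have "F x j = \<ominus> F j x" "F j x \<in> carrier G" using ins0.prems insert(2) c by blast+
    then show "F x j \<oplus> F j x = \<zero>" by (simp add: l_neg)
  qed auto
  finally show ?case by simp
qed

lemma (in abelian_group) add_minus_cancel_left:
  "u \<in> carrier G \<Longrightarrow> v \<in> carrier G \<Longrightarrow> (u \<oplus> v) \<ominus> u = v"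
  by (simp add: minus_eq a_comm[of u v] a_assoc r_neg)

lemma (in module) submodule_finsum:
  assumes U: "submodule U R M" and "finite A" "\<And>i. i \<in> A \<Longrightarrow> f i \<in> U"
  shows "(\<Oplus>\<^bsub>M\<^esub>i\<in>A. f i) \<in> U"
  using assms(2,3)
proof (induction A)
  case empty
  then show ?case
    using subgroup.one_closed[OF submodule.axioms(1)[OF U]] by simp
next
  case (insert x A)
  have "U \<subseteq> carrier M" using submoduleE(1)[OF U] .
  with insert show ?case
    by (subst M.finsum_insert) (auto intro: submoduleE(5)[OF U])
qed

lemma (in module) submodule_zero: "submodule U R M \<Longrightarrow> \<zero>\<^bsub>M\<^esub> \<in> U"
  using subgroup.one_closed[OF submodule.axioms(1)] by fastforce

lemma (in module) submodule_minus:
  "submodule U R M \<Longrightarrow> x \<in> U \<Longrightarrow> y \<in> U \<Longrightarrow> x \<ominus>\<^bsub>M\<^esub> y \<in> U"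
  by (simp add: a_minus_def submoduleE(3,5))

lemma (in module) submodule_add_cancel:
  assumes U: "submodule U R M" and u: "u \<in> U" and x: "x \<in> carrier M"
  shows "x \<oplus>\<^bsub>M\<^esub> u \<in> U \<longleftrightarrow> x \<in> U"
proof
  have uc: "u \<in> carrier M" using submoduleE(1)[OF U] u by auto
  assume "x \<oplus>\<^bsub>M\<^esub> u \<in> U"
  then have "(x \<oplus>\<^bsub>M\<^esub> u) \<oplus>\<^bsub>M\<^esub> (\<ominus>\<^bsub>M\<^esub> u) \<in> U"
    using submoduleE(3,5)[OF U] u by auto
  then show "x \<in> U" using uc x by (simp add: M.a_assoc M.r_neg)
qed (use submoduleE(5)[OF U] u in auto)

lemma (in module) submodule_minus_cancel:
  assumes U: "submodule U R M" and "u \<in> U" and x: "x \<in> carrier M"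
  shows "x \<ominus>\<^bsub>M\<^esub> u \<in> U \<longleftrightarrow> x \<in> U"
  using submodule_add_cancel[OF U submoduleE(3)[OF U assms(2)] x] by (simp add: a_minus_def)

text \<open>The submodule U + f M. The Koszul argument handles quotients as submodules of one fixed
  M: a statement about M/U is phrased as membership in U, and dividing further by f only enlarges
  U.\<close>

definition add_multiples :: "('r, 'a, 'c) module_scheme \<Rightarrow> 'a set \<Rightarrow> 'r \<Rightarrow> 'a set" where
  "add_multiples M U f = {u \<oplus>\<^bsub>M\<^esub> f \<odot>\<^bsub>M\<^esub> x | u x. u \<in> U \<and> x \<in> carrier M}"

lemma (in module) submodule_add_multiples:
  assumes U: "submodule U R M" and f: "f \<in> carrier R"
  shows "submodule (add_multiples M U f) R M"
proof (rule submoduleI)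
  have c: "\<And>u. u \<in> U \<Longrightarrow> u \<in> carrier M" using submoduleE(1)[OF U] by auto
  show "add_multiples M U f \<subseteq> carrier M"
    using c f by (auto simp: add_multiples_def)
  show "\<zero>\<^bsub>M\<^esub> \<in> add_multiples M U f"
    using submodule_zero[OF U] f unfolding add_multiples_def
    by (auto intro!: exI[of _ "\<zero>\<^bsub>M\<^esub>"])
  fix a assume "a \<in> add_multiples M U f"
  then obtain u x where a: "u \<in> U" "x \<in> carrier M" "a = u \<oplus>\<^bsub>M\<^esub> f \<odot>\<^bsub>M\<^esub> x"
    by (auto simp: add_multiples_def)
  have "\<ominus>\<^bsub>M\<^esub> a = \<ominus>\<^bsub>M\<^esub> u \<oplus>\<^bsub>M\<^esub> f \<odot>\<^bsub>M\<^esub> (\<ominus>\<^bsub>M\<^esub> x)"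
    using a c f by (simp add: M.minus_add smult_r_minus)
  then show "\<ominus>\<^bsub>M\<^esub> a \<in> add_multiples M U f"
    using a c submoduleE(3)[OF U] unfolding add_multiples_def by blast
  {
    fix b assume "b \<in> add_multiples M U f"
    then obtain v z where b: "v \<in> U" "z \<in> carrier M" "b = v \<oplus>\<^bsub>M\<^esub> f \<odot>\<^bsub>M\<^esub> z"
      by (auto simp: add_multiples_def)
    have "a \<oplus>\<^bsub>M\<^esub> b = (u \<oplus>\<^bsub>M\<^esub> v) \<oplus>\<^bsub>M\<^esub> f \<odot>\<^bsub>M\<^esub> (x \<oplus>\<^bsub>M\<^esub> z)"
      using a b c f by (simp add: smult_r_distr M.a_ac)
    then show "a \<oplus>\<^bsub>M\<^esub> b \<in> add_multiples M U f"
      using a b submoduleE(5)[OF U] unfolding add_multiples_def by blast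
  }
  fix r assume r: "r \<in> carrier R"
  have "r \<odot>\<^bsub>M\<^esub> a = r \<odot>\<^bsub>M\<^esub> u \<oplus>\<^bsub>M\<^esub> f \<odot>\<^bsub>M\<^esub> (r \<odot>\<^bsub>M\<^esub> x)"
    using a c f r by (simp add: smult_r_distr m_comm flip: smult_assoc1)
  then show "r \<odot>\<^bsub>M\<^esub> a \<in> add_multiples M U f"
    using a r c submoduleE(4)[OF U] unfolding add_multiples_def by blast
qed

text \<open>The spare factor c replaces the binomial theorem: one factor a + b is multiplied into c,
  and in the summand with a c (resp. b c) the exponent of a (resp. b) drops by one, so the induction
  on s + t applies to both.\<close>

lemma (in ideal) power_add_mem:
  fixes s t :: nat
  assumes "cring R"
  shows "a \<in> carrier R \<Longrightarrow> b \<in> carrier R \<Longrightarrow> c \<in> carrier R \<Longrightarrow>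
    a [^] s \<otimes> c \<in> I \<Longrightarrow> b [^] t \<otimes> c \<in> I \<Longrightarrow> (a \<oplus> b) [^] (s + t) \<otimes> c \<in> I"
proof (induction "s + t" arbitrary: s t c)
  case 0
  then show ?case by simp
next
  case (Suc N)
  interpret cring R by fact
  consider "s = 0" | "t = 0" | s' t' where "s = Suc s'" "t = Suc t'"
    by (cases s; cases t) auto
  then show ?case
  proof cases
    case 1
    then show ?thesis using Suc I_l_closed by simp
  next
    case 2
    then show ?thesis using Suc I_l_closed by simp
  next
    case 3
    have "a [^] s' \<otimes> (a \<otimes> c) \<in> I" "b [^] t' \<otimes> (b \<otimes> c) \<in> I"
      using Suc.prems 3 by (simp_all add: m_assoc)
    moreover have "a [^] s \<otimes> (b \<otimes> c) \<in> I" "b [^] t \<otimes> (a \<otimes> c) \<in> I"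
      using I_l_closed[of "a [^] s \<otimes> c" b] I_l_closed[of "b [^] t \<otimes> c" a] Suc.prems
      by (simp_all add: m_lcomm)
    ultimately have "(a \<oplus> b) [^] (s' + t) \<otimes> (a \<otimes> c) \<in> I" "(a \<oplus> b) [^] (s + t') \<otimes> (b \<otimes> c) \<in> I"
      using Suc.hyps(1)[of s' t "a \<otimes> c"] Suc.hyps(1)[of s t' "b \<otimes> c"] Suc.hyps(2) Suc.prems 3
      by auto
    then have "(a \<oplus> b) [^] (s' + t) \<otimes> (a \<otimes> c) \<oplus> (a \<oplus> b) [^] (s' + t) \<otimes> (b \<otimes> c) \<in> I"
      using 3 by simp
    also have "(a \<oplus> b) [^] (s' + t) \<otimes> (a \<otimes> c) \<oplus> (a \<oplus> b) [^] (s' + t) \<otimes> (b \<otimes> c)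
        = (a \<oplus> b) [^] (s' + t) \<otimes> ((a \<oplus> b) \<otimes> c)"
      using Suc.prems by (simp add: l_distr r_distr)
    also have "\<dots> = (a \<oplus> b) [^] (s + t) \<otimes> c"
      using Suc.prems 3 by (simp add: m_assoc)
    finally show ?thesis .
  qed
qed

text \<open>The radical of I is an ideal, so it contains all of \<open>Idl A\<close> once it
  contains A.\<close>

lemma (in ideal) genideal_power_mem:
  assumes "cring R" "A \<subseteq> carrier R" "\<And>a. a \<in> A \<Longrightarrow> \<exists>s::nat. a [^] s \<in> I" "f \<in> Idl A"
  shows "\<exists>s::nat. f [^] s \<in> I"
proof -
  interpret cring R by fact
  let ?J = "{f \<in> carrier R. \<exists>s::nat. f [^] s \<in> I}"
  have mult: "(x \<otimes> f) [^] s \<in> I" if "f [^] s \<in> I" "x \<in> carrier R" "f \<in> carrier R" for x f and s :: nat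
    using that by (simp add: nat_pow_distrib I_l_closed)
  have "ideal ?J R"
  proof (intro idealI ring_axioms subgroup.intro)
    fix a b assume "a \<in> ?J" "b \<in> ?J"
    then obtain s t :: nat where "a \<in> carrier R" "b \<in> carrier R" "a [^] s \<in> I" "b [^] t \<in> I"
      by auto
    then have "(a \<oplus> b) [^] (s + t) \<in> I"
      using power_add_mem[OF assms(1), of a b \<one> s t] by simp
    then show "a \<otimes>\<^bsub>add_monoid R\<^esub> b \<in> ?J"
      using \<open>a \<in> carrier R\<close> \<open>b \<in> carrier R\<close> by auto
  next
    fix a assume "a \<in> ?J"
    then obtain s :: nat where a: "a \<in> carrier R" "a [^] s \<in> I" by auto
    then have "(\<ominus> \<one> \<otimes> a) [^] s \<in> I" by (intro mult) auto
    then have "\<ominus> a \<in> ?J" using a by (auto simp: l_minus)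
    then show "inv\<^bsub>add_monoid R\<^esub> a \<in> ?J" by (simp add: a_inv_def)
    fix x assume x: "x \<in> carrier R"
    show "x \<otimes> a \<in> ?J" using mult[OF a(2) x a(1)] x a(1) by auto
    then show "a \<otimes> x \<in> ?J" using x a by (simp add: m_comm)
  next
    have "\<zero> [^] (1::nat) \<in> I" by simp
    then show "\<one>\<^bsub>add_monoid R\<^esub> \<in> ?J" using zero_closed by (metis (no_types, lifting) mem_Collect_eq monoid.simps(2))
  qed auto
  moreover have "A \<subseteq> ?J" using assms(2,3) by auto
  ultimately show ?thesis
    using assms(4) genideal_minimal[of ?J A] by auto
qed

section \<open>Koszul cochains\<close>

locale koszul = module +
  fixes y :: "nat \<Rightarrow> 'a" and n :: nat
  assumes y_closed [simp]: "j \<in> {1..n} \<Longrightarrow> y j \<in> carrier R"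
begin

definition face_sets :: "nat \<Rightarrow> nat set set" where
  "face_sets i = {I. I \<subseteq> {1..n} \<and> card I = i}"

definition coeff :: "nat \<Rightarrow> nat set \<Rightarrow> nat \<Rightarrow> 'a" where
  "coeff k I j = (\<ominus> \<one>) [^] card {l \<in> I. l < j} \<otimes> y j [^] k"

text \<open>Coboundary of the Koszul complex of the k-th powers of the y_j, in all degrees at once.
  At the empty set it is an empty sum, so coboundaries of degree 0 vanish without a separate case.
  In \<open>coeff\<close>, the exponent k = 0 leaves the bare sign, which the contraction below
  uses.\<close>

definition kdiff :: "nat \<Rightarrow> (nat set \<Rightarrow> 'c) \<Rightarrow> nat set \<Rightarrow> 'c" where
  "kdiff k a I = (\<Oplus>\<^bsub>M\<^esub>j\<in>I. coeff k I j \<odot>\<^bsub>M\<^esub> a (I - {j}))"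

lemma face_sets_finite: "I \<in> face_sets i \<Longrightarrow> finite I"
  by (auto simp: face_sets_def intro: finite_subset)

lemma face_sets_subset: "I \<in> face_sets i \<Longrightarrow> I \<subseteq> {1..n}"
  by (auto simp: face_sets_def)

lemma face_sets_remove: "I \<in> face_sets (Suc i) \<Longrightarrow> j \<in> I \<Longrightarrow> I - {j} \<in> face_sets i"
  by (auto simp: face_sets_def)

lemma face_sets_insert:
  "I \<in> face_sets i \<Longrightarrow> j \<in> {1..n} \<Longrightarrow> j \<notin> I \<Longrightarrow> insert j I \<in> face_sets (Suc i)"
  by (auto simp: face_sets_def finite_subset[of _ "{1..n}"])

lemma finite_face_sets: "finite (face_sets i)"
  by (rule finite_subset[of _ "Pow {1..n}"]) (auto simp: face_sets_def)

lemma face_sets_0 [simp]: "face_sets 0 = {{}}"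
  by (auto simp: face_sets_def finite_subset[of _ "{1..n}"])

lemma coeff_closed [simp]: "j \<in> {1..n} \<Longrightarrow> coeff k I j \<in> carrier R"
  by (simp add: coeff_def)

text \<open>For j < l, deleting j moves l one place forward in I, while deleting l does not affect
  the place of j; this one step is the sign.\<close>

lemma coeff_anticommute:
  assumes I: "finite I" "I \<subseteq> {1..n}" "j \<in> I" "l \<in> I" "j \<noteq> l"
  shows "coeff k I j \<otimes> coeff k' (I - {j}) l = \<ominus> (coeff k' I l \<otimes> coeff k (I - {l}) j)"
  using assms
proof (induction j l arbitrary: k k' rule: linorder_wlog)
  case (le j l)
  have yc: "y j \<in> carrier R" "y l \<in> carrier R" using le by auto
  have "{x \<in> I. x < l} = insert j {x \<in> I - {j}. x < l}" using le by auto
  then have 1: "card {x \<in> I. x < l} = Suc (card {x \<in> I - {j}. x < l})"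
    using le by simp
  have 2: "{x \<in> I - {l}. x < j} = {x \<in> I. x < j}" using le by auto
  show ?case
    using yc unfolding coeff_def 1 2
    by (simp add: l_minus r_minus m_ac)
next
  case (sym l j)
  have "j \<in> {1..n}" "l \<in> {1..n}" using sym by auto
  with sym.IH[of k' k] sym.prems show ?case
    by simp
qed

text \<open>Exactly one of two places changes: inserting j shifts l if j < l, and deleting l shifts
  j if l < j.\<close>

lemma coeff_insert_anticommute:
  assumes I: "I \<subseteq> {1..n}" "j \<in> {1..n}" "j \<notin> I" "l \<in> I"
  shows "coeff k I l \<otimes> coeff k' (insert j I - {l}) j = \<ominus> (coeff k' (insert j I) j \<otimes> coeff k (insert j I) l)"
proof -
  have fin: "finite I" using I finite_subset by blast
  have yc: "y j \<in> carrier R" "y l \<in> carrier R" using I by auto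
  consider "l < j" | "j < l" using I by (metis linorder_neqE_nat)
  then show ?thesis
  proof cases
    case 1
    have "{x \<in> insert j I. x < j} = insert l {x \<in> insert j I - {l}. x < j}"
      "{x \<in> insert j I. x < l} = {x \<in> I. x < l}" using 1 I by auto
    then have "card {x \<in> insert j I. x < j} = Suc (card {x \<in> insert j I - {l}. x < j})"
      "card {x \<in> insert j I. x < l} = card {x \<in> I. x < l}"
      using fin by simp_all
    then show ?thesis
      using yc unfolding coeff_def by (simp add: l_minus r_minus m_ac)
  next
    case 2
    have "{x \<in> insert j I. x < l} = insert j {x \<in> I. x < l}"
      "{x \<in> insert j I - {l}. x < j} = {x \<in> insert j I. x < j}" using 2 I by auto
    then have "card {x \<in> insert j I. x < l} = Suc (card {x \<in> I. x < l})"
      "card {x \<in> insert j I - {l}. x < j} = card {x \<in> insert j I. x < j}"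
      using fin I by simp_all
    then show ?thesis
      using yc unfolding coeff_def by (simp add: l_minus r_minus m_ac)
  qed
qed

lemma kdiff_closed:
  assumes "I \<subseteq> {1..n}" "\<And>J. a J \<in> carrier M"
  shows "kdiff k a I \<in> carrier M"
  using assms unfolding kdiff_def by (intro M.finsum_closed) auto

lemma kdiff_cong:
  assumes "I \<in> face_sets (Suc i)" "\<And>J. b J \<in> carrier M" "\<And>J. J \<in> face_sets i \<Longrightarrow> a J = b J"
  shows "kdiff k a I = kdiff k b I"
  unfolding kdiff_def
proof (intro M.finsum_cong')
  show "(\<lambda>j. coeff k I j \<odot>\<^bsub>M\<^esub> b (I - {j})) \<in> I \<rightarrow> carrier M"
    using assms face_sets_subset by fastforce
qed (use assms face_sets_remove in auto)

lemma kdiff_empty [simp]: "kdiff k a {} = \<zero>\<^bsub>M\<^esub>"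
  by (simp add: kdiff_def)

lemma kdiff_zero: "I \<subseteq> {1..n} \<Longrightarrow> kdiff k (\<lambda>_. \<zero>\<^bsub>M\<^esub>) I = \<zero>\<^bsub>M\<^esub>"
proof -
  assume I: "I \<subseteq> {1..n}"
  have "kdiff k (\<lambda>_. \<zero>\<^bsub>M\<^esub>) I = (\<Oplus>\<^bsub>M\<^esub>j\<in>I. \<zero>\<^bsub>M\<^esub>)"
    unfolding kdiff_def using I by (intro M.finsum_cong') auto
  then show ?thesis by simp
qed

lemma kdiff_add:
  assumes "I \<subseteq> {1..n}" "\<And>J. a J \<in> carrier M" "\<And>J. b J \<in> carrier M"
  shows "kdiff k (\<lambda>J. a J \<oplus>\<^bsub>M\<^esub> b J) I = kdiff k a I \<oplus>\<^bsub>M\<^esub> kdiff k b I"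
proof -
  have "kdiff k (\<lambda>J. a J \<oplus>\<^bsub>M\<^esub> b J) I
    = (\<Oplus>\<^bsub>M\<^esub>j\<in>I. coeff k I j \<odot>\<^bsub>M\<^esub> a (I - {j}) \<oplus>\<^bsub>M\<^esub> coeff k I j \<odot>\<^bsub>M\<^esub> b (I - {j}))"
    unfolding kdiff_def using assms
    by (intro M.finsum_cong') (auto simp: smult_r_distr)
  also have "\<dots> = kdiff k a I \<oplus>\<^bsub>M\<^esub> kdiff k b I"
    unfolding kdiff_def using assms by (intro M.finsum_addf) auto
  finally show ?thesis .
qed

lemma kdiff_smult:
  assumes "I \<subseteq> {1..n}" "\<And>J. a J \<in> carrier M" "r \<in> carrier R"
  shows "kdiff k (\<lambda>J. r \<odot>\<^bsub>M\<^esub> a J) I = r \<odot>\<^bsub>M\<^esub> kdiff k a I"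
proof -
  have fin: "finite I" using assms(1) finite_subset by blast
  have "r \<odot>\<^bsub>M\<^esub> kdiff k a I = (\<Oplus>\<^bsub>M\<^esub>j\<in>I. r \<odot>\<^bsub>M\<^esub> (coeff k I j \<odot>\<^bsub>M\<^esub> a (I - {j})))"
    unfolding kdiff_def using assms fin by (intro finsum_smult_ldistr) auto
  also have "\<dots> = kdiff k (\<lambda>J. r \<odot>\<^bsub>M\<^esub> a J) I"
    unfolding kdiff_def
  proof (intro M.finsum_cong')
    fix j assume "j \<in> I"
    then have "coeff k I j \<in> carrier R" using assms by auto
    then show "r \<odot>\<^bsub>M\<^esub> (coeff k I j \<odot>\<^bsub>M\<^esub> a (I - {j})) = coeff k I j \<odot>\<^bsub>M\<^esub> (r \<odot>\<^bsub>M\<^esub> a (I - {j}))"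
      using assms(2,3) by (metis R.m_comm smult_assoc1)
  qed (use assms in auto)
  finally show ?thesis by simp
qed

lemma kdiff_minus:
  assumes "I \<subseteq> {1..n}" "\<And>J. a J \<in> carrier M" "\<And>J. b J \<in> carrier M"
  shows "kdiff k (\<lambda>J. a J \<ominus>\<^bsub>M\<^esub> b J) I = kdiff k a I \<ominus>\<^bsub>M\<^esub> kdiff k b I"
proof -
  have "(\<lambda>J. a J \<ominus>\<^bsub>M\<^esub> b J) = (\<lambda>J. a J \<oplus>\<^bsub>M\<^esub> (\<ominus> \<one>) \<odot>\<^bsub>M\<^esub> b J)"
    using assms by (simp add: a_minus_def smult_l_minus)
  then show ?thesis
    using assms kdiff_closed[OF assms(1), of b k]
      kdiff_add[OF assms(1), of a "\<lambda>J. (\<ominus> \<one>) \<odot>\<^bsub>M\<^esub> b J" k] kdiff_smult[OF assms(1), of b "\<ominus> \<one>" k]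
    by (simp add: smult_l_minus a_minus_def)
qed

lemma kdiff_mem:
  assumes U: "submodule U R M" and "I \<in> face_sets (Suc i)" "\<And>J. J \<in> face_sets i \<Longrightarrow> a J \<in> U"
  shows "kdiff k a I \<in> U"
  unfolding kdiff_def
  using assms face_sets_remove face_sets_finite face_sets_subset[OF assms(2)]
  by (intro submodule_finsum[OF U]) (auto intro!: submoduleE(4)[OF U])

lemma kdiff_kdiff:
  assumes I: "I \<subseteq> {1..n}" and a: "\<And>J. a J \<in> carrier M"
  shows "kdiff k (kdiff k a) I = \<zero>\<^bsub>M\<^esub>"
proof -
  have fin: "finite I" using I finite_subset by blast
  define F where "F j l = (coeff k I j \<otimes> coeff k (I - {j}) l) \<odot>\<^bsub>M\<^esub> a (I - {j} - {l})" for j l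
  have c: "coeff k J j \<in> carrier R" if "j \<in> I" for j J using I that by auto
  have "kdiff k (kdiff k a) I = (\<Oplus>\<^bsub>M\<^esub>j\<in>I. \<Oplus>\<^bsub>M\<^esub>l\<in>I-{j}. F j l)"
    unfolding kdiff_def[of _ "kdiff k a"]
  proof (intro M.finsum_cong')
    fix j assume j: "j \<in> I"
    then have "coeff k I j \<odot>\<^bsub>M\<^esub> kdiff k a (I - {j})
      = (\<Oplus>\<^bsub>M\<^esub>l\<in>I-{j}. coeff k I j \<odot>\<^bsub>M\<^esub> (coeff k (I - {j}) l \<odot>\<^bsub>M\<^esub> a (I - {j} - {l})))"
      unfolding kdiff_def using c a fin by (intro finsum_smult_ldistr) auto
    also have "\<dots> = (\<Oplus>\<^bsub>M\<^esub>l\<in>I-{j}. F j l)"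
      using j c a by (intro M.finsum_cong') (auto simp: F_def smult_assoc1)
    finally show "coeff k I j \<odot>\<^bsub>M\<^esub> kdiff k a (I - {j}) = (\<Oplus>\<^bsub>M\<^esub>l\<in>I-{j}. F j l)" .
  qed (use c a in \<open>auto simp: F_def intro!: M.finsum_closed\<close>)
  also have "\<dots> = \<zero>\<^bsub>M\<^esub>"
  proof (rule M.finsum_antisymmetric[OF fin])
    fix j l assume jl: "j \<in> I" "l \<in> I" "j \<noteq> l"
    then show "F j l \<in> carrier M" using c a by (auto simp: F_def)
    have "I - {j} - {l} = I - {l} - {j}" by auto
    then show "F j l = \<ominus>\<^bsub>M\<^esub> F l j"
      using coeff_anticommute[OF fin I jl, of k k] c a jl
      by (simp add: F_def smult_l_minus)
  qed
  finally show ?thesis .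
qed

text \<open>The contraction showing that \<open>y\<^sub>j\<^sup>k\<close> annihilates Koszul cohomology.\<close>

definition homotopy :: "nat \<Rightarrow> (nat set \<Rightarrow> 'c) \<Rightarrow> nat set \<Rightarrow> 'c" where
  "homotopy j a I = (if j \<in> I then \<zero>\<^bsub>M\<^esub> else coeff 0 (insert j I) j \<odot>\<^bsub>M\<^esub> a (insert j I))"

lemma homotopy_closed:
  "j \<in> {1..n} \<Longrightarrow> (\<And>J. a J \<in> carrier M) \<Longrightarrow> homotopy j a I \<in> carrier M"
  by (auto simp: homotopy_def)

lemma coeff_mult_self: "j \<in> {1..n} \<Longrightarrow> coeff 0 I j \<otimes> coeff k I j = y j [^] k"
proof -
  assume j: "j \<in> {1..n}"
  have "(\<ominus> \<one>) [^] m \<otimes> (\<ominus> \<one>) [^] m = \<one>" for m :: nat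
    by (induction m) (auto simp: m_ac l_minus r_minus)
  then show ?thesis using y_closed[OF j] unfolding coeff_def
    by (simp flip: m_assoc)
qed

text \<open>If j is in I, the second summand is zero and only the term at j survives in the first.
  If not, the term at j of the second summand is the right-hand side, and its remaining terms cancel
  against the first summand by \<open>coeff_insert_anticommute\<close>.\<close>

lemma homotopy_formula:
  assumes I: "I \<subseteq> {1..n}" and a: "\<And>J. a J \<in> carrier M" and j: "j \<in> {1..n}"
  shows "kdiff k (homotopy j a) I \<oplus>\<^bsub>M\<^esub> homotopy j (kdiff k a) I = y j [^] k \<odot>\<^bsub>M\<^esub> a I"
proof (cases "j \<in> I")
  case True
  have fin: "finite I" using I finite_subset by blast
  have c: "coeff k J l \<in> carrier R" if "l \<in> I" for l J k using I that by auto
  have ins: "insert j (I - {j}) = I" using True by auto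
  have "kdiff k (homotopy j a) I
    = (\<Oplus>\<^bsub>M\<^esub>l\<in>I. if j = l then coeff k I l \<odot>\<^bsub>M\<^esub> homotopy j a (I - {l}) else \<zero>\<^bsub>M\<^esub>)"
    unfolding kdiff_def using True c homotopy_closed[OF j, of a] a j
    by (intro M.finsum_cong') (auto simp: homotopy_def)
  also have "\<dots> = coeff k I j \<odot>\<^bsub>M\<^esub> homotopy j a (I - {j})"
    using fin True c homotopy_closed[OF j, of a] a by (intro M.finsum_singleton) auto
  also have "\<dots> = y j [^] k \<odot>\<^bsub>M\<^esub> a I"
    using True c[OF True] a coeff_mult_self[OF j, of I k]
    by (simp add: homotopy_def ins insert_absorb m_comm flip: smult_assoc1)
  finally show ?thesis
    using True a j by (simp add: homotopy_def)
next
  case False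
  have fin: "finite I" using I finite_subset by blast
  let ?I = "insert j I"
  have c: "coeff k J l \<in> carrier R" if "l \<in> ?I" for l J k using I j that by auto
  let ?T = "\<lambda>l. (coeff 0 ?I j \<otimes> coeff k ?I l) \<odot>\<^bsub>M\<^esub> a (?I - {l})"
  have ins: "?I - {j} = I" using False by auto
  have "homotopy j (kdiff k a) I = coeff 0 ?I j \<odot>\<^bsub>M\<^esub> (\<Oplus>\<^bsub>M\<^esub>l\<in>?I. coeff k ?I l \<odot>\<^bsub>M\<^esub> a (?I - {l}))"
    using False by (simp add: homotopy_def kdiff_def)
  also have "\<dots> = (\<Oplus>\<^bsub>M\<^esub>l\<in>?I. coeff 0 ?I j \<odot>\<^bsub>M\<^esub> (coeff k ?I l \<odot>\<^bsub>M\<^esub> a (?I - {l})))"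
    using fin j c a by (intro finsum_smult_ldistr) auto
  also have "\<dots> = (\<Oplus>\<^bsub>M\<^esub>l\<in>?I. ?T l)"
    using fin j c a by (intro M.finsum_cong') (auto simp: smult_assoc1)
  also have "\<dots> = ?T j \<oplus>\<^bsub>M\<^esub> (\<Oplus>\<^bsub>M\<^esub>l\<in>I. ?T l)"
    using fin False c a by (intro M.finsum_insert) auto
  also have "?T j = y j [^] k \<odot>\<^bsub>M\<^esub> a I"
    using coeff_mult_self[OF j] by (simp add: ins)
  finally have 1: "homotopy j (kdiff k a) I = y j [^] k \<odot>\<^bsub>M\<^esub> a I \<oplus>\<^bsub>M\<^esub> (\<Oplus>\<^bsub>M\<^esub>l\<in>I. ?T l)" .
  have "kdiff k (homotopy j a) I = (\<Oplus>\<^bsub>M\<^esub>l\<in>I. \<ominus> \<one> \<odot>\<^bsub>M\<^esub> ?T l)"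
    unfolding kdiff_def
  proof (intro M.finsum_cong')
    fix l assume l: "l \<in> I"
    then have jl: "j \<noteq> l" using False by auto
    have ins2: "insert j (I - {l}) = ?I - {l}" using jl by auto
    have "coeff k I l \<odot>\<^bsub>M\<^esub> homotopy j a (I - {l}) = (coeff k I l \<otimes> coeff 0 (?I - {l}) j) \<odot>\<^bsub>M\<^esub> a (?I - {l})"
      using False l c a by (simp add: homotopy_def ins2 smult_assoc1)
    also have "coeff k I l \<otimes> coeff 0 (?I - {l}) j = \<ominus> (coeff 0 ?I j \<otimes> coeff k ?I l)"
      using coeff_insert_anticommute[OF I j False l] by simp
    finally show "coeff k I l \<odot>\<^bsub>M\<^esub> homotopy j a (I - {l}) = \<ominus> \<one> \<odot>\<^bsub>M\<^esub> ?T l"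
      using c l a by (simp add: smult_l_minus)
  qed (use c a in auto)
  also have "\<dots> = \<ominus> \<one> \<odot>\<^bsub>M\<^esub> (\<Oplus>\<^bsub>M\<^esub>l\<in>I. ?T l)"
    using fin c a by (intro finsum_smult_ldistr[symmetric]) auto
  also have "\<dots> = \<ominus>\<^bsub>M\<^esub> (\<Oplus>\<^bsub>M\<^esub>l\<in>I. ?T l)"
    using fin c a by (simp add: smult_l_minus M.finsum_closed)
  finally have 2: "kdiff k (homotopy j a) I = \<ominus>\<^bsub>M\<^esub> (\<Oplus>\<^bsub>M\<^esub>l\<in>I. ?T l)" .
  have "(\<Oplus>\<^bsub>M\<^esub>l\<in>I. ?T l) \<in> carrier M" using c a by (intro M.finsum_closed) auto
  moreover have "y j [^] k \<odot>\<^bsub>M\<^esub> a I \<in> carrier M" using j a by simp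
  ultimately show ?thesis unfolding 1 2
    by (simp only: M.a_comm[of "y j [^] k \<odot>\<^bsub>M\<^esub> a I"] M.r_neg1)
qed

text \<open>Koszul cohomology of \<open>M / U\<close> at the powers \<open>y\<^sub>1\<^sup>k, \<dots>, y\<^sub>n\<^sup>k\<close> vanishes in degree \<open>i\<close>;
  a cochain is a function on index sets whose values off \<open>face_sets i\<close> are irrelevant.\<close>

definition koszul_exact :: "nat \<Rightarrow> 'c set \<Rightarrow> nat \<Rightarrow> bool" where
  "koszul_exact k U i \<longleftrightarrow>
    (\<forall>a. (\<forall>I. a I \<in> carrier M) \<and> (\<forall>J\<in>face_sets (Suc i). kdiff k a J \<in> U) \<longrightarrow>
      (\<exists>b. (\<forall>I. b I \<in> carrier M) \<and> (\<forall>I\<in>face_sets i. a I \<ominus>\<^bsub>M\<^esub> kdiff k b I \<in> U)))"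

text \<open>The r for which r a is a coboundary modulo U form an ideal. It contains each y_j^k by
  the contraction, hence a power of every element of Q.\<close>

lemma torsion:
  assumes U: "submodule U R M" and a: "\<And>J. a J \<in> carrier M"
    and cyc: "\<And>J. J \<in> face_sets (Suc i) \<Longrightarrow> kdiff k a J \<in> U"
    and f: "f \<in> Idl (y ` {1..n})"
  shows "\<exists>s::nat. \<exists>b. (\<forall>I. b I \<in> carrier M) \<and> (\<forall>I\<in>face_sets i. f [^] s \<odot>\<^bsub>M\<^esub> a I \<ominus>\<^bsub>M\<^esub> kdiff k b I \<in> U)"
proof -
  let ?P = "\<lambda>r b. (\<forall>I. b I \<in> carrier M) \<and> (\<forall>I\<in>face_sets i. r \<odot>\<^bsub>M\<^esub> a I \<ominus>\<^bsub>M\<^esub> kdiff k b I \<in> U)"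
  let ?T = "{r \<in> carrier R. \<exists>b. ?P r b}"
  have add: "?P (r \<oplus> r') (\<lambda>I. b I \<oplus>\<^bsub>M\<^esub> b' I)"
    if "?P r b" "?P r' b'" "r \<in> carrier R" "r' \<in> carrier R" for r r' b b'
  proof (intro conjI ballI allI)
    fix I assume I: "I \<in> face_sets i"
    have "kdiff k b I \<in> carrier M" "kdiff k b' I \<in> carrier M"
      using that face_sets_subset[OF I] by (auto intro!: kdiff_closed)
    then have "(r \<oplus> r') \<odot>\<^bsub>M\<^esub> a I \<ominus>\<^bsub>M\<^esub> kdiff k (\<lambda>I. b I \<oplus>\<^bsub>M\<^esub> b' I) I
      = (r \<odot>\<^bsub>M\<^esub> a I \<ominus>\<^bsub>M\<^esub> kdiff k b I) \<oplus>\<^bsub>M\<^esub> (r' \<odot>\<^bsub>M\<^esub> a I \<ominus>\<^bsub>M\<^esub> kdiff k b' I)"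
      using that a face_sets_subset[OF I]
      by (simp add: kdiff_add smult_l_distr a_minus_def M.minus_add M.a_ac)
    then show "(r \<oplus> r') \<odot>\<^bsub>M\<^esub> a I \<ominus>\<^bsub>M\<^esub> kdiff k (\<lambda>I. b I \<oplus>\<^bsub>M\<^esub> b' I) I \<in> U"
      using that I submoduleE(5)[OF U] by auto
  qed (use that in auto)
  have mult: "?P (x \<otimes> r) (\<lambda>I. x \<odot>\<^bsub>M\<^esub> b I)"
    if "?P r b" "r \<in> carrier R" "x \<in> carrier R" for r x b
  proof (intro conjI ballI allI)
    fix I assume I: "I \<in> face_sets i"
    have "kdiff k b I \<in> carrier M"
      using that face_sets_subset[OF I] by (auto intro!: kdiff_closed)
    then have "(x \<otimes> r) \<odot>\<^bsub>M\<^esub> a I \<ominus>\<^bsub>M\<^esub> kdiff k (\<lambda>I. x \<odot>\<^bsub>M\<^esub> b I) I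
      = x \<odot>\<^bsub>M\<^esub> (r \<odot>\<^bsub>M\<^esub> a I \<ominus>\<^bsub>M\<^esub> kdiff k b I)"
      using that a face_sets_subset[OF I]
      by (simp add: kdiff_smult smult_assoc1 a_minus_def smult_r_distr smult_r_minus)
    then show "(x \<otimes> r) \<odot>\<^bsub>M\<^esub> a I \<ominus>\<^bsub>M\<^esub> kdiff k (\<lambda>I. x \<odot>\<^bsub>M\<^esub> b I) I \<in> U"
      using that I submoduleE(4)[OF U] by auto
  qed (use that in auto)
  have T: "ideal ?T R"
  proof (intro idealI R.ring_axioms subgroup.intro)
    fix r r' assume r: "r \<in> ?T" "r' \<in> ?T"
    then obtain b b' where "?P r b" "?P r' b'" by auto
    then have "?P (r \<oplus> r') (\<lambda>I. b I \<oplus>\<^bsub>M\<^esub> b' I)" using r by (intro add) auto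
    then show "r \<otimes>\<^bsub>add_monoid R\<^esub> r' \<in> ?T" using r by auto
  next
    fix r assume r: "r \<in> ?T"
    have m: "x \<otimes> r \<in> ?T" if "x \<in> carrier R" for x
    proof -
      from r obtain b where "?P r b" by auto
      then have "?P (x \<otimes> r) (\<lambda>I. x \<odot>\<^bsub>M\<^esub> b I)" using r that by (intro mult) auto
      then show ?thesis using r that by auto
    qed
    have "\<ominus> \<one> \<otimes> r \<in> ?T" by (rule m) simp
    moreover have "\<ominus> \<one> \<otimes> r = inv\<^bsub>add_monoid R\<^esub> r" using r by (simp add: l_minus flip: a_inv_def)
    ultimately show "inv\<^bsub>add_monoid R\<^esub> r \<in> ?T" by simp
    fix x assume x: "x \<in> carrier R"
    show "x \<otimes> r \<in> ?T" by (rule m[OF x])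
    then show "r \<otimes> x \<in> ?T" using x r by (simp add: m_comm)
  next
    have "?P \<zero> (\<lambda>_. \<zero>\<^bsub>M\<^esub>)"
      using a kdiff_zero face_sets_subset submodule_zero[OF U] submoduleE(3)[OF U submodule_zero[OF U]]
      by (auto simp: M.minus_eq)
    then show "\<one>\<^bsub>add_monoid R\<^esub> \<in> ?T" by auto
  qed auto
  have pow: "\<exists>s::nat. x [^] s \<in> ?T" if "x \<in> y ` {1..n}" for x
  proof -
    from that obtain j where j: "j \<in> {1..n}" "x = y j" by auto
    \<comment> \<open>By \<open>homotopy_formula\<close> the defect y_j^k a - d h a equals h d a. At
      I this is zero or, up to sign, the value of d a at \<open>insert j I\<close>, a face of the
      next size, where d a lies in U.\<close>
    have "?P (x [^] k) (homotopy j a)"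
    proof (intro conjI allI ballI)
      fix I assume I: "I \<in> face_sets i"
      have "homotopy j (kdiff k a) I \<in> U"
        using cyc I j face_sets_insert[OF I j(1)] submodule_zero[OF U] submoduleE(4)[OF U]
        by (auto simp: homotopy_def)
      moreover have "x [^] k \<odot>\<^bsub>M\<^esub> a I \<ominus>\<^bsub>M\<^esub> kdiff k (homotopy j a) I = homotopy j (kdiff k a) I"
      proof -
        have "kdiff k (homotopy j a) I \<in> carrier M"
          using homotopy_closed[OF j(1) a] face_sets_subset[OF I] by (intro kdiff_closed) auto
        moreover have "homotopy j (kdiff k a) I \<in> carrier M"
          using \<open>homotopy j (kdiff k a) I \<in> U\<close> submoduleE(1)[OF U] by auto
        ultimately have "(kdiff k (homotopy j a) I \<oplus>\<^bsub>M\<^esub> homotopy j (kdiff k a) I) \<ominus>\<^bsub>M\<^esub> kdiff k (homotopy j a) I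
            = homotopy j (kdiff k a) I"
          by (rule M.add_minus_cancel_left)
        then show ?thesis
          using homotopy_formula[OF face_sets_subset[OF I] _ j(1), where a = a and k = k] a j(2) by simp
      qed
      ultimately show "x [^] k \<odot>\<^bsub>M\<^esub> a I \<ominus>\<^bsub>M\<^esub> kdiff k (homotopy j a) I \<in> U" by simp
    qed (use homotopy_closed[OF j(1) a] in auto)
    then show ?thesis using j by auto
  qed
  have "y ` {1..n} \<subseteq> carrier R" using y_closed by blast
  then have "\<exists>s::nat. f [^] s \<in> ?T"
    by (rule ideal.genideal_power_mem[OF T R.is_cring _ pow f])
  then show ?thesis by auto
qed

end

section \<open>Koszul exactness and regular sequences\<close>

primrec rel_regular :: "('r, 'a, 'c) module_scheme \<Rightarrow> 'a set \<Rightarrow> 'r list \<Rightarrow> bool" where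
  "rel_regular M U [] = True"
| "rel_regular M U (f # fs) =
     ((\<forall>x\<in>carrier M. f \<odot>\<^bsub>M\<^esub> x \<in> U \<longrightarrow> x \<in> U) \<and> rel_regular M (add_multiples M U f) fs)"

lemma (in abelian_group) diff_zero [simp]: "x \<in> carrier G \<Longrightarrow> x \<ominus> \<zero> = x"
  using add.inv_one by (simp add: a_minus_def a_inv_def)

lemma (in module) add_multiples_choice:
  assumes U: "submodule U R M" and g: "\<forall>I\<in>A. g I \<in> add_multiples M U f"
  shows "\<exists>u b. (\<forall>I. u I \<in> U) \<and> (\<forall>I. b I \<in> carrier M) \<and> (\<forall>I\<in>A. g I = u I \<oplus>\<^bsub>M\<^esub> f \<odot>\<^bsub>M\<^esub> b I)"
proof -
  have "\<forall>I\<in>A. \<exists>p. fst p \<in> U \<and> snd p \<in> carrier M \<and> g I = fst p \<oplus>\<^bsub>M\<^esub> f \<odot>\<^bsub>M\<^esub> snd p"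
    using g by (fastforce simp: add_multiples_def)
  then obtain p where p: "\<forall>I\<in>A. fst (p I) \<in> U \<and> snd (p I) \<in> carrier M \<and> g I = fst (p I) \<oplus>\<^bsub>M\<^esub> f \<odot>\<^bsub>M\<^esub> snd (p I)"
    by (rule bchoice[THEN exE])
  show ?thesis
    by (intro exI[of _ "\<lambda>I. if I \<in> A then fst (p I) else \<zero>\<^bsub>M\<^esub>"] exI[of _ "\<lambda>I. if I \<in> A then snd (p I) else \<zero>\<^bsub>M\<^esub>"])
      (use p submodule_zero[OF U] in auto)
qed

context koszul
begin

lemma ideal_Q: "ideal (Idl (y ` {1..n})) R"
  by (intro R.genideal_ideal) auto

lemma Q_closed: "f \<in> Idl (y ` {1..n}) \<Longrightarrow> f \<in> carrier R"
  using ideal.Icarr[OF ideal_Q] .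

lemma koszul_exactD:
  assumes "koszul_exact k U i" "\<And>I. a I \<in> carrier M" "\<And>J. J \<in> face_sets (Suc i) \<Longrightarrow> kdiff k a J \<in> U"
  shows "\<exists>b. (\<forall>I. b I \<in> carrier M) \<and> (\<forall>I\<in>face_sets i. a I \<ominus>\<^bsub>M\<^esub> kdiff k b I \<in> U)"
  using assms(1) unfolding koszul_exact_def by (elim allE[of _ a]) (use assms(2,3) in auto)

text \<open>Induction along the sequence. By \<open>torsion\<close> some f^s a is a coboundary
  modulo U, and each power of f can be cancelled thanks to exactness one degree lower for M/(U + f
  M). \<open>rel_regular\<close> records only the nonzerodivisor conditions; the nonzero last
  quotient is dealt with in \<open>regular_sequence_iff\<close>.\<close>

lemma koszul_exact_if_regular:
  assumes "submodule U R M" "rel_regular M U fs" "set fs \<subseteq> Idl (y ` {1..n})" "i < length fs"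
  shows "koszul_exact k U i"
  using assms
proof (induction fs arbitrary: U i)
  case Nil
  then show ?case by simp
next
  case (Cons f fs)
  note U = Cons.prems(1)
  have Uc: "\<And>u. u \<in> U \<Longrightarrow> u \<in> carrier M" using submoduleE(1)[OF U] by auto
  have f: "f \<in> carrier R" "f \<in> Idl (y ` {1..n})" using Cons.prems(3) Q_closed by auto
  have reg: "\<And>x. x \<in> carrier M \<Longrightarrow> f \<odot>\<^bsub>M\<^esub> x \<in> U \<Longrightarrow> x \<in> U"
    using Cons.prems(2) by auto
  let ?V = "add_multiples M U f"
  have V: "submodule ?V R M" by (rule submodule_add_multiples[OF U f(1)])
  show ?case
    unfolding koszul_exact_def
  proof (intro allI impI, elim conjE)
    fix a assume a': "\<forall>I. a I \<in> carrier M" and cyc: "\<forall>J\<in>face_sets (Suc i). kdiff k a J \<in> U"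
    have a: "\<And>J. a J \<in> carrier M" using a' by auto
    let ?E = "\<lambda>s b. (\<forall>I. b I \<in> carrier M) \<and>
      (\<forall>I\<in>face_sets i. f [^] (s::nat) \<odot>\<^bsub>M\<^esub> a I \<ominus>\<^bsub>M\<^esub> kdiff k b I \<in> U)"
    \<comment> \<open>If f^(s+1) a = d b modulo U, then d b vanishes modulo U + f M. The induction
      hypothesis gives b = d e + u + f b' with u in U, so d b = d u + f d b', and f cancels in f
      (f^s a - d b') modulo U. In degree 0 the coboundary d b is zero and f cancels at once.\<close>
    have descend: "\<exists>b. ?E s b" if "?E (Suc s) b" for s b
    proof -
      have b: "\<And>J. b J \<in> carrier M" using that by auto
      have fa: "\<And>I. f [^] s \<odot>\<^bsub>M\<^esub> a I \<in> carrier M" using f a by auto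
      have fs: "f [^] Suc s \<odot>\<^bsub>M\<^esub> a I = f \<odot>\<^bsub>M\<^esub> (f [^] s \<odot>\<^bsub>M\<^esub> a I)" for I
        using f a by (simp add: m_comm flip: smult_assoc1)
      show ?thesis
      proof (cases i)
        case 0
        have "f \<odot>\<^bsub>M\<^esub> (f [^] s \<odot>\<^bsub>M\<^esub> a {}) \<in> U"
        proof -
          have "f [^] Suc s \<odot>\<^bsub>M\<^esub> a {} \<ominus>\<^bsub>M\<^esub> \<zero>\<^bsub>M\<^esub> \<in> U"
            using that by (simp add: 0 del: R.nat_pow_Suc)
          then show ?thesis using fa[of "{}"] f unfolding fs by simp
        qed
        then have "f [^] s \<odot>\<^bsub>M\<^esub> a {} \<in> U" using reg fa by blast
        then have "?E s b" using that fa[of "{}"] by (simp add: 0)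
        then show ?thesis by blast
      next
        case (Suc i')
        have "kdiff k b J \<in> ?V" if J: "J \<in> face_sets (Suc i')" for J
        proof -
          have "f [^] Suc s \<odot>\<^bsub>M\<^esub> a J \<ominus>\<^bsub>M\<^esub> kdiff k b J \<in> U"
            using \<open>?E (Suc s) b\<close> J Suc by auto
          then have 1: "\<ominus>\<^bsub>M\<^esub> (f [^] Suc s \<odot>\<^bsub>M\<^esub> a J \<ominus>\<^bsub>M\<^esub> kdiff k b J) \<in> U" (is "?u \<in> U")
            by (rule submoduleE(3)[OF U])
          have c: "kdiff k b J \<in> carrier M" using kdiff_closed[OF face_sets_subset[OF J] b] .
          have "kdiff k b J = ?u \<oplus>\<^bsub>M\<^esub> f \<odot>\<^bsub>M\<^esub> (f [^] s \<odot>\<^bsub>M\<^esub> a J)"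
            using c fa[of J] f unfolding fs
            by (simp add: a_minus_def M.minus_add M.minus_minus M.a_ac M.r_neg1 M.r_neg2 M.r_neg)
          then show ?thesis using 1 fa unfolding add_multiples_def by blast
        qed
        then obtain e where e: "\<And>I. e I \<in> carrier M"
          "\<And>I. I \<in> face_sets i' \<Longrightarrow> b I \<ominus>\<^bsub>M\<^esub> kdiff k e I \<in> ?V"
        proof -
          have ex: "koszul_exact k ?V i'" using Cons.IH[OF V, of i'] Cons.prems Suc by simp
          show thesis
            using koszul_exactD[OF ex b \<open>\<And>J. J \<in> face_sets (Suc i') \<Longrightarrow> kdiff k b J \<in> ?V\<close>] that by auto
        qed
        have e2: "\<forall>I\<in>face_sets i'. b I \<ominus>\<^bsub>M\<^esub> kdiff k e I \<in> ?V" using e(2) by blast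
        obtain u b' where ub': "\<forall>I. u I \<in> U" "\<forall>I. b' I \<in> carrier M"
          "\<forall>I\<in>face_sets i'. b I \<ominus>\<^bsub>M\<^esub> kdiff k e I = u I \<oplus>\<^bsub>M\<^esub> f \<odot>\<^bsub>M\<^esub> b' I"
          using add_multiples_choice[where A = "face_sets i'" and g = "\<lambda>I. b I \<ominus>\<^bsub>M\<^esub> kdiff k e I", OF U e2]
          by (elim exE conjE) (rule that; assumption)
        note ub = ub'[rule_format]
        have "f [^] s \<odot>\<^bsub>M\<^esub> a I \<ominus>\<^bsub>M\<^esub> kdiff k b' I \<in> U" if I: "I \<in> face_sets i" for I
        proof -
          note Is = face_sets_subset[OF I]
          have I': "I \<in> face_sets (Suc i')" using I Suc by simp
          have uc: "\<And>J. u J \<in> carrier M" using ub(1) Uc by auto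
          have kc: "kdiff k u I \<in> carrier M" "kdiff k b' I \<in> carrier M" "kdiff k b I \<in> carrier M"
            using Is uc ub b by (auto intro!: kdiff_closed)
          \<comment> \<open>\<open>kdiff k e\<close> is known to lie in the carrier only on subsets
            of {1..n}. The guard makes the cochain total, and the sum at I meets only such
            subsets.\<close>
          have "kdiff k b I = kdiff k (\<lambda>J. (u J \<oplus>\<^bsub>M\<^esub> f \<odot>\<^bsub>M\<^esub> b' J) \<oplus>\<^bsub>M\<^esub> (if J \<subseteq> {1..n} then kdiff k e J else \<zero>\<^bsub>M\<^esub>)) I"
          proof (rule kdiff_cong[OF I'])
            fix J assume J: "J \<in> face_sets i'"
            have ke: "kdiff k e J \<in> carrier M" by (rule kdiff_closed[OF face_sets_subset[OF J] e(1)])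
            have "b J = (b J \<ominus>\<^bsub>M\<^esub> kdiff k e J) \<oplus>\<^bsub>M\<^esub> kdiff k e J"
              using ke b by (simp add: a_minus_def M.a_assoc M.l_neg)
            then show "b J = (u J \<oplus>\<^bsub>M\<^esub> f \<odot>\<^bsub>M\<^esub> b' J) \<oplus>\<^bsub>M\<^esub> (if J \<subseteq> {1..n} then kdiff k e J else \<zero>\<^bsub>M\<^esub>)"
              using ub(3)[OF J] face_sets_subset[OF J] by simp
          qed (use uc ub f e kdiff_closed in auto)
          also have "\<dots> = (kdiff k u I \<oplus>\<^bsub>M\<^esub> f \<odot>\<^bsub>M\<^esub> kdiff k b' I) \<oplus>\<^bsub>M\<^esub> kdiff k (\<lambda>J. if J \<subseteq> {1..n} then kdiff k e J else \<zero>\<^bsub>M\<^esub>) I"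
            using uc ub f e Is by (simp add: kdiff_add kdiff_smult kdiff_closed)
          also have "kdiff k (\<lambda>J. if J \<subseteq> {1..n} then kdiff k e J else \<zero>\<^bsub>M\<^esub>) I = kdiff k (kdiff k e) I"
            using Is e by (auto simp: kdiff_def intro!: M.finsum_cong' smult_closed M.finsum_closed)
          also have "\<dots> = \<zero>\<^bsub>M\<^esub>" by (rule kdiff_kdiff[OF Is e(1)])
          finally have kb: "kdiff k b I = kdiff k u I \<oplus>\<^bsub>M\<^esub> f \<odot>\<^bsub>M\<^esub> kdiff k b' I"
            using kc f by simp
          have ku: "kdiff k u I \<in> U" using kdiff_mem[OF U I' ub(1)] .
          have "f [^] Suc s \<odot>\<^bsub>M\<^esub> a I \<ominus>\<^bsub>M\<^esub> kdiff k b I \<in> U"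
            using \<open>?E (Suc s) b\<close> I by auto
          also have "f [^] Suc s \<odot>\<^bsub>M\<^esub> a I \<ominus>\<^bsub>M\<^esub> kdiff k b I
            = f \<odot>\<^bsub>M\<^esub> (f [^] s \<odot>\<^bsub>M\<^esub> a I \<ominus>\<^bsub>M\<^esub> kdiff k b' I) \<ominus>\<^bsub>M\<^esub> kdiff k u I"
            unfolding fs kb using kc f fa[of I]
            by (simp add: a_minus_def smult_r_distr smult_r_minus M.minus_add M.a_ac)
          finally have "f \<odot>\<^bsub>M\<^esub> (f [^] s \<odot>\<^bsub>M\<^esub> a I \<ominus>\<^bsub>M\<^esub> kdiff k b' I) \<in> U"
            using submodule_minus_cancel[OF U ku] kc f fa[of I] by simp
          then show ?thesis using reg kc fa[of I] by simp
        qed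
        then show ?thesis using ub(2) by blast
      qed
    qed
    have "\<exists>s::nat. \<exists>b. (\<forall>I. b I \<in> carrier M) \<and> (\<forall>I\<in>face_sets i. f [^] s \<odot>\<^bsub>M\<^esub> a I \<ominus>\<^bsub>M\<^esub> kdiff k b I \<in> U)"
      by (rule torsion[OF U a _ f(2)]) (use cyc in auto)
    then obtain s b where "?E s b" by auto
    then have "\<exists>b. ?E 0 b"
    proof (induction s arbitrary: b)
      case (Suc s)
      then show ?case using descend by metis
    qed auto
    then show "\<exists>b. (\<forall>I. b I \<in> carrier M) \<and> (\<forall>I\<in>face_sets i. a I \<ominus>\<^bsub>M\<^esub> kdiff k b I \<in> U)"
      using a by simp
  qed
qed

text \<open>Exactness in degree 0 says that no nonzero class of M/U is killed by all y_j;
  \<open>nzd\<close> turns this into a nonzerodivisor f in Q. Exactness of M/U in degrees i and i +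
  1 then gives exactness of M/(U + f M) in degree i, as in the long exact sequence of f. The
  assumption \<open>nzd\<close> is discharged later by prime avoidance.\<close>

lemma regular_if_koszul_exact:
  assumes nzd: "\<And>U. submodule U R M \<Longrightarrow> (\<And>x. x \<in> carrier M \<Longrightarrow> (\<And>j. j \<in> {1..n} \<Longrightarrow> y j \<odot>\<^bsub>M\<^esub> x \<in> U) \<Longrightarrow> x \<in> U)
      \<Longrightarrow> \<exists>f\<in>Idl (y ` {1..n}). \<forall>x\<in>carrier M. f \<odot>\<^bsub>M\<^esub> x \<in> U \<longrightarrow> x \<in> U"
    and "submodule U R M" "\<And>i. i < g \<Longrightarrow> koszul_exact 1 U i"
  shows "\<exists>fs. length fs = g \<and> set fs \<subseteq> Idl (y ` {1..n}) \<and> rel_regular M U fs"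
  using assms(2,3)
proof (induction g arbitrary: U)
  case 0
  then show ?case by auto
next
  case (Suc g)
  note U = Suc.prems(1)
  have Uc: "\<And>u. u \<in> U \<Longrightarrow> u \<in> carrier M" using submoduleE(1)[OF U] by auto
  have "x \<in> U" if x: "x \<in> carrier M" "\<And>j. j \<in> {1..n} \<Longrightarrow> y j \<odot>\<^bsub>M\<^esub> x \<in> U" for x
  proof -
    \<comment> \<open>As a cochain of degree 0 the constant x stands for its value at the empty set;
      its coboundary at {j} is y_j x.\<close>
    have "kdiff 1 (\<lambda>_. x) J \<in> U" if "J \<in> face_sets (Suc 0)" for J
    proof -
      from that obtain j where "J = {j}" "j \<in> {1..n}"
        by (auto simp: face_sets_def card_Suc_eq)
      moreover have "coeff 1 {j} j = y j" if "j \<in> {1..n}"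
      proof -
        have e: "{l \<in> {j}. l < j} = {}" by auto
        show ?thesis using y_closed[OF that] unfolding coeff_def e by simp
      qed
      ultimately show ?thesis using x by (simp add: kdiff_def M.finsum_insert)
    qed
    then obtain b where "\<And>I. b I \<in> carrier M" "x \<ominus>\<^bsub>M\<^esub> kdiff 1 b {} \<in> U"
    proof -
      have ex: "koszul_exact 1 U 0" using Suc.prems(2)[of 0] by simp
      from koszul_exactD[OF ex x(1) \<open>\<And>J. J \<in> face_sets (Suc 0) \<Longrightarrow> kdiff 1 (\<lambda>_. x) J \<in> U\<close>] that
      show thesis by auto
    qed
    then show ?thesis using x by simp
  qed
  then obtain f where f: "f \<in> Idl (y ` {1..n})" and reg: "\<And>x. x \<in> carrier M \<Longrightarrow> f \<odot>\<^bsub>M\<^esub> x \<in> U \<Longrightarrow> x \<in> U"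
    using nzd[OF U] by blast
  have fc: "f \<in> carrier R" using Q_closed[OF f] .
  let ?V = "add_multiples M U f"
  have V: "submodule ?V R M" by (rule submodule_add_multiples[OF U fc])
  have "koszul_exact 1 ?V i" if i: "i < g" for i
    unfolding koszul_exact_def
  proof (intro allI impI, elim conjE)
    fix a assume a': "\<forall>I. a I \<in> carrier M" and cyc: "\<forall>J\<in>face_sets (Suc i). kdiff 1 a J \<in> ?V"
    have a: "\<And>J. a J \<in> carrier M" using a' by auto
    obtain u b where ub': "\<forall>I. u I \<in> U" "\<forall>I. b I \<in> carrier M"
      "\<forall>J\<in>face_sets (Suc i). kdiff 1 a J = u J \<oplus>\<^bsub>M\<^esub> f \<odot>\<^bsub>M\<^esub> b J"
      using add_multiples_choice[where A = "face_sets (Suc i)" and g = "kdiff 1 a", OF U cyc]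
      by (elim exE conjE) (rule that; assumption)
    note ub = ub'[rule_format]
    have uc: "\<And>J. u J \<in> carrier M" using ub(1) Uc by auto
    \<comment> \<open>Here b represents the connecting map: d a = u + f b, and 0 = d d a = d u + f d
      b lets f be cancelled, so b is a cocycle modulo U.\<close>
    have "kdiff 1 b J \<in> U" if J: "J \<in> face_sets (Suc (Suc i))" for J
    proof -
      note Js = face_sets_subset[OF J]
      have kc: "kdiff 1 u J \<in> carrier M" "kdiff 1 b J \<in> carrier M"
        using Js uc ub by (auto intro!: kdiff_closed)
      have "\<zero>\<^bsub>M\<^esub> = kdiff 1 (kdiff 1 a) J" using kdiff_kdiff[OF Js a] by simp
      also have "\<dots> = kdiff 1 (\<lambda>J. u J \<oplus>\<^bsub>M\<^esub> f \<odot>\<^bsub>M\<^esub> b J) J"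
        by (rule kdiff_cong[OF J _ ub(3)]) (use uc ub fc in auto)
      also have "\<dots> = f \<odot>\<^bsub>M\<^esub> kdiff 1 b J \<oplus>\<^bsub>M\<^esub> kdiff 1 u J"
        using uc ub fc Js kc by (simp add: kdiff_add kdiff_smult M.a_comm)
      finally have "f \<odot>\<^bsub>M\<^esub> kdiff 1 b J \<oplus>\<^bsub>M\<^esub> kdiff 1 u J \<in> U"
        using submodule_zero[OF U] by simp
      then show ?thesis
        using submodule_add_cancel[OF U kdiff_mem[OF U J ub(1)]] reg kc fc by auto
    qed
    then obtain c where c: "\<And>I. c I \<in> carrier M" "\<And>J. J \<in> face_sets (Suc i) \<Longrightarrow> b J \<ominus>\<^bsub>M\<^esub> kdiff 1 c J \<in> U"
    proof -
      have ex: "koszul_exact 1 U (Suc i)" using Suc.prems(2)[of "Suc i"] i by simp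
      from koszul_exactD[OF ex ub(2) \<open>\<And>J. J \<in> face_sets (Suc (Suc i)) \<Longrightarrow> kdiff 1 b J \<in> U\<close>] that show thesis by auto
    qed
    \<comment> \<open>Subtracting f c changes nothing modulo U + f M but turns a into a cocycle
      modulo U.\<close>
    let ?a = "\<lambda>J. a J \<ominus>\<^bsub>M\<^esub> f \<odot>\<^bsub>M\<^esub> c J"
    have "kdiff 1 ?a J \<in> U" if J: "J \<in> face_sets (Suc i)" for J
    proof -
      note Js = face_sets_subset[OF J]
      have kc: "kdiff 1 c J \<in> carrier M" using Js c by (auto intro!: kdiff_closed)
      have "kdiff 1 ?a J = (u J \<oplus>\<^bsub>M\<^esub> f \<odot>\<^bsub>M\<^esub> b J) \<ominus>\<^bsub>M\<^esub> f \<odot>\<^bsub>M\<^esub> kdiff 1 c J"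
        using Js a c fc ub(3)[OF J] by (simp add: kdiff_minus kdiff_smult)
      also have "\<dots> = u J \<oplus>\<^bsub>M\<^esub> f \<odot>\<^bsub>M\<^esub> (b J \<ominus>\<^bsub>M\<^esub> kdiff 1 c J)"
        using kc fc uc[of J] ub(2)[of J]
        by (simp add: a_minus_def smult_r_distr smult_r_minus M.a_assoc)
      also have "\<dots> \<in> U"
        using ub(1) c(2)[OF J] fc by (auto intro!: submoduleE(4,5)[OF U])
      finally show ?thesis .
    qed
    then obtain e where e: "\<And>I. e I \<in> carrier M" "\<And>J. J \<in> face_sets i \<Longrightarrow> ?a J \<ominus>\<^bsub>M\<^esub> kdiff 1 e J \<in> U"
    proof -
      have ex: "koszul_exact 1 U i" using Suc.prems(2)[of i] i by simp
      have "?a I \<in> carrier M" for I using a c(1) fc by simp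
      from koszul_exactD[OF ex this \<open>\<And>J. J \<in> face_sets (Suc i) \<Longrightarrow> kdiff 1 ?a J \<in> U\<close>] that show thesis by auto
    qed
    have "a J \<ominus>\<^bsub>M\<^esub> kdiff 1 e J \<in> ?V" if J: "J \<in> face_sets i" for J
    proof -
      have ke: "kdiff 1 e J \<in> carrier M" by (rule kdiff_closed[OF face_sets_subset[OF J] e(1)])
      have "a J \<ominus>\<^bsub>M\<^esub> kdiff 1 e J = (?a J \<ominus>\<^bsub>M\<^esub> kdiff 1 e J) \<oplus>\<^bsub>M\<^esub> f \<odot>\<^bsub>M\<^esub> c J"
        using a[of J] c(1)[of J] ke fc
        by (simp add: a_minus_def M.a_ac M.r_neg1 M.r_neg2 M.l_neg)
      then show ?thesis using e(2)[OF J] c(1) unfolding add_multiples_def by blast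
    qed
    then show "\<exists>b. (\<forall>I. b I \<in> carrier M) \<and> (\<forall>I\<in>face_sets i. a I \<ominus>\<^bsub>M\<^esub> kdiff 1 b I \<in> ?V)"
      using e(1) by blast
  qed
  then obtain fs where "length fs = g" "set fs \<subseteq> Idl (y ` {1..n})" "rel_regular M ?V fs"
    using Suc.IH[OF V] by auto
  then show ?case
    using f reg by (intro exI[of _ "f # fs"]) auto
qed

end

lemma (in abelian_group) diff_eq_zeroD:
  assumes "x \<ominus> z = \<zero>" "x \<in> carrier G" "z \<in> carrier G"
  shows "x = z"
proof -
  have "x = (x \<ominus> z) \<oplus> z" using assms(2,3) by (simp add: a_minus_def a_assoc l_neg)
  then show ?thesis using assms by simp
qed

section \<open>Cech cocycles as numerators, and their double complex with Koszul chains\<close>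

context koszul
begin

text \<open>Multiplying the component at I by \<open>y_power I t\<close> is the transition map from
  the Koszul complex of the k-th powers to that of the (k + t)-th powers: a fraction whose
  denominator is a power of the product over I is expanded by t further powers.\<close>

definition y_power :: "nat set \<Rightarrow> nat \<Rightarrow> 'a" where
  "y_power I t = (\<Otimes>j\<in>I. y j) [^] t"

lemma prod_y_closed: "I \<subseteq> {1..n} \<Longrightarrow> (\<Otimes>j\<in>I. y j) \<in> carrier R"
  by (intro R.finprod_closed) auto

lemma y_power_closed [simp]: "I \<subseteq> {1..n} \<Longrightarrow> y_power I t \<in> carrier R"
  by (simp add: y_power_def prod_y_closed)

lemma y_power_empty [simp]: "y_power {} t = \<one>"
  by (simp add: y_power_def)

lemma y_power_add: "I \<subseteq> {1..n} \<Longrightarrow> y_power I (s + t) = y_power I s \<otimes> y_power I t"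
  by (simp add: y_power_def prod_y_closed R.nat_pow_mult)

lemma prod_y_remove:
  assumes "I \<subseteq> {1..n}" "j \<in> I"
  shows "(\<Otimes>i\<in>I. y i) = y j \<otimes> (\<Otimes>i\<in>I-{j}. y i)"
proof -
  have "I = insert j (I - {j})" using assms by auto
  moreover have "finite (I - {j})" using assms finite_subset by blast
  ultimately show ?thesis using assms
    by (subst (1) \<open>I = insert j (I - {j})\<close>, subst R.finprod_insert) auto
qed

lemma y_power_remove:
  assumes "I \<subseteq> {1..n}" "j \<in> I"
  shows "y_power I t = y j [^] t \<otimes> y_power (I - {j}) t"
proof -
  have "I - {j} \<subseteq> {1..n}" "j \<in> {1..n}" using assms by auto
  then show ?thesis
    unfolding y_power_def prod_y_remove[OF assms] by (simp add: R.nat_pow_distrib prod_y_closed)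
qed

lemma y_power_coeff:
  assumes "I \<subseteq> {1..n}" "j \<in> I"
  shows "y_power I t \<otimes> coeff k I j = coeff (k + t) I j \<otimes> y_power (I - {j}) t"
proof -
  have "I - {j} \<subseteq> {1..n}" "j \<in> {1..n}" using assms by auto
  then have "y_power (I - {j}) t \<in> carrier R" "y j \<in> carrier R" by (auto simp del: atLeastAtMost_iff)
  then show ?thesis
    by (simp add: coeff_def y_power_remove[OF assms] m_ac flip: R.nat_pow_mult)
qed

text \<open>The transition maps commute with the coboundary: of the t-th power of the product over
  I, the factor at j raises the exponent in \<open>coeff\<close>, and the rest belongs to the face I
  - {j}.\<close>

lemma kdiff_y_power:
  assumes I: "I \<subseteq> {1..n}" and a: "\<And>J. a J \<in> carrier M"
  shows "y_power I t \<odot>\<^bsub>M\<^esub> kdiff k a I = kdiff (k + t) (\<lambda>J. if J \<subseteq> {1..n} then y_power J t \<odot>\<^bsub>M\<^esub> a J else \<zero>\<^bsub>M\<^esub>) I"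
proof -
  have fin: "finite I" using I finite_subset by blast
  have c: "coeff k J l \<in> carrier R" if "l \<in> I" for l J k using I that by auto
  have "y_power I t \<odot>\<^bsub>M\<^esub> kdiff k a I = (\<Oplus>\<^bsub>M\<^esub>j\<in>I. y_power I t \<odot>\<^bsub>M\<^esub> (coeff k I j \<odot>\<^bsub>M\<^esub> a (I - {j})))"
    unfolding kdiff_def using c a fin I by (intro finsum_smult_ldistr) auto
  also have "\<dots> = kdiff (k + t) (\<lambda>J. if J \<subseteq> {1..n} then y_power J t \<odot>\<^bsub>M\<^esub> a J else \<zero>\<^bsub>M\<^esub>) I"
    unfolding kdiff_def
  proof (rule M.finsum_cong')
    fix j assume j: "j \<in> I"
    have I': "I - {j} \<subseteq> {1..n}" using I by auto
    show "y_power I t \<odot>\<^bsub>M\<^esub> (coeff k I j \<odot>\<^bsub>M\<^esub> a (I - {j})) = coeff (k + t) I j \<odot>\<^bsub>M\<^esub>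
        (if I - {j} \<subseteq> {1..n} then y_power (I - {j}) t \<odot>\<^bsub>M\<^esub> a (I - {j}) else \<zero>\<^bsub>M\<^esub>)"
      using I' a y_power_coeff[OF I j, of t k] c[OF j] I by (simp flip: smult_assoc1)
  qed (use c a in auto)
  finally show ?thesis .
qed

text \<open>Boundary map of the Koszul chain complex of the q-th powers, decreasing the size of J.
  At the empty set its values are sums of elements y_l^q m, which is how membership is obtained in
  the end.\<close>

definition lower :: "nat \<Rightarrow> (nat set \<Rightarrow> 'c) \<Rightarrow> nat set \<Rightarrow> 'c" where
  "lower q w J = (\<Oplus>\<^bsub>M\<^esub>l\<in>{1..n}-J. coeff q (insert l J) l \<odot>\<^bsub>M\<^esub> w (insert l J))"

lemma lower_mem:
  assumes U: "submodule U R M" and "\<And>J. w J \<in> U"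
  shows "lower q w J \<in> U"
  unfolding lower_def
  using assms by (intro submodule_finsum[OF U] submoduleE(4)[OF U]) auto

lemma lower_closed: "(\<And>J. w J \<in> carrier M) \<Longrightarrow> lower q w J \<in> carrier M"
  by (rule lower_mem[OF carrier_is_submodule])

lemma lower_cong:
  assumes "J \<in> face_sets i" "\<And>J. b J \<in> carrier M" "\<And>J. J \<in> face_sets (Suc i) \<Longrightarrow> a J = b J"
  shows "lower q a J = lower q b J"
  unfolding lower_def
proof (intro M.finsum_cong')
  show "(\<lambda>l. coeff q (insert l J) l \<odot>\<^bsub>M\<^esub> b (insert l J)) \<in> {1..n} - J \<rightarrow> carrier M"
    using assms by auto
qed (use assms face_sets_insert in auto)

lemma lower_lower:
  assumes J: "J \<subseteq> {1..n}" and w: "\<And>J. w J \<in> carrier M"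
  shows "lower q (lower q w) J = \<zero>\<^bsub>M\<^esub>"
proof -
  let ?A = "{1..n} - J"
  define F where "F l j = (coeff q (insert l J) l \<otimes> coeff q (insert j (insert l J)) j) \<odot>\<^bsub>M\<^esub> w (insert j (insert l J))" for l j
  have "lower q (lower q w) J = (\<Oplus>\<^bsub>M\<^esub>l\<in>?A. \<Oplus>\<^bsub>M\<^esub>j\<in>?A-{l}. F l j)"
    unfolding lower_def[of q "lower q w"]
  proof (intro M.finsum_cong')
    fix l assume l: "l \<in> ?A"
    have A: "{1..n} - insert l J = ?A - {l}" by auto
    have "coeff q (insert l J) l \<odot>\<^bsub>M\<^esub> lower q w (insert l J)
      = (\<Oplus>\<^bsub>M\<^esub>j\<in>?A-{l}. coeff q (insert l J) l \<odot>\<^bsub>M\<^esub> (coeff q (insert j (insert l J)) j \<odot>\<^bsub>M\<^esub> w (insert j (insert l J))))"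
      unfolding lower_def A using l w by (intro finsum_smult_ldistr) auto
    also have "\<dots> = (\<Oplus>\<^bsub>M\<^esub>j\<in>?A-{l}. F l j)"
      using l w by (intro M.finsum_cong') (auto simp: F_def smult_assoc1)
    finally show "coeff q (insert l J) l \<odot>\<^bsub>M\<^esub> lower q w (insert l J) = (\<Oplus>\<^bsub>M\<^esub>j\<in>?A-{l}. F l j)" .
  qed (use w in \<open>auto simp: F_def intro!: M.finsum_closed\<close>)
  also have "\<dots> = \<zero>\<^bsub>M\<^esub>"
  proof (rule M.finsum_antisymmetric)
    fix l j assume lj: "l \<in> ?A" "j \<in> ?A" "l \<noteq> j"
    then show "F l j \<in> carrier M" using w by (auto simp: F_def)
    let ?I = "insert j (insert l J)"
    have I: "?I \<subseteq> {1..n}" using J lj by auto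
    have e: "insert l (insert j J) = ?I" "?I - {l} = insert j J" "?I - {j} = insert l J" using lj by auto
    have c: "coeff q K l \<in> carrier R" "coeff q K j \<in> carrier R" for K using lj by auto
    have "coeff q ?I j \<otimes> coeff q (?I - {j}) l = \<ominus> (coeff q ?I l \<otimes> coeff q (?I - {l}) j)"
      using lj I finite_subset[OF I] by (intro coeff_anticommute) auto
    then have "coeff q (insert l J) l \<otimes> coeff q ?I j = \<ominus> (coeff q (insert j J) j \<otimes> coeff q ?I l)"
      unfolding e using c by (simp add: m_comm)
    then show "F l j = \<ominus>\<^bsub>M\<^esub> F j l"
      using c w by (simp add: F_def e(1) smult_l_minus)
  qed simp
  finally show ?thesis .
qed

text \<open>The two differentials act on different indices, so they commute without a sign.\<close>

lemma kdiff_lower: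
  assumes I: "I \<subseteq> {1..n}" and J: "J \<subseteq> {1..n}" and w: "\<And>I J. w I J \<in> carrier M"
  shows "kdiff k (\<lambda>I. lower q (w I) J) I = lower q (\<lambda>J. kdiff k (\<lambda>I. w I J) I) J"
proof -
  have fin: "finite I" using I finite_subset by blast
  have c: "coeff k K l \<in> carrier R" if "l \<in> I" for l K k using I that by auto
  let ?F = "\<lambda>j l. (coeff k I j \<otimes> coeff q (insert l J) l) \<odot>\<^bsub>M\<^esub> w (I - {j}) (insert l J)"
  have "kdiff k (\<lambda>I. lower q (w I) J) I = (\<Oplus>\<^bsub>M\<^esub>j\<in>I. \<Oplus>\<^bsub>M\<^esub>l\<in>{1..n}-J. ?F j l)"
    unfolding kdiff_def
  proof (intro M.finsum_cong')
    fix j assume j: "j \<in> I"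
    have "coeff k I j \<odot>\<^bsub>M\<^esub> lower q (w (I - {j})) J = (\<Oplus>\<^bsub>M\<^esub>l\<in>{1..n}-J.
       coeff k I j \<odot>\<^bsub>M\<^esub> (coeff q (insert l J) l \<odot>\<^bsub>M\<^esub> w (I - {j}) (insert l J)))"
      unfolding lower_def using c j w by (intro finsum_smult_ldistr) auto
    also have "\<dots> = (\<Oplus>\<^bsub>M\<^esub>l\<in>{1..n}-J. ?F j l)"
      using c j w by (intro M.finsum_cong') (auto simp: smult_assoc1)
    finally show "coeff k I j \<odot>\<^bsub>M\<^esub> lower q (w (I - {j})) J = (\<Oplus>\<^bsub>M\<^esub>l\<in>{1..n}-J. ?F j l)" .
  qed (use c w in \<open>auto intro!: M.finsum_closed\<close>)
  also have "\<dots> = (\<Oplus>\<^bsub>M\<^esub>l\<in>{1..n}-J. \<Oplus>\<^bsub>M\<^esub>j\<in>I. ?F j l)"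
    using fin c w by (intro M.finsum_swap) auto
  also have "\<dots> = lower q (\<lambda>J. kdiff k (\<lambda>I. w I J) I) J"
    unfolding lower_def
  proof (intro M.finsum_cong')
    fix l assume l: "l \<in> {1..n} - J"
    have "coeff q (insert l J) l \<odot>\<^bsub>M\<^esub> kdiff k (\<lambda>I. w I (insert l J)) I = (\<Oplus>\<^bsub>M\<^esub>j\<in>I.
       coeff q (insert l J) l \<odot>\<^bsub>M\<^esub> (coeff k I j \<odot>\<^bsub>M\<^esub> w (I - {j}) (insert l J)))"
      unfolding kdiff_def using c l w fin by (intro finsum_smult_ldistr) auto
    also have "\<dots> = (\<Oplus>\<^bsub>M\<^esub>j\<in>I. ?F j l)"
      using c l w by (intro M.finsum_cong') (auto simp: R.m_comm simp flip: smult_assoc1)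
    finally show "(\<Oplus>\<^bsub>M\<^esub>j\<in>I. ?F j l) = coeff q (insert l J) l \<odot>\<^bsub>M\<^esub> kdiff k (\<lambda>I. w I (insert l J)) I" by simp
  qed (use c w kdiff_closed[OF I w] in \<open>auto intro!: M.finsum_closed\<close>)
  finally show ?thesis .
qed

text \<open>The direct limit over \<open>k\<close> of the Koszul cohomology of \<open>W\<close> at \<open>y\<^sub>1\<^sup>k, \<dots>, y\<^sub>n\<^sup>k\<close>, which is the
  Cech cohomology, vanishes in degree \<open>i\<close>.\<close>

definition colim_exact :: "'c set \<Rightarrow> nat \<Rightarrow> bool" where
  "colim_exact W i \<longleftrightarrow>
    (\<forall>k a. (\<forall>I. a I \<in> W) \<and> (\<forall>J\<in>face_sets (Suc i). kdiff k a J = \<zero>\<^bsub>M\<^esub>) \<longrightarrow>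
      (\<exists>t b. (\<forall>I. b I \<in> W) \<and> (\<forall>I\<in>face_sets i. y_power I t \<odot>\<^bsub>M\<^esub> a I = kdiff (k + t) b I)))"

lemma colim_exact_if_koszul_exact:
  assumes "\<And>k. koszul_exact k {\<zero>\<^bsub>M\<^esub>} i"
  shows "colim_exact (carrier M) i"
  unfolding colim_exact_def
proof (intro allI impI, elim conjE)
  fix k a assume a: "\<forall>I. a I \<in> carrier M" "\<forall>J\<in>face_sets (Suc i). kdiff k a J = \<zero>\<^bsub>M\<^esub>"
  have "\<exists>b. (\<forall>I. b I \<in> carrier M) \<and> (\<forall>I\<in>face_sets i. a I \<ominus>\<^bsub>M\<^esub> kdiff k b I \<in> {\<zero>\<^bsub>M\<^esub>})"
    by (rule koszul_exactD[OF assms]) (use a in auto)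
  then obtain b where b: "\<forall>I. b I \<in> carrier M" "\<forall>I\<in>face_sets i. a I \<ominus>\<^bsub>M\<^esub> kdiff k b I = \<zero>\<^bsub>M\<^esub>"
    by auto
  \<comment> \<open>Exactness at the given exponent k provides a primitive at the same exponent, so
    t = 0.\<close>
  have "y_power I 0 \<odot>\<^bsub>M\<^esub> a I = kdiff (k + 0) b I" if "I \<in> face_sets i" for I
  proof -
    have kc: "kdiff k b I \<in> carrier M" by (rule kdiff_closed[OF face_sets_subset[OF that]]) (use b in auto)
    have "a I \<ominus>\<^bsub>M\<^esub> kdiff k b I = \<zero>\<^bsub>M\<^esub>" using b(2) that by blast
    then have "a I = kdiff k b I" by (rule M.diff_eq_zeroD[OF _ _ kc]) (use a(1) in blast)
    then show ?thesis using kc by (simp add: y_power_def)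
  qed
  then show "\<exists>t b. (\<forall>I. b I \<in> carrier M) \<and> (\<forall>I\<in>face_sets i. y_power I t \<odot>\<^bsub>M\<^esub> a I = kdiff (k + t) b I)"
    using b(1) by blast
qed

text \<open>A double cochain \<open>z I J\<close> stands for an element of (Cech cochains in \<open>I\<close>) tensor (Koszul chains
  of \<open>y\<^sub>1\<^sup>q, \<dots>, y\<^sub>n\<^sup>q\<close> in \<open>J\<close>), written as the numerator over the \<open>(q + s)\<close>-th power of the product of
  the \<open>y\<^sub>j\<close> with \<open>j \<in> I\<close>.  The diagonal is the product over \<open>j\<close> of \<open>1 + e\<^sub>j / y\<^sub>j\<^sup>q\<close> times \<open>x\<close>; it is a cocycle of
  the total complex that lifts \<open>x\<close>.\<close>

definition diagonal :: "'c \<Rightarrow> nat \<Rightarrow> nat set \<Rightarrow> nat set \<Rightarrow> 'c" where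
  "diagonal x s I J = (if I = J \<and> I \<subseteq> {1..n} then y_power I s \<odot>\<^bsub>M\<^esub> x else \<zero>\<^bsub>M\<^esub>)"

lemma diagonal_mem: "submodule W R M \<Longrightarrow> x \<in> W \<Longrightarrow> diagonal x s I J \<in> W"
  using submoduleE(4) submodule_zero by (auto simp: diagonal_def)

text \<open>The cocycle condition for the diagonal. If J is contained in I, then I - J has one
  element l, and each side reduces to its term at l; these terms agree by
  \<open>y_power_coeff\<close> because the exponent of \<open>kdiff\<close> is that of
  \<open>lower\<close> plus s. Otherwise all terms vanish.\<close>

lemma kdiff_diagonal:
  assumes x: "x \<in> carrier M" and I: "I \<in> face_sets (Suc i)" and J: "J \<in> face_sets i"
  shows "kdiff (q + s) (\<lambda>I. diagonal x s I J) I = lower q (diagonal x s I) J"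
proof -
  note Is = face_sets_subset[OF I] and Js = face_sets_subset[OF J]
  have dc: "diagonal x s I J \<in> carrier M" for I J
    by (rule diagonal_mem[OF carrier_is_submodule x])
  show ?thesis
  proof (cases "J \<subseteq> I")
    case True
    have "card (I - J) = Suc 0"
      using True I J face_sets_finite[OF J] by (simp add: card_Diff_subset face_sets_def)
    then obtain l where l: "I - J = {l}" by (auto simp: card_Suc_eq)
    then have Il: "I = insert l J" "l \<notin> J" "I - {l} = J" "l \<in> I" "l \<in> {1..n}" using True Is by auto
    have "kdiff (q + s) (\<lambda>I. diagonal x s I J) I
      = (\<Oplus>\<^bsub>M\<^esub>j\<in>I. if l = j then coeff (q + s) I j \<odot>\<^bsub>M\<^esub> diagonal x s (I - {j}) J else \<zero>\<^bsub>M\<^esub>)"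
      unfolding kdiff_def
    proof (intro M.finsum_cong')
      fix j assume j: "j \<in> I"
      have "coeff (q + s) I j \<in> carrier R" using j Is by auto
      moreover have "I - {j} \<noteq> J" if "l \<noteq> j" using that Il j by auto
      ultimately show "coeff (q + s) I j \<odot>\<^bsub>M\<^esub> diagonal x s (I - {j}) J =
         (if l = j then coeff (q + s) I j \<odot>\<^bsub>M\<^esub> diagonal x s (I - {j}) J else \<zero>\<^bsub>M\<^esub>)"
        by (auto simp: diagonal_def)
    qed (use dc Il Is in auto)
    also have "\<dots> = coeff (q + s) I l \<odot>\<^bsub>M\<^esub> diagonal x s (I - {l}) J"
      using face_sets_finite[OF I] Il dc Is by (intro M.finsum_singleton) auto
    also have "\<dots> = (coeff (q + s) I l \<otimes> y_power (I - {l}) s) \<odot>\<^bsub>M\<^esub> x"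
    proof -
      have "coeff (q + s) I l \<in> carrier R" "y_power J s \<in> carrier R" using Il(5) Js by auto
      then show ?thesis using Il(3) Js x by (simp add: diagonal_def smult_assoc1)
    qed
    also have "\<dots> = (y_power I s \<otimes> coeff q I l) \<odot>\<^bsub>M\<^esub> x"
      by (simp add: y_power_coeff[OF Is Il(4)])
    finally have L: "kdiff (q + s) (\<lambda>I. diagonal x s I J) I = (y_power I s \<otimes> coeff q I l) \<odot>\<^bsub>M\<^esub> x" .
    have "lower q (diagonal x s I) J
      = (\<Oplus>\<^bsub>M\<^esub>j\<in>{1..n}-J. if l = j then coeff q (insert j J) j \<odot>\<^bsub>M\<^esub> diagonal x s I (insert j J) else \<zero>\<^bsub>M\<^esub>)"
      unfolding lower_def
    proof (intro M.finsum_cong')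
      fix j assume j: "j \<in> {1..n} - J"
      then have "coeff q (insert j J) j \<in> carrier R" by auto
      moreover have "I \<noteq> insert j J" if "l \<noteq> j" using that Il j by auto
      ultimately show "coeff q (insert j J) j \<odot>\<^bsub>M\<^esub> diagonal x s I (insert j J) =
         (if l = j then coeff q (insert j J) j \<odot>\<^bsub>M\<^esub> diagonal x s I (insert j J) else \<zero>\<^bsub>M\<^esub>)"
        by (auto simp: diagonal_def)
    qed (use dc in auto)
    also have "\<dots> = coeff q (insert l J) l \<odot>\<^bsub>M\<^esub> diagonal x s I (insert l J)"
      using Il dc by (intro M.finsum_singleton) auto
    also have "\<dots> = (y_power I s \<otimes> coeff q I l) \<odot>\<^bsub>M\<^esub> x"
    proof -
      have "coeff q I l \<in> carrier R" "y_power I s \<in> carrier R" using Il(5) Is by auto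
      then show ?thesis
        unfolding Il(1)[symmetric] using Is x by (simp add: diagonal_def m_comm flip: smult_assoc1)
    qed
    finally show ?thesis using L by simp
  next
    case False
    have "kdiff (q + s) (\<lambda>I. diagonal x s I J) I = (\<Oplus>\<^bsub>M\<^esub>j\<in>I. \<zero>\<^bsub>M\<^esub>)"
      unfolding kdiff_def using False Is by (intro M.finsum_cong') (auto simp: diagonal_def)
    moreover have "lower q (diagonal x s I) J = (\<Oplus>\<^bsub>M\<^esub>j\<in>{1..n}-J. \<zero>\<^bsub>M\<^esub>)"
      unfolding lower_def using False by (intro M.finsum_cong') (auto simp: diagonal_def)
    ultimately show ?thesis by simp
  qed
qed

lemma lower_add:
  assumes "\<And>J. a J \<in> carrier M" "\<And>J. b J \<in> carrier M"
  shows "lower q (\<lambda>J. a J \<oplus>\<^bsub>M\<^esub> b J) J = lower q a J \<oplus>\<^bsub>M\<^esub> lower q b J"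
proof -
  have "lower q (\<lambda>J. a J \<oplus>\<^bsub>M\<^esub> b J) J = (\<Oplus>\<^bsub>M\<^esub>l\<in>{1..n}-J. coeff q (insert l J) l \<odot>\<^bsub>M\<^esub> a (insert l J)
      \<oplus>\<^bsub>M\<^esub> coeff q (insert l J) l \<odot>\<^bsub>M\<^esub> b (insert l J))"
    unfolding lower_def using assms by (intro M.finsum_cong') (auto simp: smult_r_distr)
  also have "\<dots> = lower q a J \<oplus>\<^bsub>M\<^esub> lower q b J"
    unfolding lower_def using assms by (intro M.finsum_addf) auto
  finally show ?thesis .
qed

lemma lower_smult:
  assumes "\<And>J. a J \<in> carrier M" "r \<in> carrier R"
  shows "lower q (\<lambda>J. r \<odot>\<^bsub>M\<^esub> a J) J = r \<odot>\<^bsub>M\<^esub> lower q a J"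
proof -
  have "r \<odot>\<^bsub>M\<^esub> lower q a J = (\<Oplus>\<^bsub>M\<^esub>l\<in>{1..n}-J. r \<odot>\<^bsub>M\<^esub> (coeff q (insert l J) l \<odot>\<^bsub>M\<^esub> a (insert l J)))"
    unfolding lower_def using assms by (intro finsum_smult_ldistr) auto
  also have "\<dots> = lower q (\<lambda>J. r \<odot>\<^bsub>M\<^esub> a J) J"
    unfolding lower_def
  proof (intro M.finsum_cong')
    fix l assume "l \<in> {1..n} - J"
    then have "coeff q (insert l J) l \<in> carrier R" by auto
    then show "r \<odot>\<^bsub>M\<^esub> (coeff q (insert l J) l \<odot>\<^bsub>M\<^esub> a (insert l J))
      = coeff q (insert l J) l \<odot>\<^bsub>M\<^esub> (r \<odot>\<^bsub>M\<^esub> a (insert l J))"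
      using assms by (simp add: m_comm flip: smult_assoc1)
  qed (use assms in auto)
  finally show ?thesis by simp
qed

lemma lower_minus:
  assumes "\<And>J. a J \<in> carrier M" "\<And>J. b J \<in> carrier M"
  shows "lower q (\<lambda>J. a J \<ominus>\<^bsub>M\<^esub> b J) J = lower q a J \<ominus>\<^bsub>M\<^esub> lower q b J"
proof -
  have "(\<lambda>J. a J \<ominus>\<^bsub>M\<^esub> b J) = (\<lambda>J. a J \<oplus>\<^bsub>M\<^esub> (\<ominus> \<one>) \<odot>\<^bsub>M\<^esub> b J)"
    using assms by (simp add: a_minus_def smult_l_minus)
  then show ?thesis
    using assms lower_closed[of b q] lower_add[of a "\<lambda>J. (\<ominus> \<one>) \<odot>\<^bsub>M\<^esub> b J" q] lower_smult[of b "\<ominus> \<one>" q]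
    by (simp add: smult_l_minus a_minus_def)
qed

text \<open>Both sides are numerators of the same fraction; only the denominator has grown.\<close>

lemma y_power_diagonal:
  assumes "x \<in> carrier M" "I \<subseteq> {1..n}"
  shows "y_power I t \<odot>\<^bsub>M\<^esub> diagonal x s I J = diagonal x (s + t) I J"
proof -
  have "y_power I t \<in> carrier R" "y_power I s \<in> carrier R" using assms by auto
  then have "y_power I t \<odot>\<^bsub>M\<^esub> (y_power I s \<odot>\<^bsub>M\<^esub> x) = y_power I (s + t) \<odot>\<^bsub>M\<^esub> x"
    using assms(1) y_power_add[OF assms(2), of s t] by (simp add: m_comm flip: smult_assoc1)
  then show ?thesis
    using assms(2) \<open>y_power I t \<in> carrier R\<close> by (cases "J = I") (auto simp: diagonal_def)
qed

text \<open>The diagonal is cohomologous to a cocycle without components in degrees above \<open>i\<close>.\<close>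

definition truncated :: "'c set \<Rightarrow> 'c \<Rightarrow> nat \<Rightarrow> nat \<Rightarrow> bool" where
  "truncated W x q i \<longleftrightarrow> (\<exists>s w. (\<forall>I J. w I J \<in> W) \<and>
    (\<forall>I\<in>face_sets (Suc i). \<forall>J\<in>face_sets i.
      kdiff (q + s) (\<lambda>I. diagonal x s I J \<ominus>\<^bsub>M\<^esub> lower q (w I) J) I = \<zero>\<^bsub>M\<^esub>))"

text \<open>For each J of size i + 1 the part of the corrected diagonal in Cech degree i + 1 is a
  cocycle, hence, after denominators are enlarged, the coboundary of some v in Cech degree i. The
  new correction is \<open>lower\<close> of v: its coboundary is \<open>lower\<close> of d v, in
  which the old correction drops out because \<open>lower\<close> squares to zero, and what remains
  is the coboundary of the diagonal.\<close>

lemma truncated_step: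
  assumes W: "submodule W R M" and x: "x \<in> W"
    and ex: "colim_exact W (Suc i)" and tr: "truncated W x q (Suc i)"
  shows "truncated W x q i"
proof -
  have Wc: "u \<in> carrier M" if "u \<in> W" for u using submoduleE(1)[OF W] that by auto
  have xc: "x \<in> carrier M" using x Wc by auto
  obtain s w where w': "\<forall>I J. w I J \<in> W" and cyc': "\<forall>I\<in>face_sets (Suc (Suc i)). \<forall>J\<in>face_sets (Suc i).
      kdiff (q + s) (\<lambda>I. diagonal x s I J \<ominus>\<^bsub>M\<^esub> lower q (w I) J) I = \<zero>\<^bsub>M\<^esub>"
    using tr unfolding truncated_def by (elim exE conjE) (rule that)
  note w = w'[rule_format] and cyc = cyc'[rule_format]
  have dW: "diagonal x s I J \<in> W" for s I J by (rule diagonal_mem[OF W x])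
  define a where "a J I = diagonal x s I J \<ominus>\<^bsub>M\<^esub> lower q (w I) J" for I J
  have aW: "a J I \<in> W" for I J
    unfolding a_def by (intro submodule_minus[OF W] dW lower_mem[OF W] w)
  have "\<exists>p. (\<forall>I. snd p I \<in> W) \<and> (\<forall>I\<in>face_sets (Suc i). y_power I (fst p) \<odot>\<^bsub>M\<^esub> a J I = kdiff (q + s + fst p) (snd p) I)"
    if J: "J \<in> face_sets (Suc i)" for J
  proof -
    have "\<exists>t b. (\<forall>I. b I \<in> W) \<and> (\<forall>I\<in>face_sets (Suc i). y_power I t \<odot>\<^bsub>M\<^esub> a J I = kdiff (q + s + t) b I)"
      using ex unfolding colim_exact_def
      by (elim allE[of _ "q + s"] allE[of _ "a J"] impE) (use aW cyc J in \<open>auto simp: a_def[abs_def]\<close>)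
    then show ?thesis by auto
  qed
  then have "\<forall>J\<in>face_sets (Suc i). \<exists>p. (\<forall>I. snd p I \<in> W) \<and>
      (\<forall>I\<in>face_sets (Suc i). y_power I (fst p) \<odot>\<^bsub>M\<^esub> a J I = kdiff (q + s + fst p) (snd p) I)"
    by blast
  then obtain p where p: "\<And>I J. J \<in> face_sets (Suc i) \<Longrightarrow> snd (p J) I \<in> W"
    "\<And>I J. J \<in> face_sets (Suc i) \<Longrightarrow> I \<in> face_sets (Suc i) \<Longrightarrow>
      y_power I (fst (p J)) \<odot>\<^bsub>M\<^esub> a J I = kdiff (q + s + fst (p J)) (snd (p J)) I"
    by (elim bchoice[THEN exE]) auto
  \<comment> \<open>Each J comes with its own enlargement of the denominator; T bounds them all, and
    v brings the primitives to this common exponent.\<close>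
  define T where "T = (\<Sum>J\<in>face_sets (Suc i). fst (p J))"
  have T: "fst (p J) \<le> T" if "J \<in> face_sets (Suc i)" for J
    unfolding T_def using that finite_face_sets by (intro member_le_sum) auto
  define b where "b J I = (if J \<in> face_sets (Suc i) then snd (p J) I else \<zero>\<^bsub>M\<^esub>)" for I J
  have bW: "b J I \<in> W" for I J using p(1) submodule_zero[OF W] by (simp add: b_def)
  define v where "v I J = (if I \<subseteq> {1..n} then y_power I (T - fst (p J)) \<odot>\<^bsub>M\<^esub> b J I else \<zero>\<^bsub>M\<^esub>)" for I J
  have vW: "v I J \<in> W" for I J
    unfolding v_def using bW submodule_zero[OF W] submoduleE(4)[OF W] y_power_closed by auto
  have kv: "kdiff (q + (s + T)) (\<lambda>I. v I J) I = diagonal x (s + T) I J \<ominus>\<^bsub>M\<^esub> y_power I T \<odot>\<^bsub>M\<^esub> lower q (w I) J"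
    if I: "I \<in> face_sets (Suc i)" and J: "J \<in> face_sets (Suc i)" for I J
  proof -
    note Is = face_sets_subset[OF I]
    have t: "q + s + fst (p J) + (T - fst (p J)) = q + (s + T)" "fst (p J) + (T - fst (p J)) = T"
      using T[OF J] by auto
    have yc: "y_power I t \<in> carrier R" for t by (rule y_power_closed[OF Is])
    have lc: "lower q (w I) J \<in> carrier M" using w Wc by (intro lower_closed) auto
    have dc: "diagonal x s I J \<in> carrier M" using dW Wc by auto
    have "kdiff (q + (s + T)) (\<lambda>I. v I J) I = y_power I (T - fst (p J)) \<odot>\<^bsub>M\<^esub> kdiff (q + s + fst (p J)) (b J) I"
      using kdiff_y_power[OF Is, of "b J" "T - fst (p J)" "q + s + fst (p J)"] bW Wc unfolding t v_def by simp
    also have "kdiff (q + s + fst (p J)) (b J) I = y_power I (fst (p J)) \<odot>\<^bsub>M\<^esub> a J I"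
      using p(2)[OF J I] J by (simp add: b_def[abs_def])
    also have "y_power I (T - fst (p J)) \<odot>\<^bsub>M\<^esub> (y_power I (fst (p J)) \<odot>\<^bsub>M\<^esub> a J I) = y_power I T \<odot>\<^bsub>M\<^esub> a J I"
      using y_power_add[OF Is, of "T - fst (p J)" "fst (p J)"] T[OF J] aW Wc yc by (simp flip: smult_assoc1)
    also have "\<dots> = y_power I T \<odot>\<^bsub>M\<^esub> diagonal x s I J \<ominus>\<^bsub>M\<^esub> y_power I T \<odot>\<^bsub>M\<^esub> lower q (w I) J"
      using yc lc dc by (simp add: a_def a_minus_def smult_r_distr smult_r_minus)
    finally show ?thesis by (simp add: y_power_diagonal[OF xc Is])
  qed
  have "kdiff (q + (s + T)) (\<lambda>I. diagonal x (s + T) I J \<ominus>\<^bsub>M\<^esub> lower q (v I) J) I = \<zero>\<^bsub>M\<^esub>"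
    if I: "I \<in> face_sets (Suc i)" and J: "J \<in> face_sets i" for I J
  proof -
    note Is = face_sets_subset[OF I] and Js = face_sets_subset[OF J]
    have yc: "y_power I T \<in> carrier R" by (rule y_power_closed[OF Is])
    have c: "w I J \<in> carrier M" "v I J \<in> carrier M" "diagonal x (s + T) I J \<in> carrier M" for I J
      using w vW dW Wc by auto
    have lc: "lower q (w I) J \<in> carrier M" "lower q (v I) J \<in> carrier M" for I J
      using c by (auto intro!: lower_closed)
    have "lower q (\<lambda>J. kdiff (q + (s + T)) (\<lambda>I. v I J) I) J
      = lower q (\<lambda>J. diagonal x (s + T) I J \<ominus>\<^bsub>M\<^esub> y_power I T \<odot>\<^bsub>M\<^esub> lower q (w I) J) J"
      by (rule lower_cong[OF J _ kv[OF I]]) (use c lc yc in auto)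
    also have "\<dots> = lower q (diagonal x (s + T) I) J \<ominus>\<^bsub>M\<^esub> y_power I T \<odot>\<^bsub>M\<^esub> lower q (lower q (w I)) J"
      using c lc yc by (simp add: lower_minus lower_smult)
    also have "\<dots> = lower q (diagonal x (s + T) I) J"
      using lower_lower[OF Js, of "w I"] c yc lower_closed[of "diagonal x (s + T) I" q J] by simp
    finally have 1: "lower q (\<lambda>J. kdiff (q + (s + T)) (\<lambda>I. v I J) I) J = lower q (diagonal x (s + T) I) J" .
    have "kdiff (q + (s + T)) (\<lambda>I. diagonal x (s + T) I J \<ominus>\<^bsub>M\<^esub> lower q (v I) J) I
      = kdiff (q + (s + T)) (\<lambda>I. diagonal x (s + T) I J) I \<ominus>\<^bsub>M\<^esub> kdiff (q + (s + T)) (\<lambda>I. lower q (v I) J) I"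
      by (rule kdiff_minus[OF Is]) (use c lc in auto)
    also have "\<dots> = lower q (diagonal x (s + T) I) J \<ominus>\<^bsub>M\<^esub> lower q (diagonal x (s + T) I) J"
      unfolding kdiff_diagonal[OF xc I J] by (subst kdiff_lower[OF Is Js]) (use c 1 in auto)
    also have "\<dots> = \<zero>\<^bsub>M\<^esub>"
      using lower_closed[of "diagonal x (s + T) I" q J] c by (simp add: a_minus_def M.r_neg)
    finally show ?thesis .
  qed
  then show ?thesis
    using vW unfolding truncated_def by blast
qed

text \<open>There are no faces of size n + 1, so the zero correction will do.\<close>

lemma truncated_top: "submodule W R M \<Longrightarrow> truncated W x q n"
proof -
  assume W: "submodule W R M"
  have "face_sets (Suc n) = {}"
  proof (rule equals0I)
    fix I assume "I \<in> face_sets (Suc n)"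
    then have "I \<subseteq> {1..n}" "card I = Suc n" by (simp_all add: face_sets_def)
    with card_mono[OF _ this(1)] show False by simp
  qed
  then show ?thesis
    using submodule_zero[OF W] unfolding truncated_def
    by (intro exI[of _ 0] exI[of _ "\<lambda>_ _. \<zero>\<^bsub>M\<^esub>"]) simp
qed

lemma truncated_descend:
  assumes W: "submodule W R M" and x: "x \<in> W" and tr: "truncated W x q m"
    and ex: "\<And>i. l < i \<Longrightarrow> i \<le> m \<Longrightarrow> colim_exact W i" and "l \<le> m"
  shows "truncated W x q l"
  using assms(5)
proof (induction rule: inc_induct)
  case base
  show ?case by (rule tr)
next
  case (step i)
  then show ?case using truncated_step[OF W x ex] by simp
qed

text \<open>This change of coefficients joins the two halves of the argument: a correction found in
  W serves also in a larger module, which is exact in other degrees.\<close>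

lemma truncated_mono: "truncated W x q i \<Longrightarrow> W \<subseteq> W' \<Longrightarrow> truncated W' x q i"
  unfolding truncated_def by blast

text \<open>In degree 0 the corrected diagonal is x minus \<open>lower q (w {}) {}\<close>. It is a
  cocycle, coboundaries vanish at the empty set and \<open>y_power {} t\<close> is 1, so it is zero
  and x is a combination of elements y_l^q m. In the applications V is a step of a
  filtration.\<close>

lemma truncated_0_mem:
  assumes W: "submodule W R M" and x: "x \<in> W" and tr: "truncated W x q 0" and ex: "colim_exact W 0"
    and V: "submodule V R M" "\<And>l m. l \<in> {1..n} \<Longrightarrow> m \<in> carrier M \<Longrightarrow> y l [^] q \<odot>\<^bsub>M\<^esub> m \<in> V"
  shows "x \<in> V"
proof -
  have Wc: "u \<in> carrier M" if "u \<in> W" for u using submoduleE(1)[OF W] that by auto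
  obtain s w where w': "\<forall>I J. w I J \<in> W" and cyc': "\<forall>I\<in>face_sets (Suc 0). \<forall>J\<in>face_sets 0.
      kdiff (q + s) (\<lambda>I. diagonal x s I J \<ominus>\<^bsub>M\<^esub> lower q (w I) J) I = \<zero>\<^bsub>M\<^esub>"
    using tr unfolding truncated_def by (elim exE conjE) (rule that)
  have w: "\<And>I J. w I J \<in> W" and cyc: "\<And>I. I \<in> face_sets (Suc 0) \<Longrightarrow>
      kdiff (q + s) (\<lambda>I. diagonal x s I {} \<ominus>\<^bsub>M\<^esub> lower q (w I) {}) I = \<zero>\<^bsub>M\<^esub>"
    using w' cyc' by simp_all
  let ?a = "\<lambda>I. diagonal x s I {} \<ominus>\<^bsub>M\<^esub> lower q (w I) {}"
  have aW: "?a I \<in> W" for I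
    by (intro submodule_minus[OF W] diagonal_mem[OF W x] lower_mem[OF W] w)
  have "\<exists>t b. (\<forall>I. b I \<in> W) \<and> (\<forall>I\<in>face_sets 0. y_power I t \<odot>\<^bsub>M\<^esub> ?a I = kdiff (q + s + t) b I)"
    using ex unfolding colim_exact_def
    by (elim allE[of _ "q + s"] allE[of _ ?a] impE) (use aW cyc in auto)
  then have "?a {} = \<zero>\<^bsub>M\<^esub>" using Wc[OF aW[of "{}"]] by auto
  moreover have lc: "lower q (w {}) {} \<in> carrier M" using w Wc by (intro lower_closed) auto
  ultimately have "x = lower q (w {}) {}"
    using Wc[OF x] M.diff_eq_zeroD[of x "lower q (w {}) {}"] by (simp add: diagonal_def)
  also have "\<dots> \<in> V"
    unfolding lower_def
  proof (rule submodule_finsum[OF V(1)])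
    fix l assume "l \<in> {1..n} - {}"
    then have l: "l \<in> {1..n}" by auto
    show "coeff q (insert l {}) l \<odot>\<^bsub>M\<^esub> w {} (insert l {}) \<in> V"
      using V(2)[OF l Wc[OF w]] submoduleE(4)[OF V(1)] y_closed[OF l] Wc[OF w]
      by (simp add: coeff_def smult_assoc1)
  qed simp
  finally show ?thesis .
qed

text \<open>The Koszul analogue of the fact that a map from a complex in degrees below \<open>g\<close> to a complex in
  degrees at least \<open>g\<close> is zero: the localized identity chain map is pushed off the degrees \<open>\<ge> g\<close> using
  \<open>W\<close> and then off the degrees \<open>< g\<close> using the whole module.\<close>

lemma exactness_gap:
  fixes q :: nat
  assumes W: "submodule W R M" "x \<in> W" and g: "1 \<le> g"
    and hi: "\<And>i. g \<le> i \<Longrightarrow> i \<le> n \<Longrightarrow> colim_exact W i"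
    and lo: "\<And>i. i < g \<Longrightarrow> i \<le> n \<Longrightarrow> colim_exact (carrier M) i"
    and V: "submodule V R M" "\<And>l m. l \<in> {1..n} \<Longrightarrow> m \<in> carrier M \<Longrightarrow> y l [^] q \<odot>\<^bsub>M\<^esub> m \<in> V"
  shows "x \<in> V"
proof -
  \<comment> \<open>The degrees from g to n are removed with primitives in W, those from g - 1 down
    to 0 with primitives in M. The minimum keeps the meeting point at most n.\<close>
  let ?m = "min (g - 1) n"
  have xM: "x \<in> carrier M" "W \<subseteq> carrier M" using W submoduleE(1) by auto
  have "truncated W x q ?m"
    by (rule truncated_descend[OF W truncated_top[OF W(1)]]) (use g hi in auto)
  then have "truncated (carrier M) x q ?m"
    using truncated_mono xM(2) by blast
  then have "truncated (carrier M) x q 0"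
    by (rule truncated_descend[OF carrier_is_submodule xM(1)]) (use g lo in auto)
  then show ?thesis
    by (rule truncated_0_mem[OF carrier_is_submodule xM(1) _ _ V]) (use g lo in auto)
qed

end

section \<open>Noetherian rings and modules\<close>

definition acc_ideals :: "('r, 'b) ring_scheme \<Rightarrow> bool" where
  "acc_ideals R \<longleftrightarrow> (\<forall>I :: nat \<Rightarrow> 'r set. (\<forall>i. ideal (I i) R) \<and> (\<forall>i. I i \<subseteq> I (Suc i)) \<longrightarrow>
     (\<exists>k. \<forall>i\<ge>k. I i = I k))"

text \<open>Chains are confined to V, so that generators can be adjoined to V inside one module
  M.\<close>

definition acc_submodules :: "('r, 'b) ring_scheme \<Rightarrow> ('r, 'a, 'c) module_scheme \<Rightarrow> 'a set \<Rightarrow> bool" where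
  "acc_submodules R M V \<longleftrightarrow> (\<forall>N :: nat \<Rightarrow> 'a set. (\<forall>i. submodule (N i) R M \<and> N i \<subseteq> V) \<and>
     (\<forall>i. N i \<subseteq> N (Suc i)) \<longrightarrow> (\<exists>k. \<forall>i\<ge>k. N i = N k))"

lemma acc_ideals_maximal:
  assumes acc: "acc_ideals R" and S: "\<And>I. I \<in> S \<Longrightarrow> ideal I R" and I0: "I0 \<in> S"
  shows "\<exists>J\<in>S. I0 \<subseteq> J \<and> (\<forall>J'\<in>S. J \<subseteq> J' \<longrightarrow> J' = J)"
proof (rule ccontr)
  assume neg: "\<not> (\<exists>J\<in>S. I0 \<subseteq> J \<and> (\<forall>J'\<in>S. J \<subseteq> J' \<longrightarrow> J' = J))"
  have step: "\<exists>J'. (J' \<in> S \<and> I0 \<subseteq> J') \<and> J \<subset> J'" if J: "J \<in> S \<and> I0 \<subseteq> J" for J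
  proof -
    have "\<not> (\<forall>J'\<in>S. J \<subseteq> J' \<longrightarrow> J' = J)" using neg J by (metis (lifting))
    then obtain J' where "J' \<in> S" "J \<subseteq> J'" "J' \<noteq> J" by auto
    then show ?thesis using J by (intro exI[of _ J']) auto
  qed
  have "\<exists>f. \<forall>i::nat. (f i \<in> S \<and> I0 \<subseteq> f i) \<and> f i \<subset> f (Suc i)"
  proof (rule dependent_nat_choice[where P = "\<lambda>_ J. J \<in> S \<and> I0 \<subseteq> J" and Q = "\<lambda>_ J J'. J \<subset> J'"])
    show "\<exists>J. J \<in> S \<and> I0 \<subseteq> J" using I0 by auto
    show "\<exists>J'. (J' \<in> S \<and> I0 \<subseteq> J') \<and> J \<subset> J'" if "J \<in> S \<and> I0 \<subseteq> J" for J using step[OF that] .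
  qed
  then obtain f where f': "\<forall>i::nat. (f i \<in> S \<and> I0 \<subseteq> f i) \<and> f i \<subset> f (Suc i)" by (elim exE)
  then have f: "f i \<in> S" "f i \<subset> f (Suc i)" for i by (simp_all only: simp_thms)
  have "\<exists>k. \<forall>i\<ge>k. f i = f k"
    using acc unfolding acc_ideals_def by (elim allE[of _ f] impE) (use f S in auto)
  then obtain k where "\<forall>i\<ge>k. f i = f k" by blast
  then have "f (Suc k) = f k" by (meson le_SucI order_refl)
  then show False using f(2) by blast
qed

text \<open>The colon ideal (U : x), that is, the annihilator of the class of x in M/U.\<close>

definition annihilator :: "('r, 'b) ring_scheme \<Rightarrow> ('r, 'a, 'c) module_scheme \<Rightarrow> 'a set \<Rightarrow> 'a \<Rightarrow> 'r set" where
  "annihilator R M U x = {r \<in> carrier R. r \<odot>\<^bsub>M\<^esub> x \<in> U}"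

definition add_span :: "('r, 'b) ring_scheme \<Rightarrow> ('r, 'a, 'c) module_scheme \<Rightarrow> 'a set \<Rightarrow> 'a \<Rightarrow> 'a set" where
  "add_span R M V a = {v \<oplus>\<^bsub>M\<^esub> r \<odot>\<^bsub>M\<^esub> a | v r. v \<in> V \<and> r \<in> carrier R}"

context module
begin

lemma ideal_annihilator:
  assumes U: "submodule U R M" and x: "x \<in> carrier M"
  shows "ideal (annihilator R M U x) R"
proof (intro idealI R.ring_axioms subgroup.intro)
  fix a assume a: "a \<in> annihilator R M U x"
  then show "inv\<^bsub>add_monoid R\<^esub> a \<in> annihilator R M U x"
    using x submoduleE(3)[OF U] by (auto simp: annihilator_def smult_l_minus simp flip: a_inv_def)
  fix r assume r: "r \<in> carrier R"
  then show "r \<otimes> a \<in> annihilator R M U x"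
    using a x submoduleE(4)[OF U] by (auto simp: annihilator_def smult_assoc1)
  then show "a \<otimes> r \<in> annihilator R M U x"
    using a r by (simp add: annihilator_def m_comm)
qed (use x submoduleE(5)[OF U] submodule_zero[OF U] in \<open>auto simp: annihilator_def smult_l_distr\<close>)

lemma submodule_add_span:
  assumes V: "submodule V R M" and a: "a \<in> carrier M"
  shows "submodule (add_span R M V a) R M"
proof (rule submoduleI)
  have c: "\<And>v. v \<in> V \<Longrightarrow> v \<in> carrier M" using submoduleE(1)[OF V] by auto
  show "add_span R M V a \<subseteq> carrier M" using c a by (auto simp: add_span_def)
  have "\<zero>\<^bsub>M\<^esub> = \<zero>\<^bsub>M\<^esub> \<oplus>\<^bsub>M\<^esub> \<zero> \<odot>\<^bsub>M\<^esub> a" using a by simp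
  then show "\<zero>\<^bsub>M\<^esub> \<in> add_span R M V a"
    using submodule_zero[OF V] R.zero_closed unfolding add_span_def by blast
  fix z assume "z \<in> add_span R M V a"
  then obtain v r where z: "v \<in> V" "r \<in> carrier R" "z = v \<oplus>\<^bsub>M\<^esub> r \<odot>\<^bsub>M\<^esub> a"
    by (auto simp: add_span_def)
  have "\<ominus>\<^bsub>M\<^esub> z = \<ominus>\<^bsub>M\<^esub> v \<oplus>\<^bsub>M\<^esub> (\<ominus> r) \<odot>\<^bsub>M\<^esub> a"
    using z c a by (simp add: M.minus_add smult_l_minus)
  moreover have "\<ominus>\<^bsub>M\<^esub> v \<in> V" "\<ominus> r \<in> carrier R" using z submoduleE(3)[OF V] by auto
  ultimately show "\<ominus>\<^bsub>M\<^esub> z \<in> add_span R M V a"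
    unfolding add_span_def by blast
  {
    fix z' assume "z' \<in> add_span R M V a"
    then obtain v' r' where z': "v' \<in> V" "r' \<in> carrier R" "z' = v' \<oplus>\<^bsub>M\<^esub> r' \<odot>\<^bsub>M\<^esub> a"
      by (auto simp: add_span_def)
    have "z \<oplus>\<^bsub>M\<^esub> z' = (v \<oplus>\<^bsub>M\<^esub> v') \<oplus>\<^bsub>M\<^esub> (r \<oplus> r') \<odot>\<^bsub>M\<^esub> a"
      using z z' c a by (simp add: smult_l_distr M.a_ac)
    moreover have "v \<oplus>\<^bsub>M\<^esub> v' \<in> V" "r \<oplus> r' \<in> carrier R" using z z' submoduleE(5)[OF V] by auto
    ultimately show "z \<oplus>\<^bsub>M\<^esub> z' \<in> add_span R M V a"
      unfolding add_span_def by blast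
  }
  fix s assume s: "s \<in> carrier R"
  have "s \<odot>\<^bsub>M\<^esub> z = s \<odot>\<^bsub>M\<^esub> v \<oplus>\<^bsub>M\<^esub> (s \<otimes> r) \<odot>\<^bsub>M\<^esub> a"
    using z c a s by (simp add: smult_r_distr smult_assoc1)
  moreover have "s \<odot>\<^bsub>M\<^esub> v \<in> V" "s \<otimes> r \<in> carrier R" using z s submoduleE(4)[OF V] by auto
  ultimately show "s \<odot>\<^bsub>M\<^esub> z \<in> add_span R M V a"
    unfolding add_span_def by blast
qed

lemma add_span_supset:
  assumes V: "submodule V R M" and a: "a \<in> carrier M"
  shows "V \<subseteq> add_span R M V a" "a \<in> add_span R M V a"
proof -
  have c: "\<And>v. v \<in> V \<Longrightarrow> v \<in> carrier M" using submoduleE(1)[OF V] by auto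
  show "V \<subseteq> add_span R M V a"
  proof
    fix v assume "v \<in> V"
    moreover from this have "v = v \<oplus>\<^bsub>M\<^esub> \<zero> \<odot>\<^bsub>M\<^esub> a" using a c by simp
    ultimately show "v \<in> add_span R M V a"
      unfolding add_span_def using R.zero_closed by blast
  qed
  have "a = \<zero>\<^bsub>M\<^esub> \<oplus>\<^bsub>M\<^esub> \<one> \<odot>\<^bsub>M\<^esub> a" using a by simp
  then show "a \<in> add_span R M V a"
    unfolding add_span_def using submodule_zero[OF V] R.one_closed by blast
qed

lemma submodule_Int:
  assumes "submodule U R M" "submodule V R M"
  shows "submodule (U \<inter> V) R M"
  using submoduleE[OF assms(1)] submoduleE[OF assms(2)] submodule_zero[OF assms(1)] submodule_zero[OF assms(2)]
  by (intro submoduleI) auto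

text \<open>A chain in V + R a is controlled by two others: its intersections with V, and the ideals
  of coefficients that occur at a. Once both are stationary, so is the chain.\<close>

lemma acc_submodules_add_span:
  assumes acc: "acc_ideals R" and V: "submodule V R M" and aV: "acc_submodules R M V" and a: "a \<in> carrier M"
  shows "acc_submodules R M (add_span R M V a)"
  unfolding acc_submodules_def
proof (intro allI impI, elim conjE)
  fix N :: "nat \<Rightarrow> 'c set"
  assume N': "\<forall>i. submodule (N i) R M \<and> N i \<subseteq> add_span R M V a" and inc: "\<forall>i. N i \<subseteq> N (Suc i)"
  have N: "\<And>i. submodule (N i) R M" "\<And>i. N i \<subseteq> add_span R M V a" using N' by auto
  have mono: "N i \<subseteq> N j" if "i \<le> j" for i j using lift_Suc_mono_le[of N i j] inc that by blast
  have c: "\<And>v. v \<in> V \<Longrightarrow> v \<in> carrier M" using submoduleE(1)[OF V] by auto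
  define I where "I i = {r \<in> carrier R. \<exists>v\<in>V. v \<oplus>\<^bsub>M\<^esub> r \<odot>\<^bsub>M\<^esub> a \<in> N i}" for i
  have I_mult: "s \<otimes> r \<in> I i" if r: "r \<in> I i" and s: "s \<in> carrier R" for r s i
  proof -
    obtain v where v: "v \<in> V" "v \<oplus>\<^bsub>M\<^esub> r \<odot>\<^bsub>M\<^esub> a \<in> N i" "r \<in> carrier R" using r by (auto simp: I_def)
    have "s \<odot>\<^bsub>M\<^esub> (v \<oplus>\<^bsub>M\<^esub> r \<odot>\<^bsub>M\<^esub> a) = s \<odot>\<^bsub>M\<^esub> v \<oplus>\<^bsub>M\<^esub> (s \<otimes> r) \<odot>\<^bsub>M\<^esub> a"
      using v c a s by (simp add: smult_r_distr smult_assoc1)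
    then have "s \<odot>\<^bsub>M\<^esub> v \<oplus>\<^bsub>M\<^esub> (s \<otimes> r) \<odot>\<^bsub>M\<^esub> a \<in> N i"
      using submoduleE(4)[OF N(1)] v s by metis
    then show ?thesis using v s submoduleE(4)[OF V] by (auto simp: I_def)
  qed
  have "ideal (I i) R" for i
  proof (intro idealI R.ring_axioms subgroup.intro)
    fix r r' assume r: "r \<in> I i" and r': "r' \<in> I i"
    then obtain v v' where v: "v \<in> V" "v \<oplus>\<^bsub>M\<^esub> r \<odot>\<^bsub>M\<^esub> a \<in> N i" "r \<in> carrier R"
      "v' \<in> V" "v' \<oplus>\<^bsub>M\<^esub> r' \<odot>\<^bsub>M\<^esub> a \<in> N i" "r' \<in> carrier R"
      by (auto simp: I_def)
    have "(v \<oplus>\<^bsub>M\<^esub> r \<odot>\<^bsub>M\<^esub> a) \<oplus>\<^bsub>M\<^esub> (v' \<oplus>\<^bsub>M\<^esub> r' \<odot>\<^bsub>M\<^esub> a) = (v \<oplus>\<^bsub>M\<^esub> v') \<oplus>\<^bsub>M\<^esub> (r \<oplus> r') \<odot>\<^bsub>M\<^esub> a"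
      using v c a by (simp add: smult_l_distr M.a_ac)
    then have "(v \<oplus>\<^bsub>M\<^esub> v') \<oplus>\<^bsub>M\<^esub> (r \<oplus> r') \<odot>\<^bsub>M\<^esub> a \<in> N i"
      using submoduleE(5)[OF N(1)] v by metis
    then show "r \<otimes>\<^bsub>add_monoid R\<^esub> r' \<in> I i"
      using v submoduleE(5)[OF V] by (auto simp: I_def)
  next
    have "\<zero>\<^bsub>M\<^esub> \<oplus>\<^bsub>M\<^esub> \<zero> \<odot>\<^bsub>M\<^esub> a \<in> N i" using a submodule_zero[OF N(1)] by simp
    then show "\<one>\<^bsub>add_monoid R\<^esub> \<in> I i" using submodule_zero[OF V] by (auto simp: I_def)
  next
    fix r assume r: "r \<in> I i"
    then have rc: "r \<in> carrier R" by (simp add: I_def)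
    have "\<ominus> \<one> \<otimes> r \<in> I i" by (rule I_mult[OF r]) simp
    then show "inv\<^bsub>add_monoid R\<^esub> r \<in> I i" using rc by (simp add: l_minus flip: a_inv_def)
    fix s assume s: "s \<in> carrier R"
    show "s \<otimes> r \<in> I i" by (rule I_mult[OF r s])
    then show "r \<otimes> s \<in> I i" using rc s by (simp add: m_comm)
  qed (auto simp: I_def)
  moreover have "I i \<subseteq> I (Suc i)" for i using inc by (auto simp: I_def)
  ultimately have "\<exists>k. \<forall>i\<ge>k. I i = I k"
    using acc unfolding acc_ideals_def by (elim allE[of _ I]) auto
  then obtain k1 where k1: "\<And>i. i \<ge> k1 \<Longrightarrow> I i = I k1" by auto
  have "submodule (N i \<inter> V) R M" for i using submodule_Int[OF N(1) V] .
  then have "\<exists>k. \<forall>i\<ge>k. N i \<inter> V = N k \<inter> V"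
    using aV inc unfolding acc_submodules_def by (elim allE[of _ "\<lambda>i. N i \<inter> V"]) auto
  then obtain k2 where k2: "\<And>i. i \<ge> k2 \<Longrightarrow> N i \<inter> V = N k2 \<inter> V" by auto
  let ?k = "max k1 k2"
  \<comment> \<open>An x in \<open>N i\<close> shares its coefficient r at a with some element of
    \<open>N ?k\<close>; their difference v - v' lies in the stationary intersection with V.\<close>
  have "N i \<subseteq> N ?k" if i: "i \<ge> ?k" for i
  proof
    fix x assume x: "x \<in> N i"
    then obtain v r where vr: "v \<in> V" "r \<in> carrier R" "x = v \<oplus>\<^bsub>M\<^esub> r \<odot>\<^bsub>M\<^esub> a"
      using N(2)[of i] by (auto simp: add_span_def)
    then have "r \<in> I i" using x by (auto simp: I_def)
    then have "r \<in> I ?k" using k1[of i] k1[of ?k] i by auto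
    then obtain v' where v': "v' \<in> V" "v' \<oplus>\<^bsub>M\<^esub> r \<odot>\<^bsub>M\<^esub> a \<in> N ?k" by (auto simp: I_def)
    have "x \<ominus>\<^bsub>M\<^esub> (v' \<oplus>\<^bsub>M\<^esub> r \<odot>\<^bsub>M\<^esub> a) \<in> N i"
      using submodule_minus[OF N(1) x] v' mono[OF i] by blast
    also have eq: "x \<ominus>\<^bsub>M\<^esub> (v' \<oplus>\<^bsub>M\<^esub> r \<odot>\<^bsub>M\<^esub> a) = v \<ominus>\<^bsub>M\<^esub> v'"
      using vr v'(1) a c by (simp add: a_minus_def M.minus_add M.a_ac M.r_neg1 M.r_neg2 M.r_neg)
    finally have "v \<ominus>\<^bsub>M\<^esub> v' \<in> N i \<inter> V"
      using submodule_minus[OF V vr(1) v'(1)] by simp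
    then have "v \<ominus>\<^bsub>M\<^esub> v' \<in> N ?k" using k2[of i] k2[of ?k] i by auto
    then have "(v \<ominus>\<^bsub>M\<^esub> v') \<oplus>\<^bsub>M\<^esub> (v' \<oplus>\<^bsub>M\<^esub> r \<odot>\<^bsub>M\<^esub> a) \<in> N ?k"
      using v'(2) submoduleE(5)[OF N(1)] by blast
    also have "(v \<ominus>\<^bsub>M\<^esub> v') \<oplus>\<^bsub>M\<^esub> (v' \<oplus>\<^bsub>M\<^esub> r \<odot>\<^bsub>M\<^esub> a) = x"
    proof -
      have "v \<in> carrier M" "v' \<in> carrier M" "r \<odot>\<^bsub>M\<^esub> a \<in> carrier M" using vr v'(1) a c by auto
      then have "(v \<ominus>\<^bsub>M\<^esub> v') \<oplus>\<^bsub>M\<^esub> (v' \<oplus>\<^bsub>M\<^esub> r \<odot>\<^bsub>M\<^esub> a) = v \<oplus>\<^bsub>M\<^esub> r \<odot>\<^bsub>M\<^esub> a"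
        by (simp add: a_minus_def M.a_assoc M.r_neg1)
      then show ?thesis using vr(3) by simp
    qed
    finally show "x \<in> N ?k" .
  qed
  then show "\<exists>k. \<forall>i\<ge>k. N i = N k" using mono by blast
qed

lemma acc_submodules_if_finitely_generated:
  assumes acc: "acc_ideals R" and A: "finite A" "A \<subseteq> carrier M"
    and gen: "\<And>W. submodule W R M \<Longrightarrow> A \<subseteq> W \<Longrightarrow> W = carrier M"
  shows "acc_submodules R M (carrier M)"
proof -
  have "\<exists>V. submodule V R M \<and> A \<subseteq> V \<and> acc_submodules R M V"
    using A
  proof (induction A)
    case empty
    have z: "submodule {\<zero>\<^bsub>M\<^esub>} R M" by (intro submoduleI) auto
    have "N = {\<zero>\<^bsub>M\<^esub>}" if "submodule N R M" "N \<subseteq> {\<zero>\<^bsub>M\<^esub>}" for N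
      using that submodule_zero by blast
    then have "acc_submodules R M {\<zero>\<^bsub>M\<^esub>}" unfolding acc_submodules_def by metis
    then show ?case using z by blast
  next
    case (insert a A)
    then obtain V where V: "submodule V R M" "A \<subseteq> V" "acc_submodules R M V" by auto
    have a: "a \<in> carrier M" using insert by simp
    show ?case
      using submodule_add_span[OF V(1) a] add_span_supset[OF V(1) a] V(2)
        acc_submodules_add_span[OF acc V(1,3) a] by blast
  qed
  then show ?thesis using gen by metis
qed

text \<open>The annihilators of nonzero classes of M/U that are maximal among all such. Maximality
  makes them pairwise incomparable, and they turn out to be prime and finite in number: the
  hypotheses of prime avoidance.\<close>

definition maximal_annihilators :: "'c set \<Rightarrow> 'a set set" where
  "maximal_annihilators U = {P. (\<exists>x\<in>carrier M - U. P = annihilator R M U x) \<and>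
     (\<forall>x\<in>carrier M - U. P \<subseteq> annihilator R M U x \<longrightarrow> annihilator R M U x = P)}"

lemma maximal_annihilator_exists:
  assumes acc: "acc_ideals R" and U: "submodule U R M" and x: "x \<in> carrier M" "x \<notin> U"
  shows "\<exists>P\<in>maximal_annihilators U. annihilator R M U x \<subseteq> P"
proof -
  let ?S = "annihilator R M U ` (carrier M - U)"
  have "\<exists>J\<in>?S. annihilator R M U x \<subseteq> J \<and> (\<forall>J'\<in>?S. J \<subseteq> J' \<longrightarrow> J' = J)"
    by (rule acc_ideals_maximal[OF acc]) (use x ideal_annihilator[OF U] in auto)
  then show ?thesis unfolding maximal_annihilators_def by auto
qed

text \<open>If a b is in P = (U : x) and b is not, then b x is outside U and (U : b x) contains P.
  By maximality they agree, and a lies in (U : b x).\<close>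

lemma maximal_annihilator_prime:
  assumes U: "submodule U R M" and P: "P \<in> maximal_annihilators U"
  shows "primeideal P R"
proof -
  obtain x where x: "x \<in> carrier M" "x \<notin> U" "P = annihilator R M U x"
    and mx: "\<And>z. z \<in> carrier M \<Longrightarrow> z \<notin> U \<Longrightarrow> P \<subseteq> annihilator R M U z \<Longrightarrow> annihilator R M U z = P"
    using P unfolding maximal_annihilators_def by auto
  show ?thesis
  proof (intro primeidealI)
    show "ideal P R" using ideal_annihilator[OF U x(1)] x(3) by simp
    show "cring R" by (rule R.is_cring)
    have "\<one> \<notin> P" using x by (simp add: annihilator_def)
    then show "carrier R \<noteq> P" by auto
    fix a b assume ab: "a \<in> carrier R" "b \<in> carrier R" "a \<otimes> b \<in> P"
    show "a \<in> P \<or> b \<in> P"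
    proof (rule disjCI)
      assume b: "b \<notin> P"
      have "b \<odot>\<^bsub>M\<^esub> x \<notin> U" using b ab x by (simp add: annihilator_def)
      moreover have "P \<subseteq> annihilator R M U (b \<odot>\<^bsub>M\<^esub> x)"
      proof
        fix r assume r: "r \<in> P"
        then have "b \<odot>\<^bsub>M\<^esub> (r \<odot>\<^bsub>M\<^esub> x) \<in> U" "r \<in> carrier R"
          using x ab submoduleE(4)[OF U] by (auto simp: annihilator_def)
        then show "r \<in> annihilator R M U (b \<odot>\<^bsub>M\<^esub> x)"
          using ab x by (simp add: annihilator_def m_comm flip: smult_assoc1)
      qed
      ultimately have "annihilator R M U (b \<odot>\<^bsub>M\<^esub> x) = P" using mx ab x by simp
      moreover have "a \<odot>\<^bsub>M\<^esub> (b \<odot>\<^bsub>M\<^esub> x) \<in> U"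
        using ab x by (simp add: annihilator_def smult_assoc1)
      ultimately show "a \<in> P" using ab by (auto simp: annihilator_def)
    qed
  qed
qed

text \<open>Take from each ideal an element outside P and multiply. In contrapositive form: a prime
  containing a finite intersection of ideals contains one of them.\<close>

lemma prime_not_contains_Int:
  assumes P: "primeideal P R" and "finite F" "\<And>P'. P' \<in> F \<Longrightarrow> ideal P' R \<and> \<not> P' \<subseteq> P"
  shows "\<exists>c\<in>carrier R. c \<notin> P \<and> (\<forall>P'\<in>F. c \<in> P')"
  using assms(2,3)
proof (induction F)
  case empty
  interpret primeideal P R by (rule P)
  have "\<one> \<notin> P" using one_imp_carrier I_notcarr by auto
  then show ?case by auto
next
  case (insert P' F)
  then obtain c where c: "c \<in> carrier R" "c \<notin> P" "\<forall>P'\<in>F. c \<in> P'" by auto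
  obtain d where d: "d \<in> P'" "d \<notin> P" using insert.prems by blast
  have dc: "d \<in> carrier R" using ideal.Icarr[OF conjunct1[OF insert.prems]] d(1) by auto
  have "d \<otimes> c \<notin> P" using primeideal.I_prime[OF P dc c(1)] c d by auto
  moreover have "d \<otimes> c \<in> P'" using ideal.I_r_closed[OF conjunct1[OF insert.prems] d(1) c(1)] by simp
  moreover have "d \<otimes> c \<in> P''" if "P'' \<in> F" for P''
    using ideal.I_l_closed[OF conjunct1[OF insert.prems[of P'']] _ dc] that c(3) by simp
  ultimately show ?case using dc c by (intro bexI[of _ "d \<otimes> c"]) auto
qed

text \<open>If the f found for F lies in the new prime P, add u c with u in I outside P, and c
  outside P but in all members of F; such c exists because the primes are incomparable. The summand
  moves f out of P and leaves it unchanged modulo the other primes.\<close>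

lemma prime_avoidance:
  assumes "finite F" and "\<And>P. P \<in> F \<Longrightarrow> primeideal P R" and "ideal I R"
    and "\<And>P. P \<in> F \<Longrightarrow> \<not> I \<subseteq> P" and "\<And>P P'. P \<in> F \<Longrightarrow> P' \<in> F \<Longrightarrow> P \<subseteq> P' \<Longrightarrow> P = P'"
  shows "\<exists>f\<in>I. \<forall>P\<in>F. f \<notin> P"
  using assms(1,2,4,5)
proof (induction F)
  case empty
  show ?case using additive_subgroup.zero_closed[OF ideal.axioms(1)[OF assms(3)]] by auto
next
  case (insert P F)
  then obtain f where f: "f \<in> I" "\<forall>P\<in>F. f \<notin> P" by auto
  show ?case
  proof (cases "f \<in> P")
    case False
    then show ?thesis using f by auto
  next
    case True
    obtain u where u: "u \<in> I" "u \<notin> P" using insert.prems(2)[of P] by auto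
    have P: "primeideal P R" using insert.prems(1) by simp
    have id: "ideal P' R" if "P' \<in> insert P F" for P'
      using insert.prems(1)[OF that] primeideal.axioms(1) by auto
    have "\<exists>c\<in>carrier R. c \<notin> P \<and> (\<forall>P'\<in>F. c \<in> P')"
    proof (rule prime_not_contains_Int[OF P insert.hyps(1)])
      fix P' assume "P' \<in> F"
      then show "ideal P' R \<and> \<not> P' \<subseteq> P" using id insert.prems(3)[of P' P] insert.hyps(2) by auto
    qed
    then obtain c where c: "c \<in> carrier R" "c \<notin> P" "\<forall>P'\<in>F. c \<in> P'" by auto
    have uc: "u \<in> carrier R" "f \<in> carrier R" using ideal.Icarr[OF assms(3)] u f by auto
    have w: "u \<otimes> c \<in> I" "u \<otimes> c \<notin> P"
      using ideal.I_r_closed[OF assms(3) u(1) c(1)] primeideal.I_prime[OF P uc(1) c(1)] u c by auto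
    have mem: "b \<in> P'" if "P' \<in> insert P F" "a \<in> P'" "a \<oplus> b \<in> P'" "b \<in> carrier R" for P' a b
    proof -
      interpret ideal P' R by (rule id[OF that(1)])
      have "\<ominus> a \<oplus> (a \<oplus> b) \<in> P'" by (intro a_closed a_inv_closed that)
      then show ?thesis using that Icarr by (simp add: R.r_neg1)
    qed
    have "f \<oplus> u \<otimes> c \<notin> P'" if "P' \<in> insert P F" for P'
    proof
      assume s: "f \<oplus> u \<otimes> c \<in> P'"
      show False
      proof (cases "P' = P")
        case True
        then show ?thesis using mem[OF that _ s] \<open>f \<in> P\<close> w uc c by auto
      next
        case False
        then have "P' \<in> F" using that by simp
        moreover have "u \<otimes> c \<in> P'" using c \<open>P' \<in> F\<close> uc ideal.I_l_closed[OF id[OF that]] by auto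
        ultimately show ?thesis using mem[OF that, of "u \<otimes> c" f] s f uc c by (auto simp: R.a_comm)
      qed
    qed
    moreover have "f \<oplus> u \<otimes> c \<in> I"
      using f w ideal.axioms(1)[OF assms(3)] additive_subgroup.a_closed by fastforce
    ultimately show ?thesis by blast
  qed
qed

text \<open>If \<open>P\<^sub>i\<close> is the annihilator of \<open>x\<^sub>i\<close>, then \<open>x\<^sub>k\<close> lying in the span of \<open>U\<close> and the earlier \<open>x\<^sub>i\<close>
  forces the intersection of the earlier \<open>P\<^sub>i\<close> into \<open>P\<^sub>k\<close>, hence one of them by primality.\<close>

lemma finite_maximal_annihilators:
  assumes U: "submodule U R M" and acc: "acc_submodules R M (carrier M)"
  shows "finite (maximal_annihilators U)"
proof (rule ccontr)
  assume "infinite (maximal_annihilators U)"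
  from infinite_countable_subset[OF this] obtain P :: "nat \<Rightarrow> 'a set"
    where inj: "inj P" and ran: "range P \<subseteq> maximal_annihilators U" by (elim exE conjE)
  have P: "P i \<in> maximal_annihilators U" for i using ran by (rule subsetD) simp
  have "\<exists>x. x \<in> carrier M \<and> x \<notin> U \<and> P i = annihilator R M U x" for i
    using P[of i] unfolding maximal_annihilators_def by auto
  then have "\<forall>i. \<exists>x. x \<in> carrier M \<and> x \<notin> U \<and> P i = annihilator R M U x" ..
  from choice[OF this] obtain x where
    x': "\<forall>i. x i \<in> carrier M \<and> x i \<notin> U \<and> P i = annihilator R M U (x i)" by (elim exE)
  have x: "x i \<in> carrier M" "x i \<notin> U" "P i = annihilator R M U (x i)" for i
    using x'[rule_format, of i] by (auto elim: conjE)
  define N where "N = rec_nat U (\<lambda>k V. add_span R M V (x k))"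
  have N0: "N 0 = U" and NS: "N (Suc k) = add_span R M (N k) (x k)" for k
    by (simp_all add: N_def)
  have sub: "submodule (N k) R M" for k
    by (induction k) (auto simp: N0 NS U submodule_add_span x(1))
  have "\<exists>k. \<forall>i\<ge>k. N i = N k"
    using acc sub submoduleE(1)[OF sub] add_span_supset(1)[OF sub x(1)] unfolding acc_submodules_def
    by (elim allE[of _ N]) (auto simp: NS)
  then obtain k where "N (Suc k) = N k" by (meson le_SucI order_refl)
  then have xk: "x k \<in> N k" using add_span_supset(2)[OF sub x(1)] NS by metis
  have kill: "r \<odot>\<^bsub>M\<^esub> z \<in> U" if "r \<in> carrier R" "\<And>i. i < l \<Longrightarrow> r \<in> P i" "z \<in> N l" for r l z
    using that(2,3)
  proof (induction l arbitrary: z)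
    case 0
    then show ?case using that(1) submoduleE(4)[OF U] by (simp add: N0)
  next
    case (Suc l)
    then obtain v s where v: "v \<in> N l" "s \<in> carrier R" "z = v \<oplus>\<^bsub>M\<^esub> s \<odot>\<^bsub>M\<^esub> x l"
      by (auto simp: NS add_span_def)
    have vc: "v \<in> carrier M" using v(1) submoduleE(1)[OF sub] by auto
    have "s \<odot>\<^bsub>M\<^esub> (r \<odot>\<^bsub>M\<^esub> x l) \<in> U"
      using Suc.prems(1)[of l] x(3)[of l] v(2) submoduleE(4)[OF U] by (simp add: annihilator_def)
    moreover have "r \<odot>\<^bsub>M\<^esub> z = r \<odot>\<^bsub>M\<^esub> v \<oplus>\<^bsub>M\<^esub> s \<odot>\<^bsub>M\<^esub> (r \<odot>\<^bsub>M\<^esub> x l)"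
      using v vc that(1) x(1) by (simp add: smult_r_distr m_comm flip: smult_assoc1)
    moreover have "r \<odot>\<^bsub>M\<^esub> v \<in> U" using Suc v by simp
    ultimately show ?case using submoduleE(5)[OF U] by simp
  qed
  have prime: "primeideal (P i) R" for i using maximal_annihilator_prime[OF U P] .
  have "\<exists>c\<in>carrier R. c \<notin> P k \<and> (\<forall>P'\<in>P ` {..<k}. c \<in> P')"
  proof (rule prime_not_contains_Int[OF prime])
    fix P' assume "P' \<in> P ` {..<k}"
    then obtain i where i: "i < k" "P' = P i" by auto
    have "\<not> P i \<subseteq> P k"
    proof
      assume sub: "P i \<subseteq> P k"
      have "\<forall>z\<in>carrier M - U. P i \<subseteq> annihilator R M U z \<longrightarrow> annihilator R M U z = P i"
        using P[of i] unfolding maximal_annihilators_def by simp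
      then have "annihilator R M U (x k) = P i"
        using x(1,2)[of k] sub unfolding x(3)[of k] by simp
      then have "P i = P k" by (simp only: x(3)[of k])
      then show False using injD[OF inj, of i k] i(1) by simp
    qed
    then show "ideal P' R \<and> \<not> P' \<subseteq> P k" using i prime primeideal.axioms(1) by auto
  qed simp
  then obtain c where c: "c \<in> carrier R" "c \<notin> P k" "\<And>i. i < k \<Longrightarrow> c \<in> P i" by auto
  have "c \<odot>\<^bsub>M\<^esub> x k \<in> U" using kill[OF c(1) c(3) xk] by simp
  then show False using c x(3) by (simp add: annihilator_def)
qed

text \<open>Every zerodivisor on M/U lies in a maximal annihilator. None of these contains I: it is
  (U : x) for some x outside U, and I x inside U is excluded by \<open>depth\<close>. So one element
  of I avoids them all.\<close>

lemma nonzerodivisor_exists: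
  assumes acc: "acc_ideals R" "acc_submodules R M (carrier M)"
    and U: "submodule U R M" and I: "ideal I R"
    and depth: "\<And>x. x \<in> carrier M \<Longrightarrow> (\<And>f. f \<in> I \<Longrightarrow> f \<odot>\<^bsub>M\<^esub> x \<in> U) \<Longrightarrow> x \<in> U"
  shows "\<exists>f\<in>I. \<forall>x\<in>carrier M. f \<odot>\<^bsub>M\<^esub> x \<in> U \<longrightarrow> x \<in> U"
proof -
  have "\<exists>f\<in>I. \<forall>P\<in>maximal_annihilators U. f \<notin> P"
  proof (rule prime_avoidance[OF finite_maximal_annihilators[OF U acc(2)] _ I])
    fix P assume P: "P \<in> maximal_annihilators U"
    then obtain x where x: "x \<in> carrier M" "x \<notin> U" "P = annihilator R M U x"
      unfolding maximal_annihilators_def by auto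
    show "\<not> I \<subseteq> P" using depth[OF x(1)] x by (auto simp: annihilator_def)
    show "primeideal P R" using maximal_annihilator_prime[OF U P] .
    fix P' assume "P' \<in> maximal_annihilators U" "P \<subseteq> P'"
    then show "P = P'" using P unfolding maximal_annihilators_def by blast
  qed
  then obtain f where f: "f \<in> I" "\<And>P. P \<in> maximal_annihilators U \<Longrightarrow> f \<notin> P" by auto
  have "x \<in> U" if x: "x \<in> carrier M" "f \<odot>\<^bsub>M\<^esub> x \<in> U" for x
  proof (rule ccontr)
    assume "x \<notin> U"
    then obtain P where "P \<in> maximal_annihilators U" "annihilator R M U x \<subseteq> P"
      using maximal_annihilator_exists[OF acc(1) U x(1)] by auto
    then show False using f x ideal.Icarr[OF I] by (auto simp: annihilator_def)
  qed
  then show ?thesis using f(1) by auto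
qed

end

lemma (in module) associated_primes_nonempty:
  assumes "acc_ideals R" "nonzero_module M"
  shows "associated_primes R M \<noteq> {}"
proof -
  have z: "submodule {\<zero>\<^bsub>M\<^esub>} R M" by (intro submoduleI) auto
  obtain x where "x \<in> carrier M" "x \<notin> {\<zero>\<^bsub>M\<^esub>}" using assms(2) M.zero_closed unfolding nonzero_module_def by blast
  then obtain P where P: "P \<in> maximal_annihilators {\<zero>\<^bsub>M\<^esub>}"
    using maximal_annihilator_exists[OF assms(1) z] by auto
  then obtain z where "z \<in> carrier M" "P = annihilator R M {\<zero>\<^bsub>M\<^esub>} z"
    unfolding maximal_annihilators_def by auto
  then have "P \<in> associated_primes R M"
    using maximal_annihilator_prime[OF z P] unfolding associated_primes_def annihilator_def by auto
  then show ?thesis by auto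
qed

section \<open>Hilbert's basis theorem\<close>

text \<open>Rings are subsets of a type of class \<open>comm_ring_1\<close> here, so that
  polynomials in fewer variables lie in the same type and the induction on variables adjoins one
  element to a subring.\<close>

definition ring_on :: "'r::comm_ring_1 set \<Rightarrow> 'r ring" where
  "ring_on A = \<lparr>carrier = A, mult = (*), one = 1, zero = 0, add = (+)\<rparr>"

definition subring_on :: "'r::comm_ring_1 set \<Rightarrow> bool" where
  "subring_on A \<longleftrightarrow> 1 \<in> A \<and> (\<forall>x\<in>A. -x \<in> A) \<and> (\<forall>x\<in>A. \<forall>y\<in>A. x + y \<in> A \<and> x * y \<in> A)"

definition ideal_on :: "'r::comm_ring_1 set \<Rightarrow> 'r set \<Rightarrow> bool" where
  "ideal_on A I \<longleftrightarrow> I \<subseteq> A \<and> 0 \<in> I \<and> (\<forall>x\<in>I. \<forall>y\<in>I. x + y \<in> I) \<and> (\<forall>a\<in>A. \<forall>x\<in>I. a * x \<in> I)"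

definition acc_on :: "'r::comm_ring_1 set \<Rightarrow> bool" where
  "acc_on A \<longleftrightarrow> (\<forall>I :: nat \<Rightarrow> 'r set. (\<forall>i. ideal_on A (I i)) \<and> (\<forall>i. I i \<subseteq> I (Suc i)) \<longrightarrow>
     (\<exists>k. \<forall>i\<ge>k. I i = I k))"

lemma subring_on_zero: "subring_on A \<Longrightarrow> 0 \<in> A"
  unfolding subring_on_def by (metis add.right_inverse)

lemma cring_ring_on:
  assumes "subring_on A"
  shows "cring (ring_on A)"
proof (intro cringI abelian_groupI comm_monoidI)
  fix x assume "x \<in> carrier (ring_on A)"
  then show "\<exists>z\<in>carrier (ring_on A). z \<oplus>\<^bsub>ring_on A\<^esub> x = \<zero>\<^bsub>ring_on A\<^esub>"
    using assms by (auto simp: ring_on_def subring_on_def intro!: bexI[of _ "-x"])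
qed (use assms subring_on_zero[OF assms] in \<open>auto simp: ring_on_def subring_on_def algebra_simps\<close>)

lemma acc_ideals_ring_on:
  assumes A: "acc_on A"
  shows "acc_ideals (ring_on A)"
proof -
  have "ideal_on A I" if "ideal I (ring_on A)" for I
  proof -
    note sub = ideal.axioms(1)[OF that]
    show ?thesis
      using additive_subgroup.a_subset[OF sub] additive_subgroup.zero_closed[OF sub]
        additive_subgroup.a_closed[OF sub] ideal.I_l_closed[OF that]
      by (auto simp: ideal_on_def ring_on_def)
  qed
  then show ?thesis using A unfolding acc_ideals_def acc_on_def by blast
qed

text \<open>No algebraic independence of \<open>v\<close> over \<open>A\<close> is required: \<open>L d i\<close> consists of the leading
  coefficients of all expressions of formal degree \<open>d\<close> with value in \<open>I i\<close>.\<close>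

lemma acc_on_adjoin:
  fixes A B :: "'r::comm_ring_1 set"
  assumes A: "subring_on A" "acc_on A" and B: "A \<subseteq> B" "v \<in> B"
    and gen: "\<And>b. b \<in> B \<Longrightarrow> \<exists>d a. (\<forall>i. a i \<in> A) \<and> b = (\<Sum>j<d::nat. a j * v ^ j)"
  shows "acc_on B"
  unfolding acc_on_def
proof (intro allI impI, elim conjE)
  fix I :: "nat \<Rightarrow> 'r set"
  assume id': "\<forall>i. ideal_on B (I i)" and inc: "\<forall>i. I i \<subseteq> I (Suc i)"
  have mono: "I i \<subseteq> I j" if "i \<le> j" for i j using lift_Suc_mono_le[of I i j] inc that by blast
  have I_add: "x + z \<in> I i" if "x \<in> I i" "z \<in> I i" for x z i
    using id'[rule_format, of i] that by (simp add: ideal_on_def)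
  have I_mult: "b * x \<in> I i" if "x \<in> I i" "b \<in> B" for x b i
    using id'[rule_format, of i] that by (simp add: ideal_on_def)
  have I_0: "0 \<in> I i" for i using id'[rule_format, of i] by (simp add: ideal_on_def)
  have I_diff: "x - z \<in> I i" if "x \<in> I i" "z \<in> I i" for x z i
  proof -
    have "-1 \<in> B" using A(1) B(1) by (auto simp: subring_on_def)
    then have "x + (-1) * z \<in> I i" using that by (intro I_add I_mult)
    then show ?thesis by simp
  qed
  have A_add: "x + z \<in> A" "x * z \<in> A" "- x \<in> A" if "x \<in> A" "z \<in> A" for x z
    using A(1) that by (auto simp: subring_on_def)
  have A_0: "0 \<in> A" by (rule subring_on_zero[OF A(1)])
  define L where "L d i = {a \<in> A. \<exists>c. (\<forall>j. c j \<in> A) \<and> a * v ^ d + (\<Sum>j<d. c j * v ^ j) \<in> I i}" for d i :: nat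
  have L_ideal: "ideal_on A (L d i)" for d i
    unfolding ideal_on_def
  proof (intro conjI ballI)
    show "0 \<in> L d i"
      using A_0 I_0 unfolding L_def by (auto intro!: exI[of _ "\<lambda>_. 0"])
    fix x assume "x \<in> L d i"
    then obtain c where c: "x \<in> A" "\<forall>j. c j \<in> A" "x * v ^ d + (\<Sum>j<d. c j * v ^ j) \<in> I i"
      unfolding L_def by auto
    {
      fix z assume "z \<in> L d i"
      then obtain c' where c': "z \<in> A" "\<forall>j. c' j \<in> A" "z * v ^ d + (\<Sum>j<d. c' j * v ^ j) \<in> I i"
        unfolding L_def by auto
      have "(x + z) * v ^ d + (\<Sum>j<d. (c j + c' j) * v ^ j) \<in> I i"
        using I_add[OF c(3) c'(3)] by (simp add: algebra_simps sum.distrib)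
      moreover have "x + z \<in> A" "\<forall>j. c j + c' j \<in> A" using A_add(1) c(1,2) c'(1,2) by auto
      ultimately show "x + z \<in> L d i"
        unfolding L_def by (intro CollectI conjI exI[of _ "\<lambda>j. c j + c' j"])
    }
    fix a assume a: "a \<in> A"
    have "(a * x) * v ^ d + (\<Sum>j<d. (a * c j) * v ^ j) \<in> I i"
      using I_mult[OF c(3), of a] a B by (auto simp: algebra_simps sum_distrib_left)
    moreover have "a * x \<in> A" "\<forall>j. a * c j \<in> A" using A_add(2) a c(1,2) by auto
    ultimately show "a * x \<in> L d i"
      unfolding L_def by (intro CollectI conjI exI[of _ "\<lambda>j. a * c j"])
  qed (auto simp: L_def)
  have L_i: "L d i \<subseteq> L d j" if "i \<le> j" for d i j
    using mono[OF that] unfolding L_def by blast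
  \<comment> \<open>Multiplication by v raises the formal degree and keeps the leading coefficient;
    the new constant term is 0.\<close>
  have L_Suc: "L d i \<subseteq> L (Suc d) i" for d i
  proof
    fix x assume "x \<in> L d i"
    then obtain c where c: "x \<in> A" "\<forall>j. c j \<in> A" "x * v ^ d + (\<Sum>j<d. c j * v ^ j) \<in> I i"
      unfolding L_def by auto
    let ?c = "\<lambda>j. case j of 0 \<Rightarrow> 0 | Suc j \<Rightarrow> c j"
    have "v * (x * v ^ d + (\<Sum>j<d. c j * v ^ j)) \<in> I i"
      by (rule I_mult[OF c(3) B(2)])
    also have "v * (x * v ^ d + (\<Sum>j<d. c j * v ^ j)) = x * v ^ Suc d + (\<Sum>j<Suc d. ?c j * v ^ j)"
      unfolding sum.lessThan_Suc_shift by (simp add: algebra_simps sum_distrib_left)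
    finally have "x * v ^ Suc d + (\<Sum>j<Suc d. ?c j * v ^ j) \<in> I i" .
    moreover have "\<forall>j. ?c j \<in> A" using c(2) A_0 by (simp split: nat.split)
    ultimately show "x \<in> L (Suc d) i"
      using c(1) unfolding L_def by (intro CollectI conjI exI[of _ ?c])
  qed
  have L_d: "L d i \<subseteq> L e i" if "d \<le> e" for d e i
    using lift_Suc_mono_le[of "\<lambda>d. L d i", OF L_Suc that] .
  have stab: "\<exists>k. \<forall>i\<ge>k. J i = J k" if "\<And>i. ideal_on A (J i)" "\<And>i. J i \<subseteq> J (Suc i)" for J :: "nat \<Rightarrow> 'r set"
    using A(2) that unfolding acc_on_def by (elim allE[of _ J] impE) auto
  \<comment> \<open>The diagonal chain settles all formal degrees from k0 on at once. The finitely
    many d below k0 get a bound \<open>k d\<close> each, and K dominates all these numbers.\<close>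
  have "L i i \<subseteq> L (Suc i) (Suc i)" for i using L_i[of i "Suc i" i] L_Suc[of i "Suc i"] by simp
  from stab[of "\<lambda>i. L i i", OF L_ideal this] obtain k0 where k0: "\<And>i. i \<ge> k0 \<Longrightarrow> L i i = L k0 k0"
    by auto
  have "\<forall>d. \<exists>k. \<forall>i\<ge>k. L d i = L d k"
    using stab[of "L d" for d, OF L_ideal L_i] by simp
  then obtain k where k: "\<And>d i. i \<ge> k d \<Longrightarrow> L d i = L d (k d)" by metis
  define K where "K = k0 + (\<Sum>d<k0. k d)"
  have kK: "k d \<le> K" if "d < k0" for d
    using member_le_sum[of d "{..<k0}" k] that by (simp add: K_def)
  have LK: "L d i \<subseteq> L d K" if "i \<ge> K" for d i
  proof (cases "d < k0")
    case True
    then show ?thesis using k[of d i] k[of d K] kK[OF True] that by auto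
  next
    case False
    let ?m = "max d i"
    have "L d i \<subseteq> L ?m ?m" using L_i[of i ?m d] L_d[of d ?m ?m] by auto
    also have "\<dots> = L k0 k0" using k0[of ?m] False by simp
    also have "\<dots> \<subseteq> L d K" using L_i[of k0 K k0] L_d[of k0 d K] False by (auto simp: K_def)
    finally show ?thesis .
  qed
  have "I i \<subseteq> I K" if i: "i \<ge> K" for i
  proof
    \<comment> \<open>Induction on the formal degree: some element of \<open>I K\<close> has the
      same leading coefficient, and subtracting it leaves an element of \<open>I i\<close> of
      smaller formal degree.\<close>
    have "(\<Sum>j<d. a j * v ^ j) \<in> I K" if "\<forall>j. a j \<in> A" "(\<Sum>j<d. a j * v ^ j) \<in> I i" for d :: nat and a
      using that
    proof (induction d arbitrary: a)
      case 0
      then show ?case using I_0 by simp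
    next
      case (Suc d)
      have "a d * v ^ d + (\<Sum>j<d. a j * v ^ j) \<in> I i"
        using Suc.prems(2) by (simp add: add.commute)
      then have "a d \<in> L d i" using Suc.prems(1) unfolding L_def by auto
      then have "a d \<in> L d K" using LK[OF i] by auto
      then obtain c where c: "\<forall>j. c j \<in> A" "a d * v ^ d + (\<Sum>j<d. c j * v ^ j) \<in> I K"
        unfolding L_def by auto
      have eq: "(\<Sum>j<d. (a j - c j) * v ^ j)
        = (\<Sum>j<Suc d. a j * v ^ j) - (a d * v ^ d + (\<Sum>j<d. c j * v ^ j))"
        by (simp add: algebra_simps sum_subtractf)
      have "(\<Sum>j<d. (a j - c j) * v ^ j) \<in> I i"
        unfolding eq using Suc.prems(2) c(2) mono[OF i] by (intro I_diff) auto
      moreover have "\<forall>j. a j - c j \<in> A"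
        using A_add(1)[OF _ A_add(3)] Suc.prems(1) c(1) by (metis uminus_add_conv_diff add.commute)
      ultimately have "(\<Sum>j<d. (a j - c j) * v ^ j) \<in> I K"
        using Suc.IH[of "\<lambda>j. a j - c j"] by blast
      then have "(\<Sum>j<d. (a j - c j) * v ^ j) + (a d * v ^ d + (\<Sum>j<d. c j * v ^ j)) \<in> I K"
        by (rule I_add[OF _ c(2)])
      then show ?case unfolding eq by simp
    qed
    note main = this
    fix b assume b: "b \<in> I i"
    then have "b \<in> B" using id'[rule_format, of i] by (auto simp: ideal_on_def)
    then obtain d a where "\<forall>j. a j \<in> A" "b = (\<Sum>j<d::nat. a j * v ^ j)" using gen by blast
    then show "b \<in> I K" using main b by blast
  qed
  then show "\<exists>k. \<forall>i\<ge>k. I i = I k" using mono by blast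
qed

section \<open>Polynomial rings in finitely many variables\<close>

definition polys_in :: "'v set \<Rightarrow> (('v \<Rightarrow>\<^sub>0 nat) \<Rightarrow>\<^sub>0 'k::field) set" where
  "polys_in V = {p. \<forall>t\<in>Poly_Mapping.keys p. Poly_Mapping.keys t \<subseteq> V}"

lemma S_ring_eq: "S_ring m n = ring_on (polys_in (Inl ` {1..m} \<union> Inr ` {1..n}))"
  by (simp add: S_ring_def ring_on_def polys_in_def)

lemma sum_monomials: "p = (\<Sum>t\<in>Poly_Mapping.keys p. Poly_Mapping.single t (Poly_Mapping.lookup p t))"
proof (rule poly_mapping_eqI)
  fix t
  show "Poly_Mapping.lookup p t
    = Poly_Mapping.lookup (\<Sum>t\<in>Poly_Mapping.keys p. Poly_Mapping.single t (Poly_Mapping.lookup p t)) t"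
    by (auto simp: lookup_sum lookup_single when_def in_keys_iff)
qed

lemma keys_add_exponent:
  fixes s t :: "'v \<Rightarrow>\<^sub>0 nat"
  shows "Poly_Mapping.keys (s + t) = Poly_Mapping.keys s \<union> Poly_Mapping.keys t"
  by (auto simp: in_keys_iff lookup_add)

lemma subring_polys_in: "subring_on (polys_in V)"
  unfolding subring_on_def
proof (intro conjI ballI)
  show "1 \<in> polys_in V" by (simp add: polys_in_def)
  fix x :: "('a \<Rightarrow>\<^sub>0 nat) \<Rightarrow>\<^sub>0 'b" assume x: "x \<in> polys_in V"
  have "Poly_Mapping.keys (- x) = Poly_Mapping.keys x" by (auto simp: in_keys_iff)
  then show "- x \<in> polys_in V" using x by (simp add: polys_in_def)
  fix y :: "('a \<Rightarrow>\<^sub>0 nat) \<Rightarrow>\<^sub>0 'b" assume y: "y \<in> polys_in V"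
  show "x + y \<in> polys_in V"
    using x y keys_add[of x y] unfolding polys_in_def by blast
  show "x * y \<in> polys_in V"
    unfolding polys_in_def
  proof (intro CollectI ballI)
    fix t assume "t \<in> Poly_Mapping.keys (x * y)"
    then obtain a b where "t = a + b" "a \<in> Poly_Mapping.keys x" "b \<in> Poly_Mapping.keys y"
      using keys_mult[of x y] by blast
    then show "Poly_Mapping.keys t \<subseteq> V" using x y by (simp add: polys_in_def keys_add_exponent)
  qed
qed

text \<open>The elements are constants, so a nonzero ideal contains a unit and is
  everything.\<close>

lemma acc_polys_in_empty: "acc_on (polys_in {} :: (('v \<Rightarrow>\<^sub>0 nat) \<Rightarrow>\<^sub>0 'k::field) set)"
  unfolding acc_on_def
proof (intro allI impI, elim conjE)
  fix I :: "nat \<Rightarrow> (('v \<Rightarrow>\<^sub>0 nat) \<Rightarrow>\<^sub>0 'k) set"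
  assume id: "\<forall>i. ideal_on (polys_in {}) (I i)" and inc: "\<forall>i. I i \<subseteq> I (Suc i)"
  have mono: "I i \<subseteq> I j" if "i \<le> j" for i j
    by (rule lift_Suc_mono_le[where f = I, OF inc[rule_format] that])
  have const: "Poly_Mapping.single 0 c \<in> polys_in {}" for c :: 'k
    by (simp add: polys_in_def)
  have full: "I i = polys_in {}" if x: "x \<in> I i" "x \<noteq> 0" for x i
  proof
    show sub: "I i \<subseteq> polys_in {}" using id[rule_format, of i] by (simp add: ideal_on_def)
    have "x \<in> polys_in {}" using sub x(1) by (rule subsetD)
    then have "Poly_Mapping.keys x \<subseteq> {0}" by (auto simp: polys_in_def)
    then have kx: "Poly_Mapping.keys x = {0}" using x(2) by (auto simp: subset_singleton_iff intro: poly_mapping_eqI)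
    define c where "c = Poly_Mapping.lookup x 0"
    have "x = Poly_Mapping.single 0 c"
      unfolding c_def by (subst sum_monomials) (simp add: kx)
    moreover have "c \<noteq> 0" using kx by (metis c_def in_keys_iff insertI1)
    ultimately have c: "x = Poly_Mapping.single 0 c" "c \<noteq> 0" .
    show "polys_in {} \<subseteq> I i"
    proof
      fix z :: "('v \<Rightarrow>\<^sub>0 nat) \<Rightarrow>\<^sub>0 'k" assume z: "z \<in> polys_in {}"
      have "z * Poly_Mapping.single 0 (inverse c) \<in> polys_in {}"
        using z const[of "inverse c"] subring_polys_in[of "{}"] unfolding subring_on_def by blast
      then have "(z * Poly_Mapping.single 0 (inverse c)) * x \<in> I i"
        using id[rule_format, of i] x(1) unfolding ideal_on_def by blast
      then show "z \<in> I i" using c by (simp add: mult.assoc mult_single)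
    qed
  qed
  show "\<exists>k. \<forall>i\<ge>k. I i = I k"
  proof (cases "\<exists>i x. x \<in> I i \<and> x \<noteq> 0")
    case True
    then obtain i x where "x \<in> I i" "x \<noteq> 0" by auto
    then have "I j = I i" if "j \<ge> i" for j using full mono[OF that] by blast
    then show ?thesis by blast
  next
    case False
    have "0 \<in> I i" for i using id[rule_format, of i] by (simp add: ideal_on_def)
    then have "I i = {0}" for i using False by blast
    then show ?thesis by simp
  qed
qed

lemma acc_polys_in:
  assumes "finite V"
  shows "acc_on (polys_in V :: (('v \<Rightarrow>\<^sub>0 nat) \<Rightarrow>\<^sub>0 'k::field) set)"
  using assms
proof (induction V)
  case empty
  show ?case by (rule acc_polys_in_empty)
next
  case (insert w V)
  define X :: "('v \<Rightarrow>\<^sub>0 nat) \<Rightarrow>\<^sub>0 'k" where "X = Poly_Mapping.single (Poly_Mapping.single w 1) 1"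
  have Xpow: "X ^ i = Poly_Mapping.single (Poly_Mapping.single w i) 1" for i
    by (induction i) (auto simp: X_def mult_single simp flip: single_add)
  let ?A = "polys_in V :: (('v \<Rightarrow>\<^sub>0 nat) \<Rightarrow>\<^sub>0 'k) set"
  \<comment> \<open>Polynomial expressions in X over the polynomials in V. They are closed under
    addition and contain the monomials in \<open>insert w V\<close>, which yields the generation
    hypothesis of \<open>acc_on_adjoin\<close>.\<close>
  let ?G = "{b. \<exists>d a. (\<forall>i. a i \<in> ?A) \<and> b = (\<Sum>j<d::nat. a j * X ^ j)}"
  have A: "subring_on ?A" by (rule subring_polys_in)
  have A0: "0 \<in> ?A" by (rule subring_on_zero[OF A])
  have Gadd: "b + b' \<in> ?G" if b: "b \<in> ?G" and b': "b' \<in> ?G" for b b'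
  proof -
    obtain d a where a: "\<forall>i. a i \<in> ?A" "b = (\<Sum>j<d::nat. a j * X ^ j)" using b by blast
    obtain d' a' where a': "\<forall>i. a' i \<in> ?A" "b' = (\<Sum>j<d'::nat. a' j * X ^ j)" using b' by blast
    let ?c = "\<lambda>j. (if j < d then a j else 0) + (if j < d' then a' j else 0)"
    have pad: "(\<Sum>j<e. f j * X ^ j) = (\<Sum>j<max d d'. (if j < e then f j else 0) * X ^ j)" if "e \<le> max d d'" for e f
      using that by (intro sum.mono_neutral_cong_left) auto
    have "b + b' = (\<Sum>j<max d d'. ?c j * X ^ j)"
      unfolding a(2) a'(2) by (subst pad[of d], simp, subst pad[of d'], simp)
        (simp add: sum.distrib[symmetric] distrib_right)
    moreover have "\<forall>j. ?c j \<in> ?A" using a(1) a'(1) A A0 by (auto simp: subring_on_def)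
    ultimately show ?thesis by (intro CollectI exI[of _ "max d d'"] exI[of _ ?c] conjI)
  qed
  have Gmono: "Poly_Mapping.single t c \<in> ?G" if t: "Poly_Mapping.keys t \<subseteq> insert w V" for t c
  proof -
    \<comment> \<open>The power of w is split off the exponent t; what remains has its support in V
      and becomes the coefficient of \<open>X ^ ?e\<close>.\<close>
    let ?e = "Poly_Mapping.lookup t w"
    let ?t = "t - Poly_Mapping.single w ?e"
    let ?a = "\<lambda>j. if j = ?e then Poly_Mapping.single ?t c else 0"
    have "Poly_Mapping.lookup ?t w = 0" by (simp add: lookup_minus)
    then have "Poly_Mapping.keys ?t \<subseteq> V"
      using t by (auto simp: in_keys_iff lookup_minus lookup_single when_def subset_iff split: if_splits)
    then have "\<forall>j. ?a j \<in> ?A" using A0 by (auto simp: polys_in_def)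
    moreover have "t = ?t + Poly_Mapping.single w ?e"
      by (rule poly_mapping_eqI) (auto simp: lookup_add lookup_minus lookup_single when_def)
    then have "Poly_Mapping.single t c = (\<Sum>j<Suc ?e. ?a j * X ^ j)"
      by (simp add: Xpow mult_single)
    ultimately show ?thesis by (intro CollectI exI[of _ "Suc ?e"] exI[of _ ?a] conjI)
  qed
  have G0: "0 \<in> ?G" using A0 by (auto intro!: exI[of _ 0])
  show ?case
  proof (rule acc_on_adjoin[OF A insert.IH, of _ X])
    show "?A \<subseteq> polys_in (insert w V)" by (auto simp: polys_in_def)
    show "X \<in> polys_in (insert w V)" by (auto simp: polys_in_def X_def)
    fix b :: "('v \<Rightarrow>\<^sub>0 nat) \<Rightarrow>\<^sub>0 'k" assume b: "b \<in> polys_in (insert w V)"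
    have "(\<Sum>t\<in>T. Poly_Mapping.single t (Poly_Mapping.lookup b t)) \<in> ?G"
      if "finite T" "T \<subseteq> Poly_Mapping.keys b" for T
      using that
    proof (induction T)
      case empty
      show ?case using G0 by simp
    next
      case (insert t T)
      then have t: "Poly_Mapping.keys t \<subseteq> insert w V" using b by (auto simp: polys_in_def)
      have "T \<subseteq> Poly_Mapping.keys b" using insert.prems by simp
      from Gadd[OF Gmono[OF t] insert.IH[OF this]] show ?case
        unfolding sum.insert[OF insert.hyps] .
    qed
    from this[OF finite_keys order_refl] have "b \<in> ?G" unfolding sum_monomials[of b, symmetric] .
    then show "\<exists>d a. (\<forall>i. a i \<in> ?A) \<and> b = (\<Sum>j<d::nat. a j * X ^ j)" by blast
  qed
qed

lemma cring_S_ring: "cring (S_ring m n)"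
  unfolding S_ring_eq by (rule cring_ring_on[OF subring_polys_in])

lemma acc_ideals_S_ring: "acc_ideals (S_ring m n)"
  unfolding S_ring_eq by (intro acc_ideals_ring_on acc_polys_in) auto

lemma y_var_closed: "j \<in> {1..n} \<Longrightarrow> y_var j \<in> carrier (S_ring m n)"
  by (auto simp: S_ring_def y_var_def)

section \<open>Localization and the Cech complex\<close>

context module
begin

lemma frac_relI:
  "a \<in> carrier M \<Longrightarrow> b \<in> carrier M \<Longrightarrow> (f [^] ((t::nat) + l)) \<odot>\<^bsub>M\<^esub> a = (f [^] (t + k)) \<odot>\<^bsub>M\<^esub> b \<Longrightarrow>
    ((a, k), (b, l)) \<in> frac_rel R M f"
  unfolding frac_rel_def by auto

lemma smult_pow_add:
  "f \<in> carrier R \<Longrightarrow> a \<in> carrier M \<Longrightarrow> f [^] (s::nat) \<odot>\<^bsub>M\<^esub> (f [^] (t::nat) \<odot>\<^bsub>M\<^esub> a) = f [^] (s + t) \<odot>\<^bsub>M\<^esub> a"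
  by (simp add: R.nat_pow_mult flip: smult_assoc1)

lemma smult_left_commute:
  "r \<in> carrier R \<Longrightarrow> s \<in> carrier R \<Longrightarrow> a \<in> carrier M \<Longrightarrow> r \<odot>\<^bsub>M\<^esub> (s \<odot>\<^bsub>M\<^esub> a) = s \<odot>\<^bsub>M\<^esub> (r \<odot>\<^bsub>M\<^esub> a)"
  by (simp add: m_comm flip: smult_assoc1)

lemma equiv_frac_rel:
  assumes f: "f \<in> carrier R"
  shows "equiv (carrier M \<times> UNIV) (frac_rel R M f)"
proof (rule equivI)
  show "refl_on (carrier M \<times> UNIV) (frac_rel R M f)"
    by (auto simp: refl_on_def frac_rel_def)
  show "sym (frac_rel R M f)"
    unfolding sym_def frac_rel_def by (clarsimp, metis)
  show "trans (frac_rel R M f)"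
  proof (rule transI)
    fix x y z assume xy: "(x, y) \<in> frac_rel R M f" and yz: "(y, z) \<in> frac_rel R M f"
    obtain a k b l c m where [simp]: "x = (a, k)" "y = (b, l)" "z = (c, m)" by (cases x, cases y, cases z)
    from xy obtain t :: nat where ab: "a \<in> carrier M" "b \<in> carrier M"
      and t: "f [^] (t + l) \<odot>\<^bsub>M\<^esub> a = f [^] (t + k) \<odot>\<^bsub>M\<^esub> b" by (auto simp: frac_rel_def)
    from yz obtain s :: nat where c: "c \<in> carrier M"
      and s: "f [^] (s + m) \<odot>\<^bsub>M\<^esub> b = f [^] (s + l) \<odot>\<^bsub>M\<^esub> c" by (auto simp: frac_rel_def)
    \<comment> \<open>If t and s witness the two relations, then s + t + l witnesses their
      composition; l is the exponent in the denominator of the middle fraction.\<close>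
    have "f [^] ((s + t + l) + m) \<odot>\<^bsub>M\<^esub> a = f [^] (s + m) \<odot>\<^bsub>M\<^esub> (f [^] (t + l) \<odot>\<^bsub>M\<^esub> a)"
      using f ab by (simp add: smult_pow_add add_ac)
    also have "\<dots> = f [^] (t + k) \<odot>\<^bsub>M\<^esub> (f [^] (s + m) \<odot>\<^bsub>M\<^esub> b)"
      using f ab by (simp add: t smult_left_commute)
    also have "\<dots> = f [^] (t + k) \<odot>\<^bsub>M\<^esub> (f [^] (s + l) \<odot>\<^bsub>M\<^esub> c)"
      by (simp only: s)
    also have "\<dots> = f [^] ((s + t + l) + k) \<odot>\<^bsub>M\<^esub> c"
      using f c by (simp add: smult_pow_add add_ac)
    finally show "(x, z) \<in> frac_rel R M f" using ab c by (auto intro: frac_relI)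
  qed
qed (auto simp: frac_rel_def)

lemma frac_eq_iff:
  assumes "f \<in> carrier R" "a \<in> carrier M" "b \<in> carrier M"
  shows "frac R M f a k = frac R M f b l \<longleftrightarrow> (\<exists>t::nat. f [^] (t + l) \<odot>\<^bsub>M\<^esub> a = f [^] (t + k) \<odot>\<^bsub>M\<^esub> b)"
  unfolding frac_def using eq_equiv_class_iff[OF equiv_frac_rel[OF assms(1)], of "(a, k)" "(b, l)"] assms
  by (auto simp: frac_rel_def)

lemma frac_eqI:
  assumes "f \<in> carrier R" "a \<in> carrier M" "b \<in> carrier M"
    "f [^] ((t::nat) + l) \<odot>\<^bsub>M\<^esub> a = f [^] (t + k) \<odot>\<^bsub>M\<^esub> b"
  shows "frac R M f a k = frac R M f b l"
  using assms frac_eq_iff by blast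

lemma frac_expand:
  assumes "f \<in> carrier R" "a \<in> carrier M"
  shows "frac R M f a k = frac R M f (f [^] t \<odot>\<^bsub>M\<^esub> a) (k + t)"
  by (rule frac_eqI[where t = 0]) (use assms in \<open>simp_all add: smult_pow_add\<close>)

lemma frac_zero:
  assumes "f \<in> carrier R"
  shows "frac R M f \<zero>\<^bsub>M\<^esub> k = frac R M f \<zero>\<^bsub>M\<^esub> l"
  by (rule frac_eqI[where t = 0]) (use assms in simp_all)

text \<open>Evaluates the operations defined as unions over representatives: if F takes the same
  value, itself a set, on the whole class, the union is that value, the class being
  nonempty.\<close>

lemma UN_frac:
  assumes f: "f \<in> carrier R" and a: "a \<in> carrier M"
    and const: "\<And>b l t. b \<in> carrier M \<Longrightarrow> f [^] ((t::nat) + l) \<odot>\<^bsub>M\<^esub> a = f [^] (t + k) \<odot>\<^bsub>M\<^esub> b \<Longrightarrow> F b l = F a k"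
  shows "(\<Union>(b, l)\<in>frac R M f a k. F b l) = F a k"
proof -
  have "(a, k) \<in> frac R M f a k"
    using a by (auto simp: frac_def intro: frac_relI[where t = 0])
  then have ne: "frac R M f a k \<noteq> {}" by blast
  have eq: "(case p of (b, l) \<Rightarrow> F b l) = F a k" if p: "p \<in> frac R M f a k" for p
  proof -
    obtain b l where bl: "p = (b, l)" by (cases p)
    from p have "((a, k), (b, l)) \<in> frac_rel R M f" by (simp add: frac_def bl)
    then obtain t :: nat where "b \<in> carrier M" "f [^] (t + l) \<odot>\<^bsub>M\<^esub> a = f [^] (t + k) \<odot>\<^bsub>M\<^esub> b"
      by (auto simp: frac_rel_def)
    then have "F b l = F a k" by (rule const)
    then show ?thesis by (simp add: bl)
  qed
  have "(\<Union>(b, l)\<in>frac R M f a k. F b l) = (\<Union>p\<in>frac R M f a k. F a k)"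
    by (rule SUP_cong[OF refl eq])
  also have "\<dots> = F a k" using ne by simp
  finally show ?thesis .
qed

lemma localized_carrier:
  "carrier (localized_module R M f) = {frac R M f a k | a k. a \<in> carrier M}"
  by (auto simp: localized_module_def frac_def quotient_def)

lemma localized_zero: "\<zero>\<^bsub>localized_module R M f\<^esub> = frac R M f \<zero>\<^bsub>M\<^esub> 0"
  by (simp add: localized_module_def)

lemma localized_smult:
  assumes f: "f \<in> carrier R" and a: "a \<in> carrier M" and r: "r \<in> carrier R"
  shows "r \<odot>\<^bsub>localized_module R M f\<^esub> frac R M f a k = frac R M f (r \<odot>\<^bsub>M\<^esub> a) k"
proof -
  have "(\<Union>(b, l)\<in>frac R M f a k. frac R M f (r \<odot>\<^bsub>M\<^esub> b) l) = frac R M f (r \<odot>\<^bsub>M\<^esub> a) k"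
  proof (rule UN_frac[OF f a])
    fix b l and t :: nat assume b: "b \<in> carrier M" and t: "f [^] (t + l) \<odot>\<^bsub>M\<^esub> a = f [^] (t + k) \<odot>\<^bsub>M\<^esub> b"
    have "f [^] (t + k) \<odot>\<^bsub>M\<^esub> (r \<odot>\<^bsub>M\<^esub> b) = f [^] (t + l) \<odot>\<^bsub>M\<^esub> (r \<odot>\<^bsub>M\<^esub> a)"
      using f a b r t by (simp add: smult_left_commute[of _ r])
    then show "frac R M f (r \<odot>\<^bsub>M\<^esub> b) l = frac R M f (r \<odot>\<^bsub>M\<^esub> a) k"
      using f a b r by (intro frac_eqI) auto
  qed
  then show ?thesis by (simp add: localized_module_def)
qed

lemma localized_add:
  assumes f: "f \<in> carrier R" and a: "a \<in> carrier M" and b: "b \<in> carrier M"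
  shows "frac R M f a k \<oplus>\<^bsub>localized_module R M f\<^esub> frac R M f b l
    = frac R M f (f [^] l \<odot>\<^bsub>M\<^esub> a \<oplus>\<^bsub>M\<^esub> f [^] k \<odot>\<^bsub>M\<^esub> b) (k + l)"
proof -
  let ?F = "\<lambda>a k b l. frac R M f (f [^] l \<odot>\<^bsub>M\<^esub> a \<oplus>\<^bsub>M\<^esub> f [^] k \<odot>\<^bsub>M\<^esub> b) (k + l)"
  \<comment> \<open>Independence of the representative is computed for the first argument only;
    \<open>swap\<close> carries it over to the second.\<close>
  have left: "?F a' k' b l = ?F a k b l"
    if a: "a \<in> carrier M" and a': "a' \<in> carrier M" and b: "b \<in> carrier M"
      and t: "f [^] (t + k') \<odot>\<^bsub>M\<^esub> a = f [^] (t + k) \<odot>\<^bsub>M\<^esub> a'" for a k a' k' b l and t :: nat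
  proof (rule frac_eqI[OF f, where t = t])
    have "f [^] (t + (k + l)) \<odot>\<^bsub>M\<^esub> (f [^] l \<odot>\<^bsub>M\<^esub> a') = f [^] (l + l) \<odot>\<^bsub>M\<^esub> (f [^] (t + k) \<odot>\<^bsub>M\<^esub> a')"
      using f a' by (simp add: smult_pow_add add_ac)
    also have "\<dots> = f [^] (l + l) \<odot>\<^bsub>M\<^esub> (f [^] (t + k') \<odot>\<^bsub>M\<^esub> a)"
      by (simp only: t)
    also have "\<dots> = f [^] (t + (k' + l)) \<odot>\<^bsub>M\<^esub> (f [^] l \<odot>\<^bsub>M\<^esub> a)"
      using f a by (simp add: smult_pow_add add_ac)
    finally show "f [^] (t + (k + l)) \<odot>\<^bsub>M\<^esub> (f [^] l \<odot>\<^bsub>M\<^esub> a' \<oplus>\<^bsub>M\<^esub> f [^] k' \<odot>\<^bsub>M\<^esub> b)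
      = f [^] (t + (k' + l)) \<odot>\<^bsub>M\<^esub> (f [^] l \<odot>\<^bsub>M\<^esub> a \<oplus>\<^bsub>M\<^esub> f [^] k \<odot>\<^bsub>M\<^esub> b)"
      using f a a' b by (simp add: smult_r_distr smult_pow_add add_ac)
  qed (use f a a' b in auto)
  have swap: "?F a k b l = ?F b l a k" if "a \<in> carrier M" "b \<in> carrier M" for a k b l
    using that f by (simp add: M.a_comm add.commute)
  have inner: "(\<Union>(b', l')\<in>frac R M f b l. ?F a k b' l') = ?F a k b l" if a: "a \<in> carrier M" for a k
  proof (rule UN_frac[OF f b])
    fix b' l' and t :: nat
    assume b': "b' \<in> carrier M" "f [^] (t + l') \<odot>\<^bsub>M\<^esub> b = f [^] (t + l) \<odot>\<^bsub>M\<^esub> b'"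
    show "?F a k b' l' = ?F a k b l"
      unfolding swap[OF a b'(1)] swap[OF a b] by (rule left[OF b b'(1) a b'(2)])
  qed
  have "(\<Union>(a', k')\<in>frac R M f a k. \<Union>(b', l')\<in>frac R M f b l. ?F a' k' b' l')
    = (\<Union>(b', l')\<in>frac R M f b l. ?F a k b' l')"
  proof (rule UN_frac[OF f a])
    fix a' k' and t :: nat
    assume a': "a' \<in> carrier M" "f [^] (t + k') \<odot>\<^bsub>M\<^esub> a = f [^] (t + k) \<odot>\<^bsub>M\<^esub> a'"
    show "(\<Union>(b', l')\<in>frac R M f b l. ?F a' k' b' l') = (\<Union>(b', l')\<in>frac R M f b l. ?F a k b' l')"
      unfolding inner[OF a'(1)] inner[OF a] by (rule left[OF a a'(1) b a'(2)])
  qed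
  also have "\<dots> = ?F a k b l" by (rule inner[OF a])
  finally have "(\<Union>(a', k')\<in>frac R M f a k. \<Union>(b', l')\<in>frac R M f b l. ?F a' k' b' l') = ?F a k b l" .
  then show ?thesis by (simp add: localized_module_def)
qed

lemma localized_add_same:
  assumes f: "f \<in> carrier R" and a: "a \<in> carrier M" and b: "b \<in> carrier M"
  shows "frac R M f a k \<oplus>\<^bsub>localized_module R M f\<^esub> frac R M f b k = frac R M f (a \<oplus>\<^bsub>M\<^esub> b) k"
  using frac_expand[OF f, of "a \<oplus>\<^bsub>M\<^esub> b" k k] assms by (simp add: localized_add smult_r_distr)

lemma localized_abelian_monoid:
  assumes f: "f \<in> carrier R"
  shows "abelian_monoid (localized_module R M f)"
proof (rule abelian_monoidI)
  let ?L = "localized_module R M f"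
  show "\<zero>\<^bsub>?L\<^esub> \<in> carrier ?L" by (auto simp: localized_carrier localized_zero)
  fix X assume "X \<in> carrier ?L"
  then obtain a k where X: "X = frac R M f a k" "a \<in> carrier M" by (auto simp: localized_carrier)
  show "\<zero>\<^bsub>?L\<^esub> \<oplus>\<^bsub>?L\<^esub> X = X" using f X by (simp add: localized_zero localized_add)
  fix Y assume "Y \<in> carrier ?L"
  then obtain b l where Y: "Y = frac R M f b l" "b \<in> carrier M" by (auto simp: localized_carrier)
  show "X \<oplus>\<^bsub>?L\<^esub> Y \<in> carrier ?L"
    unfolding X(1) Y(1) localized_add[OF f X(2) Y(2)] localized_carrier using f X Y by blast
  show "X \<oplus>\<^bsub>?L\<^esub> Y = Y \<oplus>\<^bsub>?L\<^esub> X"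
    using f X Y by (simp add: localized_add M.a_comm add.commute)
  fix Z assume "Z \<in> carrier ?L"
  then obtain c m where Z: "Z = frac R M f c m" "c \<in> carrier M" by (auto simp: localized_carrier)
  show "(X \<oplus>\<^bsub>?L\<^esub> Y) \<oplus>\<^bsub>?L\<^esub> Z = X \<oplus>\<^bsub>?L\<^esub> (Y \<oplus>\<^bsub>?L\<^esub> Z)"
    using f X Y Z by (simp add: localized_add smult_r_distr smult_pow_add M.a_assoc add_ac)
qed

lemma localized_finsum:
  assumes f: "f \<in> carrier R" and "finite A" "\<And>j. j \<in> A \<Longrightarrow> g j \<in> carrier M"
  shows "(\<Oplus>\<^bsub>localized_module R M f\<^esub>j\<in>A. frac R M f (g j) k) = frac R M f (\<Oplus>\<^bsub>M\<^esub>j\<in>A. g j) k"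
proof -
  interpret L: abelian_monoid "localized_module R M f" by (rule localized_abelian_monoid[OF f])
  show ?thesis
    using assms(2,3)
  proof (induction A)
    case empty
    show ?case by (simp add: localized_zero frac_zero[OF f, of k 0])
  next
    case (insert j A)
    have "(\<lambda>j. frac R M f (g j) k) \<in> insert j A \<rightarrow> carrier (localized_module R M f)"
      using insert by (auto simp: localized_carrier)
    then show ?case
      using insert f by (simp add: localized_add_same M.finsum_closed Pi_def)
  qed
qed

end

section \<open>The Cech complex in terms of numerators\<close>

context koszul
begin

abbreviation fraction :: "nat set \<Rightarrow> 'c \<Rightarrow> nat \<Rightarrow> ('c \<times> nat) set" where
  "fraction I \<equiv> frac R M (\<Otimes>j\<in>I. y j)"

abbreviation localization :: "nat set \<Rightarrow> ('a, ('c \<times> nat) set) module" where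
  "localization I \<equiv> localized_module R M (\<Otimes>j\<in>I. y j)"

lemma cech_carrier:
  "carrier (cech_module R M n y i) = (\<Pi>\<^sub>E I\<in>face_sets i. carrier (localization I))"
proof -
  have "finite {I \<in> face_sets i. P I}" for P using finite_face_sets by simp
  then show ?thesis unfolding cech_module_def direct_sum_def face_sets_def[symmetric] by simp
qed

lemma cech_zero: "\<zero>\<^bsub>cech_module R M n y i\<^esub> = (\<lambda>I\<in>face_sets i. fraction I \<zero>\<^bsub>M\<^esub> 0)"
  unfolding cech_module_def direct_sum_def face_sets_def[symmetric] by (simp add: localized_zero)

lemma cech_add: "c \<oplus>\<^bsub>cech_module R M n y i\<^esub> c' = (\<lambda>I\<in>face_sets i. c I \<oplus>\<^bsub>localization I\<^esub> c' I)"
  unfolding cech_module_def direct_sum_def face_sets_def[symmetric] by simp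

lemma cech_restrict_frac:
  assumes J: "J \<subseteq> {1..n}" "j \<in> J" and a: "a \<in> carrier M"
  shows "cech_restrict R M y J j (fraction (J - {j}) a k) = fraction J (y j [^] k \<odot>\<^bsub>M\<^esub> a) k"
proof -
  let ?g = "\<Otimes>i\<in>J-{j}. y i"
  have J': "J - {j} \<subseteq> {1..n}" "j \<in> {1..n}" using J by auto
  have g: "?g \<in> carrier R" and yj: "y j \<in> carrier R" and gJ: "(\<Otimes>i\<in>J. y i) \<in> carrier R"
    using prod_y_closed[OF J'(1)] y_closed[OF J'(2)] prod_y_closed[OF J(1)] .
  have "(\<Union>(b, l)\<in>fraction (J - {j}) a k. fraction J (y j [^] l \<odot>\<^bsub>M\<^esub> b) l) = fraction J (y j [^] k \<odot>\<^bsub>M\<^esub> a) k"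
  proof (rule UN_frac[OF g a])
    fix b l and t :: nat assume b: "b \<in> carrier M" and t: "?g [^] (t + l) \<odot>\<^bsub>M\<^esub> a = ?g [^] (t + k) \<odot>\<^bsub>M\<^esub> b"
    have pw: "(\<Otimes>i\<in>J. y i) [^] s = y j [^] s \<otimes> ?g [^] s" for s :: nat
      unfolding prod_y_remove[OF J] by (rule R.nat_pow_distrib[OF yj g])
    have "(\<Otimes>i\<in>J. y i) [^] (t + k) \<odot>\<^bsub>M\<^esub> (y j [^] l \<odot>\<^bsub>M\<^esub> b)
      = y j [^] (t + k + l) \<odot>\<^bsub>M\<^esub> (?g [^] (t + k) \<odot>\<^bsub>M\<^esub> b)"
      unfolding pw using g yj b
      by (simp add: smult_assoc1 smult_left_commute[of "?g [^] (t + k)"] smult_pow_add)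
    also have "\<dots> = y j [^] (t + k + l) \<odot>\<^bsub>M\<^esub> (?g [^] (t + l) \<odot>\<^bsub>M\<^esub> a)"
      by (simp only: t)
    also have "\<dots> = (\<Otimes>i\<in>J. y i) [^] (t + l) \<odot>\<^bsub>M\<^esub> (y j [^] k \<odot>\<^bsub>M\<^esub> a)"
      unfolding pw using g yj a
      by (simp add: smult_assoc1 smult_left_commute[of "?g [^] (l + t)"] smult_pow_add add_ac)
    finally show "fraction J (y j [^] l \<odot>\<^bsub>M\<^esub> b) l = fraction J (y j [^] k \<odot>\<^bsub>M\<^esub> a) k"
      using gJ yj a b by (intro frac_eqI) auto
  qed
  then show ?thesis by (simp add: cech_restrict_def)
qed

text \<open>Over a common denominator exponent k the factor y_j^k in \<open>cech_restrict\<close> is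
  the one in \<open>coeff k\<close>. This translates Cech cochains into Koszul cochains.\<close>

lemma cech_differential_frac:
  assumes a: "\<And>I. a I \<in> carrier M" and c: "\<And>I. I \<in> face_sets i \<Longrightarrow> c I = fraction I (a I) k"
  shows "cech_differential R M n y i c = (\<lambda>J\<in>face_sets (Suc i). fraction J (kdiff k a J) k)"
proof -
  have "(\<Oplus>\<^bsub>localization J\<^esub>j\<in>J. ((\<ominus> \<one>) [^] card {k \<in> J. k < j}) \<odot>\<^bsub>localization J\<^esub> cech_restrict R M y J j (c (J - {j})))
     = fraction J (kdiff k a J) k" if J: "J \<in> face_sets (Suc i)" for J
  proof -
    note Js = face_sets_subset[OF J]
    have g: "(\<Otimes>i\<in>J. y i) \<in> carrier R" by (rule prod_y_closed[OF Js])
    interpret L: abelian_monoid "localization J" by (rule localized_abelian_monoid[OF g])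
    have cl: "coeff k J j \<odot>\<^bsub>M\<^esub> a (J - {j}) \<in> carrier M" if "j \<in> J" for j
      using that Js a by auto
    have "((\<ominus> \<one>) [^] card {k \<in> J. k < j}) \<odot>\<^bsub>localization J\<^esub> cech_restrict R M y J j (c (J - {j}))
      = fraction J (coeff k J j \<odot>\<^bsub>M\<^esub> a (J - {j})) k" if j: "j \<in> J" for j
    proof -
      have yj: "y j \<in> carrier R" using j Js by auto
      show ?thesis
        using g yj a unfolding c[OF face_sets_remove[OF J j]] cech_restrict_frac[OF Js j a]
        by (simp add: localized_smult coeff_def smult_assoc1)
    qed
    then have "(\<Oplus>\<^bsub>localization J\<^esub>j\<in>J. ((\<ominus> \<one>) [^] card {k \<in> J. k < j}) \<odot>\<^bsub>localization J\<^esub> cech_restrict R M y J j (c (J - {j})))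
      = (\<Oplus>\<^bsub>localization J\<^esub>j\<in>J. fraction J (coeff k J j \<odot>\<^bsub>M\<^esub> a (J - {j})) k)"
      using cl by (intro L.finsum_cong') (auto simp: localized_carrier)
    also have "\<dots> = fraction J (kdiff k a J) k"
      unfolding kdiff_def by (rule localized_finsum[OF g face_sets_finite[OF J] cl])
    finally show ?thesis .
  qed
  then show ?thesis
    unfolding cech_differential_def face_sets_def[symmetric] Let_def by (intro restrict_ext) simp
qed

lemma cech_zero_coboundary: "\<zero>\<^bsub>cech_module R M n y (Suc h)\<^esub> \<in> cech_coboundaries R M n y (Suc h)"
proof -
  let ?z = "\<lambda>I\<in>face_sets h. fraction I \<zero>\<^bsub>M\<^esub> 0"
  have "cech_differential R M n y h ?z = (\<lambda>J\<in>face_sets (Suc h). fraction J (kdiff 0 (\<lambda>_. \<zero>\<^bsub>M\<^esub>) J) 0)"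
    by (rule cech_differential_frac) auto
  also have "\<dots> = \<zero>\<^bsub>cech_module R M n y (Suc h)\<^esub>"
    unfolding cech_zero using kdiff_zero face_sets_subset by (intro restrict_ext) auto
  finally have "\<zero>\<^bsub>cech_module R M n y (Suc h)\<^esub> = cech_differential R M n y h ?z" by simp
  moreover have "?z \<in> carrier (cech_module R M n y h)"
    by (auto simp: cech_carrier localized_carrier)
  ultimately show ?thesis by (simp add: cech_coboundaries_def)
qed

lemma cech_zero_add:
  assumes c: "c \<in> carrier (cech_module R M n y i)"
  shows "\<zero>\<^bsub>cech_module R M n y i\<^esub> \<oplus>\<^bsub>cech_module R M n y i\<^esub> c = c"
proof
  fix I
  show "(\<zero>\<^bsub>cech_module R M n y i\<^esub> \<oplus>\<^bsub>cech_module R M n y i\<^esub> c) I = c I"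
  proof (cases "I \<in> face_sets i")
    case True
    interpret L: abelian_monoid "localization I"
      by (rule localized_abelian_monoid[OF prod_y_closed[OF face_sets_subset[OF True]]])
    have "c I \<in> carrier (localization I)" using c True by (auto simp: cech_carrier)
    then show ?thesis using True L.l_zero by (simp add: cech_add cech_zero localized_zero)
  next
    case False
    then show ?thesis using c by (auto simp: cech_add cech_carrier PiE_def extensional_def)
  qed
qed

lemma local_cohomology_carrier:
  "carrier (local_cohomology R M n y i) =
    {{b \<oplus>\<^bsub>cech_module R M n y i\<^esub> z | b. b \<in> cech_coboundaries R M n y i} | z. z \<in> cech_cocycles R M n y i}"
  by (auto simp: local_cohomology_def quotient_module_def A_RCOSETS_def' a_r_coset_def')

lemma local_cohomology_zero: "\<zero>\<^bsub>local_cohomology R M n y i\<^esub> = cech_coboundaries R M n y i"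
  by (simp add: local_cohomology_def quotient_module_def)

text \<open>If the quotient is trivial, the coset of c is the set of coboundaries itself; it
  contains 0 + c because zero is a coboundary.\<close>

lemma cocycle_is_coboundary:
  assumes nz: "\<not> nonzero_module (local_cohomology R M n y (Suc h))"
    and c: "c \<in> cech_cocycles R M n y (Suc h)"
  shows "c \<in> cech_coboundaries R M n y (Suc h)"
proof -
  let ?C = "cech_module R M n y (Suc h)" and ?B = "cech_coboundaries R M n y (Suc h)"
  have "{b \<oplus>\<^bsub>?C\<^esub> c | b. b \<in> ?B} \<in> carrier (local_cohomology R M n y (Suc h))"
    using c unfolding local_cohomology_carrier by blast
  moreover have "carrier (local_cohomology R M n y (Suc h)) = {?B}"
    using nz unfolding nonzero_module_def local_cohomology_zero by simp
  ultimately have eq: "{b \<oplus>\<^bsub>?C\<^esub> c | b. b \<in> ?B} = ?B" by simp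
  have "\<zero>\<^bsub>?C\<^esub> \<oplus>\<^bsub>?C\<^esub> c \<in> {b \<oplus>\<^bsub>?C\<^esub> c | b. b \<in> ?B}"
    by (intro CollectI exI[of _ "\<zero>\<^bsub>?C\<^esub>"] conjI cech_zero_coboundary refl)
  then have "\<zero>\<^bsub>?C\<^esub> \<oplus>\<^bsub>?C\<^esub> c \<in> ?B" by (simp only: eq)
  moreover have "\<zero>\<^bsub>?C\<^esub> \<oplus>\<^bsub>?C\<^esub> c = c"
    using c by (intro cech_zero_add) (simp add: cech_cocycles_def)
  ultimately show ?thesis by simp
qed

lemma face_sets_empty: "n < i \<Longrightarrow> face_sets i = {}"
proof (rule equals0I)
  fix I assume i: "n < i" and "I \<in> face_sets i"
  then have "I \<subseteq> {1..n}" "card I = i" by (simp_all add: face_sets_def)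
  with card_mono[OF _ this(1)] i show False by simp
qed

text \<open>Bounds the set of degrees over which the cohomological dimension takes its
  \<open>GREATEST\<close>.\<close>

lemma local_cohomology_vanishes:
  assumes "n < i"
  shows "\<not> nonzero_module (local_cohomology R M n y i)"
proof -
  obtain h where i: "i = Suc h" using assms by (cases i) auto
  have F: "face_sets i = {}" "face_sets (Suc i) = {}" using assms by (auto intro!: face_sets_empty)
  \<comment> \<open>With no faces of size i, the only extensional function on them is
    \<open>undefined\<close> everywhere; cochains, cocycles and coboundaries all reduce to
    it.\<close>
  let ?C = "cech_module R M n y i" and ?B = "cech_coboundaries R M n y i" and ?u = "\<lambda>_::nat set. undefined :: ('c \<times> nat) set"
  have "?B \<subseteq> {?u}"
  proof -
    have "cech_differential R M n y h e = ?u" for e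
      using F(1) unfolding i cech_differential_def face_sets_def[symmetric] by (simp add: restrict_def)
    then show ?thesis unfolding i cech_coboundaries_def by auto
  qed
  moreover have "\<zero>\<^bsub>?C\<^esub> = ?u" using F by (simp add: cech_zero restrict_def)
  ultimately have B: "?B = {?u}" using cech_zero_coboundary[of h] i by auto
  have C: "carrier ?C = {?u}" using F by (auto simp: cech_carrier)
  have add: "c \<oplus>\<^bsub>?C\<^esub> c' = ?u" for c c' using F by (simp add: cech_add restrict_def)
  have "cech_differential R M n y i ?u = ?u"
    using F(2) unfolding cech_differential_def face_sets_def[symmetric] by (simp add: restrict_def)
  moreover have "\<zero>\<^bsub>cech_module R M n y (Suc i)\<^esub> = ?u" using F(2) by (simp add: cech_zero restrict_def)
  ultimately have "?u \<in> cech_cocycles R M n y i" using C by (simp add: cech_cocycles_def)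
  moreover have "cech_cocycles R M n y i \<subseteq> {?u}" using C by (auto simp: cech_cocycles_def)
  ultimately have Z: "cech_cocycles R M n y i = {?u}" by blast
  show ?thesis
    unfolding nonzero_module_def local_cohomology_carrier local_cohomology_zero B Z add by simp
qed

text \<open>A Koszul cocycle provides the numerators of a Cech cocycle, which is the differential of
  some e. Clearing denominators, first in e and then in the resulting equations between fractions,
  gives the primitive.\<close>

lemma colim_exact_if_local_cohomology_zero:
  assumes nz: "\<not> nonzero_module (local_cohomology R M n y (Suc h))"
  shows "colim_exact (carrier M) (Suc h)"
  unfolding colim_exact_def
proof (intro allI impI, elim conjE)
  fix k a assume a': "\<forall>I. a I \<in> carrier M" and cyc: "\<forall>J\<in>face_sets (Suc (Suc h)). kdiff k a J = \<zero>\<^bsub>M\<^esub>"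
  have a: "\<And>I. a I \<in> carrier M" using a' by blast
  have g: "(\<Otimes>j\<in>I. y j) \<in> carrier R" if "I \<in> face_sets i" for I i
    by (rule prod_y_closed[OF face_sets_subset[OF that]])
  define c where "c = (\<lambda>I\<in>face_sets (Suc h). fraction I (a I) k)"
  have "cech_differential R M n y (Suc h) c = (\<lambda>J\<in>face_sets (Suc (Suc h)). fraction J (kdiff k a J) k)"
    by (rule cech_differential_frac) (use a in \<open>auto simp: c_def\<close>)
  also have "\<dots> = \<zero>\<^bsub>cech_module R M n y (Suc (Suc h))\<^esub>"
    unfolding cech_zero using cyc frac_zero[OF g] by (intro restrict_ext) auto
  finally have "c \<in> cech_cocycles R M n y (Suc h)"
    using a by (auto simp: cech_cocycles_def cech_carrier c_def localized_carrier)
  then have "c \<in> cech_coboundaries R M n y (Suc h)" by (rule cocycle_is_coboundary[OF nz])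
  then obtain e where e: "e \<in> carrier (cech_module R M n y h)" and c_e: "c = cech_differential R M n y h e"
    by (auto simp: cech_coboundaries_def)
  have "\<forall>I\<in>face_sets h. \<exists>p. fst p \<in> carrier M \<and> e I = fraction I (fst p) (snd p)"
  proof
    fix I assume "I \<in> face_sets h"
    with e have "e I \<in> carrier (localization I)" unfolding cech_carrier by (rule PiE_mem)
    then obtain a k where "e I = fraction I a k" "a \<in> carrier M" unfolding localized_carrier by blast
    then show "\<exists>p. fst p \<in> carrier M \<and> e I = fraction I (fst p) (snd p)"
      by (intro exI[of _ "(a, k)"]) simp
  qed
  then obtain p where p: "\<forall>I\<in>face_sets h. fst (p I) \<in> carrier M \<and> e I = fraction I (fst (p I)) (snd (p I))"
    by (rule bchoice[THEN exE])
  \<comment> \<open>A common denominator exponent for the finitely many components of e.\<close>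
  define K where "K = (\<Sum>I\<in>face_sets h. snd (p I))"
  have K: "snd (p I) \<le> K" if "I \<in> face_sets h" for I
    unfolding K_def using that finite_face_sets by (intro member_le_sum) auto
  define b where "b I = (if I \<in> face_sets h then (\<Otimes>j\<in>I. y j) [^] (K - snd (p I)) \<odot>\<^bsub>M\<^esub> fst (p I) else \<zero>\<^bsub>M\<^esub>)" for I
  have b: "b I \<in> carrier M" for I using p g by (auto simp: b_def)
  have eb: "e I = fraction I (b I) K" if I: "I \<in> face_sets h" for I
    using frac_expand[OF g[OF I], of "fst (p I)" "snd (p I)" "K - snd (p I)"] p I K[OF I] by (simp add: b_def)
  have de: "cech_differential R M n y h e = (\<lambda>J\<in>face_sets (Suc h). fraction J (kdiff K b J) K)"
    by (rule cech_differential_frac[OF b eb])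
  have kc: "kdiff K b J \<in> carrier M" if "J \<in> face_sets (Suc h)" for J
    by (rule kdiff_closed[OF face_sets_subset[OF that] b])
  have "\<exists>t::nat. (\<Otimes>j\<in>J. y j) [^] (t + K) \<odot>\<^bsub>M\<^esub> a J = (\<Otimes>j\<in>J. y j) [^] (t + k) \<odot>\<^bsub>M\<^esub> kdiff K b J"
    if J: "J \<in> face_sets (Suc h)" for J
  proof -
    have "c J = fraction J (kdiff K b J) K"
      unfolding c_e de using J by simp
    then have "fraction J (a J) k = fraction J (kdiff K b J) K" using J by (simp add: c_def)
    then show ?thesis using frac_eq_iff[OF g[OF J] a kc[OF J]] by simp
  qed
  then have "\<forall>J\<in>face_sets (Suc h). \<exists>t::nat. (\<Otimes>j\<in>J. y j) [^] (t + K) \<odot>\<^bsub>M\<^esub> a J = (\<Otimes>j\<in>J. y j) [^] (t + k) \<odot>\<^bsub>M\<^esub> kdiff K b J"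
    by blast
  then obtain t :: "nat set \<Rightarrow> nat" where
    t: "\<forall>J\<in>face_sets (Suc h). (\<Otimes>j\<in>J. y j) [^] (t J + K) \<odot>\<^bsub>M\<^esub> a J = (\<Otimes>j\<in>J. y j) [^] (t J + k) \<odot>\<^bsub>M\<^esub> kdiff K b J"
    by (rule bchoice[THEN exE])
  \<comment> \<open>Fractions agree after multiplication by a power depending on J; T serves for all
    J. The exponents balance because k + (T + K) = K + (T + k).\<close>
  define T where "T = (\<Sum>J\<in>face_sets (Suc h). t J)"
  have T: "t J \<le> T" if "J \<in> face_sets (Suc h)" for J
    unfolding T_def using that finite_face_sets by (intro member_le_sum) auto
  let ?b = "\<lambda>J. if J \<subseteq> {1..n} then y_power J (T + k) \<odot>\<^bsub>M\<^esub> b J else \<zero>\<^bsub>M\<^esub>"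
  have "y_power J (T + K) \<odot>\<^bsub>M\<^esub> a J = kdiff (k + (T + K)) ?b J" if J: "J \<in> face_sets (Suc h)" for J
  proof -
    let ?g = "\<Otimes>j\<in>J. y j"
    have "?g [^] (T + K) \<odot>\<^bsub>M\<^esub> a J = ?g [^] (T - t J) \<odot>\<^bsub>M\<^esub> (?g [^] (t J + K) \<odot>\<^bsub>M\<^esub> a J)"
      using g[OF J] a T[OF J] by (simp add: smult_pow_add)
    also have "\<dots> = ?g [^] (T + k) \<odot>\<^bsub>M\<^esub> kdiff K b J"
      using g[OF J] kc[OF J] T[OF J] t[rule_format, OF J] by (simp add: smult_pow_add)
    also have "\<dots> = kdiff (K + (T + k)) ?b J"
      using kdiff_y_power[OF face_sets_subset[OF J] b, of "T + k" K] by (simp add: y_power_def)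
    finally show ?thesis by (simp add: y_power_def add_ac)
  qed
  moreover have "?b J \<in> carrier M" for J using b y_power_closed[of J] by simp
  ultimately show "\<exists>t b. (\<forall>I. b I \<in> carrier M) \<and> (\<forall>I\<in>face_sets (Suc h). y_power I t \<odot>\<^bsub>M\<^esub> a I = kdiff (k + t) b I)"
    by (intro exI[of _ "T + K"] exI[of _ ?b]) blast
qed

end

section \<open>Quotient modules and regular sequences\<close>

context module
begin

lemma abelian_subgroup_submodule: "submodule U R M \<Longrightarrow> abelian_subgroup U M"
  by (intro abelian_subgroupI3 additive_subgroup.intro M.abelian_group_axioms) (rule submodule.axioms(1))

lemma coset_eq_iff:
  assumes U: "submodule U R M" and x: "x \<in> carrier M" and z: "z \<in> carrier M"
  shows "U +>\<^bsub>M\<^esub> x = U +>\<^bsub>M\<^esub> z \<longleftrightarrow> x \<ominus>\<^bsub>M\<^esub> z \<in> U"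
proof -
  interpret abelian_subgroup U M by (rule abelian_subgroup_submodule[OF U])
  have c: "u \<in> carrier M" if "u \<in> U" for u using submoduleE(1)[OF U] that by auto
  have mem: "x \<in> U +>\<^bsub>M\<^esub> z \<longleftrightarrow> x \<ominus>\<^bsub>M\<^esub> z \<in> U"
  proof
    assume "x \<in> U +>\<^bsub>M\<^esub> z"
    then obtain u where u: "u \<in> U" "x = u \<oplus>\<^bsub>M\<^esub> z" by (auto simp: a_r_coset_def')
    then have "x \<ominus>\<^bsub>M\<^esub> z = u" using z c by (simp add: a_minus_def M.a_assoc M.r_neg)
    then show "x \<ominus>\<^bsub>M\<^esub> z \<in> U" using u(1) by simp
  next
    assume "x \<ominus>\<^bsub>M\<^esub> z \<in> U"
    moreover have "x = (x \<ominus>\<^bsub>M\<^esub> z) \<oplus>\<^bsub>M\<^esub> z" using x z by (simp add: a_minus_def M.a_assoc M.l_neg)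
    ultimately show "x \<in> U +>\<^bsub>M\<^esub> z" unfolding a_r_coset_def' by blast
  qed
  show ?thesis
  proof
    assume "U +>\<^bsub>M\<^esub> x = U +>\<^bsub>M\<^esub> z"
    then have "x \<in> U +>\<^bsub>M\<^esub> z" using a_rcos_self[OF x] by simp
    then show "x \<ominus>\<^bsub>M\<^esub> z \<in> U" by (simp only: mem)
  next
    assume "x \<ominus>\<^bsub>M\<^esub> z \<in> U"
    then have "x \<in> U +>\<^bsub>M\<^esub> z" by (simp only: mem)
    then show "U +>\<^bsub>M\<^esub> x = U +>\<^bsub>M\<^esub> z" using a_repr_independence'[OF _ z] by simp
  qed
qed

lemma quotient_carrier: "carrier (quotient_module M U) = {U +>\<^bsub>M\<^esub> x | x. x \<in> carrier M}"
  by (auto simp: quotient_module_def A_RCOSETS_def')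

lemma quotient_zero:
  assumes U: "submodule U R M"
  shows "\<zero>\<^bsub>quotient_module M U\<^esub> = U +>\<^bsub>M\<^esub> \<zero>\<^bsub>M\<^esub>"
  using M.a_coset_add_zero[OF submoduleE(1)[OF U]] by (simp add: quotient_module_def)

lemma quotient_add:
  assumes U: "submodule U R M" and x: "x \<in> carrier M" and z: "z \<in> carrier M"
  shows "(U +>\<^bsub>M\<^esub> x) \<oplus>\<^bsub>quotient_module M U\<^esub> (U +>\<^bsub>M\<^esub> z) = U +>\<^bsub>M\<^esub> (x \<oplus>\<^bsub>M\<^esub> z)"
  using abelian_subgroup.a_rcos_sum[OF abelian_subgroup_submodule[OF U] x z] by (simp add: quotient_module_def)

lemma quotient_smult:
  assumes U: "submodule U R M" and x: "x \<in> carrier M" and r: "r \<in> carrier R"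
  shows "r \<odot>\<^bsub>quotient_module M U\<^esub> (U +>\<^bsub>M\<^esub> x) = U +>\<^bsub>M\<^esub> (r \<odot>\<^bsub>M\<^esub> x)"
proof -
  have c: "u \<in> carrier M" if "u \<in> U" for u using submoduleE(1)[OF U] that by auto
  have const: "U +>\<^bsub>M\<^esub> (r \<odot>\<^bsub>M\<^esub> z) = U +>\<^bsub>M\<^esub> (r \<odot>\<^bsub>M\<^esub> x)" if "z \<in> U +>\<^bsub>M\<^esub> x" for z
  proof -
    from that obtain u where u: "u \<in> U" "z = u \<oplus>\<^bsub>M\<^esub> x" by (auto simp: a_r_coset_def')
    have "r \<odot>\<^bsub>M\<^esub> z \<ominus>\<^bsub>M\<^esub> r \<odot>\<^bsub>M\<^esub> x = r \<odot>\<^bsub>M\<^esub> u"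
      using u c x r by (simp add: smult_r_distr a_minus_def M.a_assoc M.r_neg)
    then show ?thesis
      using u c x r submoduleE(4)[OF U r u(1)] by (subst coset_eq_iff[OF U]) auto
  qed
  have "x \<in> U +>\<^bsub>M\<^esub> x"
    by (rule abelian_subgroup.a_rcos_self[OF abelian_subgroup_submodule[OF U] x])
  then have ne: "U +>\<^bsub>M\<^esub> x \<noteq> {}" by blast
  have "(\<Union>z\<in>U +>\<^bsub>M\<^esub> x. U +>\<^bsub>M\<^esub> (r \<odot>\<^bsub>M\<^esub> z)) = (\<Union>z\<in>U +>\<^bsub>M\<^esub> x. U +>\<^bsub>M\<^esub> (r \<odot>\<^bsub>M\<^esub> x))"
    by (rule SUP_cong[OF refl const])
  also have "\<dots> = U +>\<^bsub>M\<^esub> (r \<odot>\<^bsub>M\<^esub> x)" using ne by simp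
  finally show ?thesis by (simp add: quotient_module_def)
qed

lemma quotient_module_is_module:
  assumes U: "submodule U R M"
  shows "module R (quotient_module M U)"
proof (rule moduleI)
  let ?N = "quotient_module M U"
  note simps = quotient_zero[OF U] quotient_add[OF U] quotient_smult[OF U]
  show "cring R" by (rule R.is_cring)
  show "abelian_group ?N"
  proof (rule abelian_groupI)
    fix X assume "X \<in> carrier ?N"
    then obtain x where X: "X = U +>\<^bsub>M\<^esub> x" "x \<in> carrier M" by (auto simp: quotient_carrier)
    show "\<zero>\<^bsub>?N\<^esub> \<oplus>\<^bsub>?N\<^esub> X = X" using X by (simp add: simps)
    show "\<exists>Y\<in>carrier ?N. Y \<oplus>\<^bsub>?N\<^esub> X = \<zero>\<^bsub>?N\<^esub>"
      using X by (intro bexI[of _ "U +>\<^bsub>M\<^esub> (\<ominus>\<^bsub>M\<^esub> x)"]) (auto simp: simps M.l_neg quotient_carrier)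
    fix Y assume "Y \<in> carrier ?N"
    then obtain z where Y: "Y = U +>\<^bsub>M\<^esub> z" "z \<in> carrier M" by (auto simp: quotient_carrier)
    show "X \<oplus>\<^bsub>?N\<^esub> Y \<in> carrier ?N" using X Y by (auto simp: simps quotient_carrier)
    show "X \<oplus>\<^bsub>?N\<^esub> Y = Y \<oplus>\<^bsub>?N\<^esub> X" using X Y by (simp add: simps M.a_comm)
    fix Z assume "Z \<in> carrier ?N"
    then obtain w where Z: "Z = U +>\<^bsub>M\<^esub> w" "w \<in> carrier M" by (auto simp: quotient_carrier)
    show "X \<oplus>\<^bsub>?N\<^esub> Y \<oplus>\<^bsub>?N\<^esub> Z = X \<oplus>\<^bsub>?N\<^esub> (Y \<oplus>\<^bsub>?N\<^esub> Z)" using X Y Z by (simp add: simps M.a_assoc)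
  qed (auto simp: simps quotient_carrier)
  fix X assume "X \<in> carrier ?N"
  then obtain x where X: "X = U +>\<^bsub>M\<^esub> x" "x \<in> carrier M" by (auto simp: quotient_carrier)
  show "\<one> \<odot>\<^bsub>?N\<^esub> X = X" using X by (simp add: simps)
  fix a assume a: "a \<in> carrier R"
  show "a \<odot>\<^bsub>?N\<^esub> X \<in> carrier ?N" using X a by (auto simp: simps quotient_carrier)
  {
    fix Y assume "Y \<in> carrier ?N"
    then obtain z where Y: "Y = U +>\<^bsub>M\<^esub> z" "z \<in> carrier M" by (auto simp: quotient_carrier)
    show "a \<odot>\<^bsub>?N\<^esub> (X \<oplus>\<^bsub>?N\<^esub> Y) = a \<odot>\<^bsub>?N\<^esub> X \<oplus>\<^bsub>?N\<^esub> a \<odot>\<^bsub>?N\<^esub> Y"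
      using X Y a by (simp add: simps smult_r_distr)
  }
  fix b assume b: "b \<in> carrier R"
  show "(a \<oplus> b) \<odot>\<^bsub>?N\<^esub> X = a \<odot>\<^bsub>?N\<^esub> X \<oplus>\<^bsub>?N\<^esub> b \<odot>\<^bsub>?N\<^esub> X" using X a b by (simp add: simps smult_l_distr)
  show "a \<otimes> b \<odot>\<^bsub>?N\<^esub> X = a \<odot>\<^bsub>?N\<^esub> (b \<odot>\<^bsub>?N\<^esub> X)" using X a b by (simp add: simps smult_assoc1)
qed

lemma coset_eq_zero_iff:
  assumes U: "submodule U R M" and x: "x \<in> carrier M"
  shows "U +>\<^bsub>M\<^esub> x = \<zero>\<^bsub>quotient_module M U\<^esub> \<longleftrightarrow> x \<in> U"
  using coset_eq_iff[OF U x M.zero_closed] x by (simp add: quotient_zero[OF U])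

lemma nonzerodivisor_quotient_iff:
  assumes U: "submodule U R M" and f: "f \<in> carrier R"
  shows "nonzerodivisor_on (quotient_module M U) f \<longleftrightarrow> (\<forall>x\<in>carrier M. f \<odot>\<^bsub>M\<^esub> x \<in> U \<longrightarrow> x \<in> U)"
proof -
  have "(\<forall>X\<in>carrier (quotient_module M U). P X) \<longleftrightarrow> (\<forall>x\<in>carrier M. P (U +>\<^bsub>M\<^esub> x))" for P
    by (auto simp: quotient_carrier)
  then show ?thesis
    unfolding nonzerodivisor_on_def using f
    by (simp add: quotient_smult[OF U] coset_eq_zero_iff[OF U])
qed

lemma nonzero_quotient_iff:
  assumes U: "submodule U R M"
  shows "nonzero_module (quotient_module M U) \<longleftrightarrow> U \<noteq> carrier M"
proof -
  have "carrier (quotient_module M U) = {\<zero>\<^bsub>quotient_module M U\<^esub>} \<longleftrightarrow> (\<forall>x\<in>carrier M. U +>\<^bsub>M\<^esub> x = \<zero>\<^bsub>quotient_module M U\<^esub>)"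
    unfolding quotient_carrier using M.zero_closed quotient_zero[OF U] by auto
  also have "\<dots> \<longleftrightarrow> carrier M \<subseteq> U" using coset_eq_zero_iff[OF U] by auto
  finally show ?thesis using submoduleE(1)[OF U] unfolding nonzero_module_def by blast
qed

lemma submodule_zero_set: "submodule {\<zero>\<^bsub>M\<^esub>} R M"
  by (intro submoduleI) auto

lemma submodule_foldl:
  "submodule U R M \<Longrightarrow> set fs \<subseteq> carrier R \<Longrightarrow> submodule (foldl (add_multiples M) U fs) R M"
  by (induction fs arbitrary: U) (auto intro: submodule_add_multiples)

text \<open>Links the linear combinations of the definition with iterated
  \<open>add_multiples\<close>. The induction runs from the right end because \<open>foldl\<close>
  adds the last element last.\<close>

lemma sequence_submodule_foldl:
  "set fs \<subseteq> carrier R \<Longrightarrow> sequence_submodule R M fs = foldl (add_multiples M) {\<zero>\<^bsub>M\<^esub>} fs"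
proof (induction fs rule: rev_induct)
  case Nil
  show ?case by (auto simp: sequence_submodule_def)
next
  case (snoc f fs)
  let ?l = "length fs"
  let ?s = "\<lambda>x. \<Oplus>\<^bsub>M\<^esub>i\<in>{..<?l}. fs ! i \<odot>\<^bsub>M\<^esub> x i"
  have step: "(\<Oplus>\<^bsub>M\<^esub>i\<in>{..<length (fs @ [f])}. (fs @ [f]) ! i \<odot>\<^bsub>M\<^esub> x i) = ?s x \<oplus>\<^bsub>M\<^esub> f \<odot>\<^bsub>M\<^esub> x ?l"
    if x: "x \<in> {..<Suc ?l} \<rightarrow> carrier M" for x
  proof -
    have c: "(fs @ [f]) ! i \<odot>\<^bsub>M\<^esub> x i \<in> carrier M" if "i < Suc ?l" for i
    proof -
      have "(fs @ [f]) ! i \<in> set (fs @ [f])" using that by (intro nth_mem) simp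
      then show ?thesis using snoc.prems x that by auto
    qed
    have c': "fs ! i \<odot>\<^bsub>M\<^esub> x i \<in> carrier M" if "i < ?l" for i
      using c[of i] that by (simp add: nth_append)
    have "(\<Oplus>\<^bsub>M\<^esub>i\<in>{..<length (fs @ [f])}. (fs @ [f]) ! i \<odot>\<^bsub>M\<^esub> x i)
      = (\<Oplus>\<^bsub>M\<^esub>i\<in>insert ?l {..<?l}. (fs @ [f]) ! i \<odot>\<^bsub>M\<^esub> x i)"
      by (simp add: lessThan_Suc)
    also have "\<dots> = (fs @ [f]) ! ?l \<odot>\<^bsub>M\<^esub> x ?l \<oplus>\<^bsub>M\<^esub> (\<Oplus>\<^bsub>M\<^esub>i\<in>{..<?l}. (fs @ [f]) ! i \<odot>\<^bsub>M\<^esub> x i)"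
      using c c[of ?l] by (intro M.finsum_insert) auto
    also have "(\<Oplus>\<^bsub>M\<^esub>i\<in>{..<?l}. (fs @ [f]) ! i \<odot>\<^bsub>M\<^esub> x i) = ?s x"
      using c' by (intro M.finsum_cong') (auto simp: nth_append)
    finally have "(\<Oplus>\<^bsub>M\<^esub>i\<in>{..<length (fs @ [f])}. (fs @ [f]) ! i \<odot>\<^bsub>M\<^esub> x i) = f \<odot>\<^bsub>M\<^esub> x ?l \<oplus>\<^bsub>M\<^esub> ?s x" by simp
    moreover have "f \<odot>\<^bsub>M\<^esub> x ?l \<in> carrier M" using c[of ?l] by simp
    moreover have "?s x \<in> carrier M" using c' by (intro M.finsum_closed) auto
    ultimately show ?thesis by (simp add: M.a_comm)
  qed
  have "sequence_submodule R M (fs @ [f]) = add_multiples M (sequence_submodule R M fs) f"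
  proof (intro equalityI subsetI)
    fix z assume "z \<in> sequence_submodule R M (fs @ [f])"
    then obtain x where x: "x \<in> {..<Suc ?l} \<rightarrow> carrier M"
      "z = (\<Oplus>\<^bsub>M\<^esub>i\<in>{..<length (fs @ [f])}. (fs @ [f]) ! i \<odot>\<^bsub>M\<^esub> x i)"
      unfolding sequence_submodule_def by auto
    then have "z = ?s x \<oplus>\<^bsub>M\<^esub> f \<odot>\<^bsub>M\<^esub> x ?l" using step by simp
    moreover have "x \<in> {..<?l} \<rightarrow> carrier M" "x ?l \<in> carrier M" using x(1) by auto
    moreover from this have "?s x \<in> sequence_submodule R M fs" unfolding sequence_submodule_def by blast
    ultimately show "z \<in> add_multiples M (sequence_submodule R M fs) f"
      unfolding add_multiples_def by blast
  next
    fix z assume "z \<in> add_multiples M (sequence_submodule R M fs) f"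
    then obtain x w where x: "x \<in> {..<?l} \<rightarrow> carrier M" and w: "w \<in> carrier M" "z = ?s x \<oplus>\<^bsub>M\<^esub> f \<odot>\<^bsub>M\<^esub> w"
      unfolding add_multiples_def sequence_submodule_def by blast
    let ?x = "x(?l := w)"
    have x': "?x \<in> {..<Suc ?l} \<rightarrow> carrier M"
      using x w(1) by (auto simp: Pi_iff less_Suc_eq)
    have "?s ?x = ?s x"
    proof (intro M.finsum_cong')
      show "(\<lambda>i. fs ! i \<odot>\<^bsub>M\<^esub> x i) \<in> {..<?l} \<rightarrow> carrier M"
        using x snoc.prems nth_mem[of _ fs] by (auto simp: Pi_iff intro!: smult_closed)
    qed auto
    then have "z = (\<Oplus>\<^bsub>M\<^esub>i\<in>{..<length (fs @ [f])}. (fs @ [f]) ! i \<odot>\<^bsub>M\<^esub> ?x i)"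
      using step[OF x'] w by simp
    then show "z \<in> sequence_submodule R M (fs @ [f])"
      using x' unfolding sequence_submodule_def by (intro CollectI exI[of _ ?x]) simp
  qed
  then show ?case using snoc by simp
qed

lemma rel_regular_iff_nth:
  "rel_regular M U fs \<longleftrightarrow> (\<forall>i<length fs. \<forall>x\<in>carrier M.
     fs ! i \<odot>\<^bsub>M\<^esub> x \<in> foldl (add_multiples M) U (take i fs) \<longrightarrow> x \<in> foldl (add_multiples M) U (take i fs))"
proof (induction fs arbitrary: U)
  case (Cons f fs)
  show ?case
    unfolding rel_regular.simps Cons.IH by (simp add: All_less_Suc2)
qed simp

text \<open>Separates the nonzerodivisor conditions, which Koszul exactness detects, from the
  properness of the last submodule, which will come from the grading.\<close>

lemma regular_sequence_iff:
  assumes "set fs \<subseteq> carrier R"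
  shows "regular_sequence R M fs \<longleftrightarrow> rel_regular M {\<zero>\<^bsub>M\<^esub>} fs \<and> foldl (add_multiples M) {\<zero>\<^bsub>M\<^esub>} fs \<noteq> carrier M"
proof -
  have sub: "set (take i fs) \<subseteq> carrier R" for i using assms set_take_subset[of i fs] by blast
  have "nonzerodivisor_on (quotient_module M (sequence_submodule R M (take i fs))) (fs ! i) \<longleftrightarrow>
    (\<forall>x\<in>carrier M. fs ! i \<odot>\<^bsub>M\<^esub> x \<in> foldl (add_multiples M) {\<zero>\<^bsub>M\<^esub>} (take i fs)
      \<longrightarrow> x \<in> foldl (add_multiples M) {\<zero>\<^bsub>M\<^esub>} (take i fs))" if "i < length fs" for i
    unfolding sequence_submodule_foldl[OF sub]
    using assms that by (intro nonzerodivisor_quotient_iff submodule_foldl submodule_zero_set sub) auto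
  moreover have "nonzero_module (quotient_module M (sequence_submodule R M fs)) \<longleftrightarrow>
      foldl (add_multiples M) {\<zero>\<^bsub>M\<^esub>} fs \<noteq> carrier M"
    unfolding sequence_submodule_foldl[OF assms]
    by (intro nonzero_quotient_iff submodule_foldl submodule_zero_set assms)
  ultimately show ?thesis
    using assms unfolding regular_sequence_def rel_regular_iff_nth by auto
qed

lemma foldl_add_multiples_subset:
  assumes W: "submodule W R M"
  shows "U \<subseteq> W \<Longrightarrow> (\<And>f x. f \<in> set fs \<Longrightarrow> x \<in> carrier M \<Longrightarrow> f \<odot>\<^bsub>M\<^esub> x \<in> W) \<Longrightarrow>
    foldl (add_multiples M) U fs \<subseteq> W"
proof (induction fs arbitrary: U)
  case (Cons f fs)
  have "add_multiples M U f \<subseteq> W"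
    using Cons.prems submoduleE(5)[OF W] unfolding add_multiples_def by auto
  then show ?case using Cons.IH[of "add_multiples M U f"] Cons.prems(2) by simp
qed simp

end

section \<open>Grade and Koszul exactness\<close>

context koszul
begin

text \<open>This is all that the grade argument uses of the bigrading. It stands in for Nakayama's
  lemma and for Krull's intersection theorem.\<close>

definition y_filtration :: "(nat \<Rightarrow> 'c set) \<Rightarrow> bool" where
  "y_filtration F \<longleftrightarrow> (\<forall>d. submodule (F d) R M) \<and> F 0 = carrier M \<and>
     (\<forall>j\<in>{1..n}. \<forall>d. \<forall>x\<in>F d. y j \<odot>\<^bsub>M\<^esub> x \<in> F (Suc d)) \<and> (\<Inter>d. F d) = {\<zero>\<^bsub>M\<^esub>}"

lemma y_filtration_Q:
  assumes F: "y_filtration F" and f: "f \<in> Idl (y ` {1..n})" and x: "x \<in> F d"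
  shows "f \<odot>\<^bsub>M\<^esub> x \<in> F (Suc d)"
proof -
  have sub: "submodule (F d) R M" for d using F by (simp add: y_filtration_def)
  have "ideal (annihilator R M (F (Suc d)) x) R"
    using submoduleE(1)[OF sub] x by (intro ideal_annihilator sub) auto
  moreover have "y ` {1..n} \<subseteq> annihilator R M (F (Suc d)) x"
    using F x y_closed unfolding y_filtration_def annihilator_def by blast
  ultimately have "Idl (y ` {1..n}) \<subseteq> annihilator R M (F (Suc d)) x"
    by (rule R.genideal_minimal)
  then show ?thesis using f by (auto simp: annihilator_def)
qed

lemma y_filtration_power:
  assumes F: "y_filtration F" and l: "l \<in> {1..n}" and x: "x \<in> carrier M"
  shows "y l [^] (q::nat) \<odot>\<^bsub>M\<^esub> x \<in> F q"
proof (induction q)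
  case 0
  then show ?case using F x by (simp add: y_filtration_def)
next
  case (Suc q)
  have yl: "y l \<in> carrier R" by (rule y_closed[OF l])
  have "y l \<odot>\<^bsub>M\<^esub> (y l [^] q \<odot>\<^bsub>M\<^esub> x) \<in> F (Suc q)"
    using F l Suc unfolding y_filtration_def by blast
  then show ?case using yl x by (simp add: m_comm flip: smult_assoc1)
qed

text \<open>If M were the sum of the f M with f in fs, then M inside F d would imply M inside F (d +
  1), so M would lie in the intersection of the filtration.\<close>

lemma foldl_Q_proper:
  assumes F: "y_filtration F" and nz: "nonzero_module M" and fs: "set fs \<subseteq> Idl (y ` {1..n})"
  shows "foldl (add_multiples M) {\<zero>\<^bsub>M\<^esub>} fs \<noteq> carrier M"
proof
  assume eq: "foldl (add_multiples M) {\<zero>\<^bsub>M\<^esub>} fs = carrier M"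
  have sub: "submodule (F d) R M" for d using F by (simp add: y_filtration_def)
  have "carrier M \<subseteq> F d" for d
  proof (induction d)
    case 0
    then show ?case using F by (simp add: y_filtration_def)
  next
    case (Suc d)
    have "f \<odot>\<^bsub>M\<^esub> x \<in> F (Suc d)" if "f \<in> set fs" "x \<in> carrier M" for f x
      using y_filtration_Q[OF F, of f x d] fs Suc that by blast
    then have "foldl (add_multiples M) {\<zero>\<^bsub>M\<^esub>} fs \<subseteq> F (Suc d)"
      using submodule_zero[OF sub] by (intro foldl_add_multiples_subset[OF sub]) auto
    then show ?case by (simp add: eq)
  qed
  then have "carrier M \<subseteq> {\<zero>\<^bsub>M\<^esub>}" using F unfolding y_filtration_def by blast
  then show False using nz M.zero_closed unfolding nonzero_module_def by blast
qed

text \<open>The reverse direction combines \<open>regular_if_koszul_exact\<close> with prime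
  avoidance for the nonzerodivisors, and with the filtration for the nonzero last quotient.\<close>

lemma regular_sequence_exists_iff:
  assumes F: "y_filtration F" and nz: "nonzero_module M"
    and acc: "acc_ideals R" "acc_submodules R M (carrier M)"
  shows "(\<exists>fs. length fs = g \<and> set fs \<subseteq> Idl (y ` {1..n}) \<and> regular_sequence R M fs) \<longleftrightarrow>
    (\<forall>i<g. koszul_exact 1 {\<zero>\<^bsub>M\<^esub>} i)" (is "?L \<longleftrightarrow> ?R")
proof
  assume ?L
  then obtain fs where fs: "length fs = g" "set fs \<subseteq> Idl (y ` {1..n})" "regular_sequence R M fs" by blast
  have "set fs \<subseteq> carrier R" using fs(2) Q_closed by blast
  then have "rel_regular M {\<zero>\<^bsub>M\<^esub>} fs" using fs(3) regular_sequence_iff by simp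
  then show ?R using koszul_exact_if_regular[OF submodule_zero_set _ fs(2)] fs(1) by simp
next
  assume R: ?R
  have nzd: "\<exists>f\<in>Idl (y ` {1..n}). \<forall>x\<in>carrier M. f \<odot>\<^bsub>M\<^esub> x \<in> U \<longrightarrow> x \<in> U"
    if U: "submodule U R M" and depth: "\<And>x. x \<in> carrier M \<Longrightarrow> (\<And>j. j \<in> {1..n} \<Longrightarrow> y j \<odot>\<^bsub>M\<^esub> x \<in> U) \<Longrightarrow> x \<in> U" for U
  proof (rule nonzerodivisor_exists[OF acc U ideal_Q])
    fix x assume x: "x \<in> carrier M" and kill: "\<And>f. f \<in> Idl (y ` {1..n}) \<Longrightarrow> f \<odot>\<^bsub>M\<^esub> x \<in> U"
    show "x \<in> U"
    proof (rule depth[OF x])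
      fix j assume "j \<in> {1..n}"
      then have "y j \<in> Idl (y ` {1..n})" using R.genideal_self[of "y ` {1..n}"] y_closed by blast
      then show "y j \<odot>\<^bsub>M\<^esub> x \<in> U" by (rule kill)
    qed
  qed
  have "\<exists>fs. length fs = g \<and> set fs \<subseteq> Idl (y ` {1..n}) \<and> rel_regular M {\<zero>\<^bsub>M\<^esub>} fs"
  proof (rule regular_if_koszul_exact)
    show "submodule {\<zero>\<^bsub>M\<^esub>} R M" by (rule submodule_zero_set)
    show "koszul_exact 1 {\<zero>\<^bsub>M\<^esub>} i" if "i < g" for i using R that by (elim allE impE)
    show "\<exists>f\<in>Idl (y ` {1..n}). \<forall>x\<in>carrier M. f \<odot>\<^bsub>M\<^esub> x \<in> U \<longrightarrow> x \<in> U"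
      if "submodule U R M" "\<And>x. x \<in> carrier M \<Longrightarrow> (\<And>j. j \<in> {1..n} \<Longrightarrow> y j \<odot>\<^bsub>M\<^esub> x \<in> U) \<Longrightarrow> x \<in> U" for U
      by (rule nzd[OF that])
  qed
  then obtain fs where fs: "length fs = g" "set fs \<subseteq> Idl (y ` {1..n})" "rel_regular M {\<zero>\<^bsub>M\<^esub>} fs" by blast
  have "set fs \<subseteq> carrier R" using fs(2) Q_closed by blast
  then have "regular_sequence R M fs" using fs(3) regular_sequence_iff foldl_Q_proper[OF F nz fs(2)] by simp
  then show ?L using fs by blast
qed

text \<open>The detour over a regular sequence changes the exponent: exactness at exponent 1
  produces the sequence, and the sequence gives exactness at every exponent, as the direct limit
  requires.\<close>

lemma koszul_exact_powers:
  assumes F: "y_filtration F" and nz: "nonzero_module M"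
    and acc: "acc_ideals R" "acc_submodules R M (carrier M)"
    and ex: "\<And>i. i < g \<Longrightarrow> koszul_exact 1 {\<zero>\<^bsub>M\<^esub>} i" and i: "i < g"
  shows "koszul_exact k {\<zero>\<^bsub>M\<^esub>} i"
proof -
  have "\<exists>fs. length fs = g \<and> set fs \<subseteq> Idl (y ` {1..n}) \<and> regular_sequence R M fs"
    using regular_sequence_exists_iff[OF F nz acc] ex by blast
  then obtain fs where fs: "length fs = g" "set fs \<subseteq> Idl (y ` {1..n})" "regular_sequence R M fs" by blast
  have "set fs \<subseteq> carrier R" using fs(2) Q_closed by blast
  then have "rel_regular M {\<zero>\<^bsub>M\<^esub>} fs" using fs(3) regular_sequence_iff by simp
  then show ?thesis using koszul_exact_if_regular[OF submodule_zero_set _ fs(2)] fs(1) i by simp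
qed

text \<open>If all degrees from 0 to n were exact, \<open>exactness_gap\<close> with W = M and the
  gap at n + 1 would put every x into every F q. So the grade is a \<open>GREATEST\<close> over a
  bounded set.\<close>

lemma exact_range_bounded:
  assumes F: "y_filtration F" and nz: "nonzero_module M"
    and acc: "acc_ideals R" "acc_submodules R M (carrier M)"
    and ex: "\<And>i. i < g \<Longrightarrow> koszul_exact 1 {\<zero>\<^bsub>M\<^esub>} i"
  shows "g \<le> n"
proof (rule ccontr)
  assume "\<not> g \<le> n"
  then have cex: "colim_exact (carrier M) i" if "i \<le> n" for i
    using koszul_exact_powers[OF F nz acc ex] that by (intro colim_exact_if_koszul_exact) simp
  have "x \<in> F q" if x: "x \<in> carrier M" for x q
    by (rule exactness_gap[OF carrier_is_submodule x, where g = "Suc n" and q = q])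
      (use F cex y_filtration_power[OF F] in \<open>auto simp: y_filtration_def\<close>)
  then have "carrier M \<subseteq> {\<zero>\<^bsub>M\<^esub>}" using F unfolding y_filtration_def by blast
  then show False using nz M.zero_closed unfolding nonzero_module_def by blast
qed

text \<open>The admissible lengths form a bounded, downward closed set containing 0. Describing the
  grade by its lower bounds turns the minimum over summands into an exchange of quantifiers.\<close>

lemma le_grade_iff:
  assumes F: "y_filtration F" and nz: "nonzero_module M"
    and acc: "acc_ideals R" "acc_submodules R M (carrier M)"
  shows "g \<le> grade R (Idl (y ` {1..n})) M \<longleftrightarrow> (\<forall>i<g. koszul_exact 1 {\<zero>\<^bsub>M\<^esub>} i)"
proof -
  let ?P = "\<lambda>g. \<forall>i<g. koszul_exact 1 {\<zero>\<^bsub>M\<^esub>} i"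
  have eq: "grade R (Idl (y ` {1..n})) M = (GREATEST g. ?P g)"
    unfolding grade_def regular_sequence_exists_iff[OF F nz acc] ..
  have bound: "\<forall>g. ?P g \<longrightarrow> g \<le> n" using exact_range_bounded[OF F nz acc] by blast
  have "?P (GREATEST g. ?P g)"
    by (rule GreatestI_nat[where P = ?P and k = 0 and b = n]) (use bound in auto)
  then have "?P g" if "g \<le> (GREATEST g. ?P g)" using that by auto
  moreover have "g \<le> (GREATEST g. ?P g)" if "?P g"
    by (rule Greatest_le_nat[where P = ?P and b = n]) (use bound that in auto)
  ultimately show ?thesis unfolding eq by blast
qed

end

section \<open>Grade and cohomological dimension\<close>

lemma (in cring) regular_module_is_module: "module R (regular_module R)"
proof (rule moduleI)
  show "abelian_group (regular_module R)"
    by (rule abelian_groupI) (auto simp: regular_module_def a_ac intro: bexI[of _ "\<ominus> _"] l_neg)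
qed (auto simp: regular_module_def l_distr r_distr m_assoc is_cring)

lemma (in cring) submodule_regular_module:
  assumes "ideal I R"
  shows "submodule I R (regular_module R)"
proof -
  interpret L: module R "regular_module R" by (rule regular_module_is_module)
  interpret ideal I R by (rule assms)
  have inv: "\<ominus>\<^bsub>regular_module R\<^esub> a = \<ominus> a" if "a \<in> I" for a
    using that Icarr[OF that] by (intro L.M.minus_equality) (auto simp: regular_module_def l_neg)
  show ?thesis
  proof (rule L.submoduleI)
    fix a assume a: "a \<in> I"
    show "\<ominus>\<^bsub>regular_module R\<^esub> a \<in> I" unfolding inv[OF a] using a by (rule a_inv_closed)
  qed (use Icarr I_l_closed in \<open>auto simp: regular_module_def\<close>)
qed

context koszul
begin

text \<open>Cocycles in the image lift along the injective map, and primitives are pushed forward.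
  The result concerns the image because \<open>exactness_gap\<close> works with a submodule of the
  module containing x.\<close>

lemma colim_exact_transport:
  fixes N :: "('a, 'e, 'f) module_scheme" and \<phi>
  assumes N: "koszul R N y n"
    and closed: "\<And>X. X \<in> carrier N \<Longrightarrow> \<phi> X \<in> carrier M"
    and add: "\<And>X Y. X \<in> carrier N \<Longrightarrow> Y \<in> carrier N \<Longrightarrow> \<phi> (X \<oplus>\<^bsub>N\<^esub> Y) = \<phi> X \<oplus>\<^bsub>M\<^esub> \<phi> Y"
    and smult: "\<And>r X. r \<in> carrier R \<Longrightarrow> X \<in> carrier N \<Longrightarrow> \<phi> (r \<odot>\<^bsub>N\<^esub> X) = r \<odot>\<^bsub>M\<^esub> \<phi> X"
    and inj: "\<And>X. X \<in> carrier N \<Longrightarrow> \<phi> X = \<zero>\<^bsub>M\<^esub> \<Longrightarrow> X = \<zero>\<^bsub>N\<^esub>"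
  shows "submodule (\<phi> ` carrier N) R M"
    and "koszul.colim_exact R N y n (carrier N) i \<Longrightarrow> colim_exact (\<phi> ` carrier N) i"
proof -
  interpret N: koszul R N y n by (rule N)
  have zero: "\<phi> \<zero>\<^bsub>N\<^esub> = \<zero>\<^bsub>M\<^esub>"
    using smult[of \<zero> "\<zero>\<^bsub>N\<^esub>"] closed[of "\<zero>\<^bsub>N\<^esub>"] by simp
  show "submodule (\<phi> ` carrier N) R M"
  proof (rule submoduleI)
    show "\<zero>\<^bsub>M\<^esub> \<in> \<phi> ` carrier N" by (rule image_eqI[of _ _ "\<zero>\<^bsub>N\<^esub>"]) (simp_all add: zero)
    fix a assume "a \<in> \<phi> ` carrier N"
    then obtain X where X: "X \<in> carrier N" "a = \<phi> X" by auto
    have "\<ominus>\<^bsub>M\<^esub> a = \<phi> ((\<ominus> \<one>) \<odot>\<^bsub>N\<^esub> X)"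
      using X closed[OF X(1)] smult[of "\<ominus> \<one>" X] by (simp add: smult_l_minus)
    then show "\<ominus>\<^bsub>M\<^esub> a \<in> \<phi> ` carrier N" using X(1) by auto
    {
      fix b assume "b \<in> \<phi> ` carrier N"
      then obtain Y where Y: "Y \<in> carrier N" "b = \<phi> Y" by auto
      then have "a \<oplus>\<^bsub>M\<^esub> b = \<phi> (X \<oplus>\<^bsub>N\<^esub> Y)" using X add by simp
      then show "a \<oplus>\<^bsub>M\<^esub> b \<in> \<phi> ` carrier N" using X(1) Y(1) by auto
    }
    fix r assume r: "r \<in> carrier R"
    then have "r \<odot>\<^bsub>M\<^esub> a = \<phi> (r \<odot>\<^bsub>N\<^esub> X)" using X smult by simp
    then show "r \<odot>\<^bsub>M\<^esub> a \<in> \<phi> ` carrier N" using X(1) r by auto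
  qed (use closed in auto)
  have fsum: "\<phi> (\<Oplus>\<^bsub>N\<^esub>j\<in>A. f j) = (\<Oplus>\<^bsub>M\<^esub>j\<in>A. \<phi> (f j))" if "finite A" "\<And>j. j \<in> A \<Longrightarrow> f j \<in> carrier N" for A :: "nat set" and f
    using that
  proof (induction A)
    case empty
    then show ?case by (simp add: zero)
  next
    case (insert j A)
    have fA: "f \<in> A \<rightarrow> carrier N" "f j \<in> carrier N" using insert.prems by auto
    have pA: "(\<lambda>j. \<phi> (f j)) \<in> A \<rightarrow> carrier M" "\<phi> (f j) \<in> carrier M" using insert.prems closed by auto
    have "\<phi> (\<Oplus>\<^bsub>N\<^esub>j\<in>insert j A. f j) = \<phi> (f j) \<oplus>\<^bsub>M\<^esub> \<phi> (\<Oplus>\<^bsub>N\<^esub>j\<in>A. f j)"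
      using insert.hyps fA by (subst N.M.finsum_insert) (auto intro!: add N.M.finsum_closed)
    then show ?case
      using insert.hyps insert.IH insert.prems pA by (subst M.finsum_insert) auto
  qed
  have hom: "\<phi> (N.kdiff k a J) = kdiff k (\<lambda>I. \<phi> (a I)) J" if J: "J \<subseteq> {1..n}" and a: "\<And>I. a I \<in> carrier N" for k a J
  proof -
    have c: "coeff k J j \<in> carrier R" if "j \<in> J" for j using J that by auto
    have "\<phi> (N.kdiff k a J) = (\<Oplus>\<^bsub>M\<^esub>j\<in>J. \<phi> (coeff k J j \<odot>\<^bsub>N\<^esub> a (J - {j})))"
      unfolding N.kdiff_def using finite_subset[OF J] c a by (intro fsum) auto
    also have "\<dots> = kdiff k (\<lambda>I. \<phi> (a I)) J"
      unfolding kdiff_def using c a closed by (intro M.finsum_cong') (auto simp: smult)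
    finally show ?thesis .
  qed
  assume ex: "N.colim_exact (carrier N) i"
  show "colim_exact (\<phi> ` carrier N) i"
    unfolding colim_exact_def
  proof (intro allI impI, elim conjE)
    fix k a assume a: "\<forall>I. a I \<in> \<phi> ` carrier N" and cyc: "\<forall>J\<in>face_sets (Suc i). kdiff k a J = \<zero>\<^bsub>M\<^esub>"
    have "\<forall>I. \<exists>X. X \<in> carrier N \<and> a I = \<phi> X" using a by blast
    from choice[OF this] obtain A where A: "\<forall>I. A I \<in> carrier N \<and> a I = \<phi> (A I)" by (elim exE)
    have Ac: "A I \<in> carrier N" and aA: "a I = \<phi> (A I)" for I using A[rule_format, of I] by simp_all
    have a_eq: "a = (\<lambda>I. \<phi> (A I))" using aA by (intro ext)
    have "N.kdiff k A J = \<zero>\<^bsub>N\<^esub>" if J: "J \<in> face_sets (Suc i)" for J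
    proof (rule inj)
      show "N.kdiff k A J \<in> carrier N" by (rule N.kdiff_closed[OF face_sets_subset[OF J] Ac])
      show "\<phi> (N.kdiff k A J) = \<zero>\<^bsub>M\<^esub>"
        unfolding hom[OF face_sets_subset[OF J] Ac] a_eq[symmetric] using cyc J by simp
    qed
    then have "\<exists>t b. (\<forall>I. b I \<in> carrier N) \<and> (\<forall>I\<in>face_sets i. y_power I t \<odot>\<^bsub>N\<^esub> A I = N.kdiff (k + t) b I)"
      using ex unfolding N.colim_exact_def by (elim allE[of _ k] allE[of _ A] impE) (use Ac in auto)
    then obtain t b where b': "\<forall>I. b I \<in> carrier N" and tb: "\<forall>I\<in>face_sets i. y_power I t \<odot>\<^bsub>N\<^esub> A I = N.kdiff (k + t) b I"
      by (elim exE conjE)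
    have b: "b I \<in> carrier N" for I using b' by simp
    have "y_power I t \<odot>\<^bsub>M\<^esub> a I = kdiff (k + t) (\<lambda>I. \<phi> (b I)) I" if I: "I \<in> face_sets i" for I
    proof -
      have "y_power I t \<odot>\<^bsub>M\<^esub> a I = \<phi> (y_power I t \<odot>\<^bsub>N\<^esub> A I)"
        using y_power_closed[OF face_sets_subset[OF I]] Ac by (simp add: aA smult)
      also have "\<dots> = kdiff (k + t) (\<lambda>I. \<phi> (b I)) I"
        using tb I hom[OF face_sets_subset[OF I] b] by simp
      finally show ?thesis .
    qed
    then show "\<exists>t b. (\<forall>I. b I \<in> \<phi> ` carrier N) \<and> (\<forall>I\<in>face_sets i. y_power I t \<odot>\<^bsub>M\<^esub> a I = kdiff (k + t) b I)"
      using b by (intro exI[of _ t] exI[of _ "\<lambda>I. \<phi> (b I)"]) simp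
  qed
qed

lemma grade_le_cohomological_dimension:
  assumes F: "y_filtration F" and nz: "nonzero_module M"
    and acc: "acc_ideals R" "acc_submodules R M (carrier M)"
    and P: "P \<in> associated_primes R M"
  shows "grade R (Idl (y ` {1..n})) M
    \<le> (GREATEST i. nonzero_module (local_cohomology R (quotient_module (regular_module R) P) n y i))"
proof -
  let ?L = "regular_module R" and ?g = "grade R (Idl (y ` {1..n})) M"
  let ?N = "quotient_module ?L P"
  from P obtain x where prime: "primeideal P R" and x: "x \<in> carrier M"
    and Px: "P = {r \<in> carrier R. r \<odot>\<^bsub>M\<^esub> x = \<zero>\<^bsub>M\<^esub>}"
    unfolding associated_primes_def by blast
  interpret L: module R ?L by (rule R.regular_module_is_module)
  have sub: "submodule P R ?L"
    using prime by (intro R.submodule_regular_module) (rule primeideal.axioms(1))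
  interpret N: koszul R ?N y n
    by (intro koszul.intro koszul_axioms.intro L.quotient_module_is_module sub y_closed)
  \<comment> \<open>The map from R/P to M sending the class of s to s x. The choice of a
    representative does not matter because P kills x, and the map is injective because P is the
    whole annihilator of x.\<close>
  define \<phi> where "\<phi> X = (SOME s. s \<in> X) \<odot>\<^bsub>M\<^esub> x" for X
  have Lc: "carrier ?L = carrier R" by (simp add: regular_module_def)
  have \<phi>: "\<phi> (P +>\<^bsub>?L\<^esub> s) = s \<odot>\<^bsub>M\<^esub> x" if s: "s \<in> carrier R" for s
  proof -
    have "(SOME z. z \<in> P +>\<^bsub>?L\<^esub> s) \<in> P +>\<^bsub>?L\<^esub> s"
      using abelian_subgroup.a_rcos_self[OF L.abelian_subgroup_submodule[OF sub], of s] s Lc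
      by (intro someI) auto
    then obtain u where u: "u \<in> P" "(SOME z. z \<in> P +>\<^bsub>?L\<^esub> s) = u \<oplus> s"
      by (auto simp: a_r_coset_def' regular_module_def)
    have "u \<in> carrier R" "u \<odot>\<^bsub>M\<^esub> x = \<zero>\<^bsub>M\<^esub>" using u(1) Px by auto
    then show ?thesis using u(2) s x by (simp add: \<phi>_def smult_l_distr)
  qed
  have Nc: "\<exists>s. s \<in> carrier R \<and> X = P +>\<^bsub>?L\<^esub> s" if "X \<in> carrier ?N" for X
    using that by (auto simp: L.quotient_carrier Lc)
  have Ladd: "s \<oplus>\<^bsub>?L\<^esub> t = s \<oplus> t" "s \<odot>\<^bsub>?L\<^esub> t = s \<otimes> t" for s t by (simp_all add: regular_module_def)
  note transport = colim_exact_transport[where N = ?N and \<phi> = \<phi>, OF N.koszul_axioms]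
  have closed: "\<phi> X \<in> carrier M" if "X \<in> carrier ?N" for X
    using Nc[OF that] \<phi> x by auto
  have add: "\<phi> (X \<oplus>\<^bsub>?N\<^esub> Y) = \<phi> X \<oplus>\<^bsub>M\<^esub> \<phi> Y" if XY: "X \<in> carrier ?N" "Y \<in> carrier ?N" for X Y
  proof -
    obtain s t where st: "s \<in> carrier R" "X = P +>\<^bsub>?L\<^esub> s" "t \<in> carrier R" "Y = P +>\<^bsub>?L\<^esub> t"
      using Nc[OF XY(1)] Nc[OF XY(2)] by auto
    then show ?thesis
      using L.quotient_add[OF sub, of s t] \<phi> x by (simp add: Lc Ladd smult_l_distr)
  qed
  have smult: "\<phi> (r \<odot>\<^bsub>?N\<^esub> X) = r \<odot>\<^bsub>M\<^esub> \<phi> X" if r: "r \<in> carrier R" and X: "X \<in> carrier ?N" for r X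
  proof -
    obtain s where s: "s \<in> carrier R" "X = P +>\<^bsub>?L\<^esub> s" using Nc[OF X] by auto
    then show ?thesis
      using L.quotient_smult[OF sub, of s r] r \<phi> x by (simp add: Lc Ladd smult_assoc1)
  qed
  have inj: "X = \<zero>\<^bsub>?N\<^esub>" if X: "X \<in> carrier ?N" and z: "\<phi> X = \<zero>\<^bsub>M\<^esub>" for X
  proof -
    obtain s where s: "s \<in> carrier R" "X = P +>\<^bsub>?L\<^esub> s" using Nc[OF X] by auto
    then have "s \<in> P" using z \<phi> Px by simp
    then show ?thesis using L.coset_eq_zero_iff[OF sub, of s] s Lc by simp
  qed
  have W: "submodule (\<phi> ` carrier ?N) R M"
    by (rule transport(1)[OF closed add smult inj])
  have xW: "x \<in> \<phi> ` carrier ?N"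
  proof (rule image_eqI)
    show "x = \<phi> (P +>\<^bsub>?L\<^esub> \<one>)" using \<phi>[of \<one>] x by simp
    show "P +>\<^bsub>?L\<^esub> \<one> \<in> carrier ?N" unfolding L.quotient_carrier Lc by blast
  qed
  have "\<one> \<notin> P"
    using ideal.one_imp_carrier[OF primeideal.axioms(1)[OF prime]] primeideal.I_notcarr[OF prime] by auto
  then have x0: "x \<noteq> \<zero>\<^bsub>M\<^esub>" using Px x by auto
  have lo: "colim_exact (carrier M) i" if "i < ?g" for i
  proof (rule colim_exact_if_koszul_exact)
    have "\<And>i. i < ?g \<Longrightarrow> koszul_exact 1 {\<zero>\<^bsub>M\<^esub>} i" using le_grade_iff[OF F nz acc, of ?g] by blast
    then show "koszul_exact k {\<zero>\<^bsub>M\<^esub>} i" for k by (rule koszul_exact_powers[OF F nz acc _ that])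
  qed
  \<comment> \<open>For \<open>?g = 0\<close> the inequality is trivial. Otherwise every degree from
    \<open>?g\<close> on is positive, as \<open>colim_exact_if_local_cohomology_zero\<close>
    requires.\<close>
  show ?thesis
  proof (cases "?g = 0")
    case False
    have "\<exists>i\<ge>?g. nonzero_module (local_cohomology R ?N n y i)"
    proof (rule ccontr)
      assume none: "\<not> ?thesis"
      have hi: "colim_exact (\<phi> ` carrier ?N) i" if gi: "?g \<le> i" for i
      proof -
        obtain h where h: "i = Suc h" using gi False by (cases i) auto
        have cx: "N.colim_exact (carrier ?N) i"
          unfolding h using none gi h by (intro N.colim_exact_if_local_cohomology_zero) auto
        show ?thesis by (rule transport(2)[OF closed add smult inj]; (assumption | rule cx))
      qed
      have "x \<in> F q" for q
      proof (rule exactness_gap[OF W xW, where g = ?g and q = q])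
        show "submodule (F q) R M" using F by (simp add: y_filtration_def)
        show "y l [^] q \<odot>\<^bsub>M\<^esub> m \<in> F q" if "l \<in> {1..n}" "m \<in> carrier M" for l m
          by (rule y_filtration_power[OF F that])
      qed (use False hi lo in auto)
      then have "x \<in> {\<zero>\<^bsub>M\<^esub>}" using F unfolding y_filtration_def by blast
      then show False using x0 by simp
    qed
    then obtain i where i: "?g \<le> i" "nonzero_module (local_cohomology R ?N n y i)" by blast
    have "i \<le> (GREATEST i. nonzero_module (local_cohomology R ?N n y i))"
    proof (rule Greatest_le_nat[where b = n])
      show "nonzero_module (local_cohomology R ?N n y i)" by (rule i(2))
      show "k \<le> n" if "nonzero_module (local_cohomology R ?N n y k)" for k
        using N.local_cohomology_vanishes[of k] that by (cases "n < k") auto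
    qed
    then show ?thesis using i(1) by simp
  qed simp
qed

end

section \<open>Finite direct sums\<close>

lemma (in koszul) koszul_exact_zero_iff:
  "koszul_exact k {\<zero>\<^bsub>M\<^esub>} i \<longleftrightarrow> (\<forall>a. (\<forall>I. a I \<in> carrier M) \<and> (\<forall>J\<in>face_sets (Suc i). kdiff k a J = \<zero>\<^bsub>M\<^esub>) \<longrightarrow>
     (\<exists>b. (\<forall>I. b I \<in> carrier M) \<and> (\<forall>I\<in>face_sets i. a I = kdiff k b I)))"
proof -
  have "a I \<ominus>\<^bsub>M\<^esub> kdiff k b I \<in> {\<zero>\<^bsub>M\<^esub>} \<longleftrightarrow> a I = kdiff k b I"
    if a: "\<forall>I. a I \<in> carrier M" and b: "\<forall>I. b I \<in> carrier M" and I: "I \<in> face_sets i" for a b I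
  proof -
    have "kdiff k b I \<in> carrier M" by (rule kdiff_closed[OF face_sets_subset[OF I]]) (use b in auto)
    then show ?thesis using a M.diff_eq_zeroD[of "a I" "kdiff k b I"] by (auto simp: a_minus_def M.r_neg)
  qed
  then show ?thesis unfolding koszul_exact_def by (simp cong: conj_cong)
qed

text \<open>Finite generation phrased through submodules, which passes to direct sums without
  handling linear combinations.\<close>

definition spanned_by :: "('r, 'b) ring_scheme \<Rightarrow> ('r, 'a, 'c) module_scheme \<Rightarrow> 'a set \<Rightarrow> bool" where
  "spanned_by R M A \<longleftrightarrow> finite A \<and> A \<subseteq> carrier M \<and> (\<forall>W. submodule W R M \<and> A \<subseteq> W \<longrightarrow> W = carrier M)"

lemma (in module) spanned_by_if_finitely_generated:
  assumes "finitely_generated_module R M"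
  shows "\<exists>A. spanned_by R M A"
proof -
  obtain A where A: "finite A" "A \<subseteq> carrier M"
    and gen: "\<And>x. x \<in> carrier M \<Longrightarrow> \<exists>c\<in>A \<rightarrow> carrier R. x = (\<Oplus>\<^bsub>M\<^esub>a\<in>A. c a \<odot>\<^bsub>M\<^esub> a)"
    using assms unfolding finitely_generated_module_def by blast
  have "W = carrier M" if W: "submodule W R M" "A \<subseteq> W" for W
  proof
    show "W \<subseteq> carrier M" by (rule submoduleE(1)[OF W(1)])
    show "carrier M \<subseteq> W"
    proof
      fix x assume "x \<in> carrier M"
      from gen[OF this] obtain c where c: "c \<in> A \<rightarrow> carrier R" "x = (\<Oplus>\<^bsub>M\<^esub>a\<in>A. c a \<odot>\<^bsub>M\<^esub> a)" by blast
      show "x \<in> W"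
        unfolding c(2) using c(1) W(2) by (intro submodule_finsum[OF W(1) A(1)] submoduleE(4)[OF W(1)]) auto
    qed
  qed
  then show ?thesis using A unfolding spanned_by_def by blast
qed

locale module_family = R?: cring R for R (structure) +
  fixes I :: "'i set" and M :: "'i \<Rightarrow> ('a, 'c, 'd) module_scheme"
  assumes finite_I: "finite I" and modules: "i \<in> I \<Longrightarrow> module R (M i)"
begin

abbreviation "N \<equiv> direct_sum I M"

lemma sum_carrier: "carrier N = (\<Pi>\<^sub>E i\<in>I. carrier (M i))"
  using finite_I by (simp add: direct_sum_def)

lemma sum_zero: "\<zero>\<^bsub>N\<^esub> = (\<lambda>i\<in>I. \<zero>\<^bsub>M i\<^esub>)"
  by (simp add: direct_sum_def)

lemma sum_add: "x \<oplus>\<^bsub>N\<^esub> z = (\<lambda>i\<in>I. x i \<oplus>\<^bsub>M i\<^esub> z i)"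
  by (simp add: direct_sum_def)

lemma sum_smult: "r \<odot>\<^bsub>N\<^esub> x = (\<lambda>i\<in>I. r \<odot>\<^bsub>M i\<^esub> x i)"
  by (simp add: direct_sum_def)

lemma abelian_groups: "i \<in> I \<Longrightarrow> abelian_group (M i)"
  using modules by (rule module.axioms(2))

lemma component: "x \<in> carrier N \<Longrightarrow> i \<in> I \<Longrightarrow> x i \<in> carrier (M i)"
  by (auto simp: sum_carrier)

lemma sum_ext: "x \<in> carrier N \<Longrightarrow> z \<in> carrier N \<Longrightarrow> (\<And>i. i \<in> I \<Longrightarrow> x i = z i) \<Longrightarrow> x = z"
  unfolding sum_carrier by (rule PiE_ext)

lemma sum_memI: "(\<And>i. i \<in> I \<Longrightarrow> f i \<in> carrier (M i)) \<Longrightarrow> (\<lambda>i\<in>I. f i) \<in> carrier N"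
  unfolding sum_carrier by auto

lemma sum_module: "module R N"
proof (rule moduleI)
  note [simp] = module.smult_closed[OF modules] abelian_monoid.a_closed[OF abelian_group.axioms(1)[OF abelian_groups]]
    abelian_monoid.zero_closed[OF abelian_group.axioms(1)[OF abelian_groups]] component
  show "cring R" by (rule R.is_cring)
  have zero: "\<zero>\<^bsub>N\<^esub> \<in> carrier N" unfolding sum_zero by (rule sum_memI) simp
  have add: "x \<oplus>\<^bsub>N\<^esub> z \<in> carrier N" if "x \<in> carrier N" "z \<in> carrier N" for x z
    unfolding sum_add by (rule sum_memI) (use that in simp)
  have smult: "r \<odot>\<^bsub>N\<^esub> x \<in> carrier N" if "r \<in> carrier R" "x \<in> carrier N" for r x
    unfolding sum_smult by (rule sum_memI) (use that in simp)
  show "abelian_group N"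
  proof (rule abelian_groupI)
    fix x assume x: "x \<in> carrier N"
    show "\<zero>\<^bsub>N\<^esub> \<oplus>\<^bsub>N\<^esub> x = x"
      by (rule sum_ext[OF add[OF zero x] x])
        (use x in \<open>simp add: sum_add sum_zero abelian_monoid.l_zero[OF abelian_group.axioms(1)[OF abelian_groups]]\<close>)
    have neg: "(\<lambda>i\<in>I. \<ominus>\<^bsub>M i\<^esub> x i) \<in> carrier N"
      by (rule sum_memI) (use x in \<open>simp add: abelian_group.a_inv_closed[OF abelian_groups]\<close>)
    have "(\<lambda>i\<in>I. \<ominus>\<^bsub>M i\<^esub> x i) \<oplus>\<^bsub>N\<^esub> x = \<zero>\<^bsub>N\<^esub>"
      by (rule sum_ext[OF add[OF neg x] zero])
        (use x in \<open>simp add: sum_add sum_zero abelian_group.l_neg[OF abelian_groups]\<close>)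
    then show "\<exists>z\<in>carrier N. z \<oplus>\<^bsub>N\<^esub> x = \<zero>\<^bsub>N\<^esub>" using neg by blast
    fix z assume z: "z \<in> carrier N"
    show "x \<oplus>\<^bsub>N\<^esub> z \<in> carrier N" by (rule add[OF x z])
    show "x \<oplus>\<^bsub>N\<^esub> z = z \<oplus>\<^bsub>N\<^esub> x"
      by (rule sum_ext[OF add[OF x z] add[OF z x]])
        (use x z in \<open>simp add: sum_add abelian_monoid.a_comm[OF abelian_group.axioms(1)[OF abelian_groups]]\<close>)
    fix w assume w: "w \<in> carrier N"
    show "(x \<oplus>\<^bsub>N\<^esub> z) \<oplus>\<^bsub>N\<^esub> w = x \<oplus>\<^bsub>N\<^esub> (z \<oplus>\<^bsub>N\<^esub> w)"
      by (rule sum_ext[OF add[OF add[OF x z] w] add[OF x add[OF z w]]])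
        (use x z w in \<open>simp add: sum_add abelian_monoid.a_assoc[OF abelian_group.axioms(1)[OF abelian_groups]]\<close>)
  qed (rule zero)
  fix x assume x: "x \<in> carrier N"
  show "\<one> \<odot>\<^bsub>N\<^esub> x = x"
    by (rule sum_ext[OF smult[OF R.one_closed x] x]) (use x in \<open>simp add: sum_smult module.smult_one[OF modules]\<close>)
  fix r assume r: "r \<in> carrier R"
  show "r \<odot>\<^bsub>N\<^esub> x \<in> carrier N" by (rule smult[OF r x])
  {
    fix z assume z: "z \<in> carrier N"
    show "r \<odot>\<^bsub>N\<^esub> (x \<oplus>\<^bsub>N\<^esub> z) = r \<odot>\<^bsub>N\<^esub> x \<oplus>\<^bsub>N\<^esub> r \<odot>\<^bsub>N\<^esub> z"
      by (rule sum_ext[OF smult[OF r add[OF x z]] add[OF smult[OF r x] smult[OF r z]]])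
        (use r x z in \<open>simp add: sum_add sum_smult module.smult_r_distr[OF modules]\<close>)
  }
  fix s assume s: "s \<in> carrier R"
  show "(r \<oplus> s) \<odot>\<^bsub>N\<^esub> x = r \<odot>\<^bsub>N\<^esub> x \<oplus>\<^bsub>N\<^esub> s \<odot>\<^bsub>N\<^esub> x"
    by (rule sum_ext[OF smult[OF R.a_closed[OF r s] x] add[OF smult[OF r x] smult[OF s x]]])
      (use r s x in \<open>simp add: sum_add sum_smult module.smult_l_distr[OF modules]\<close>)
  show "r \<otimes> s \<odot>\<^bsub>N\<^esub> x = r \<odot>\<^bsub>N\<^esub> (s \<odot>\<^bsub>N\<^esub> x)"
    by (rule sum_ext[OF smult[OF R.m_closed[OF r s] x] smult[OF r smult[OF s x]]])
      (use r s x in \<open>simp add: sum_smult module.smult_assoc1[OF modules]\<close>)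
qed

sublocale S: module R N by (rule sum_module)

lemma sum_finsum:
  assumes A: "finite A" and f: "\<And>j. j \<in> A \<Longrightarrow> f j \<in> carrier N" and i: "i \<in> I"
  shows "(\<Oplus>\<^bsub>N\<^esub>j\<in>A. f j) i = (\<Oplus>\<^bsub>M i\<^esub>j\<in>A. f j i)"
proof -
  interpret Mi: module R "M i" by (rule modules[OF i])
  show ?thesis
    using A f
  proof (induction A)
    case empty
    then show ?case using i by (simp add: sum_zero)
  next
    case (insert j A)
    then have "(\<Oplus>\<^bsub>N\<^esub>j\<in>insert j A. f j) = f j \<oplus>\<^bsub>N\<^esub> (\<Oplus>\<^bsub>N\<^esub>j\<in>A. f j)"
      by (intro S.M.finsum_insert) auto
    moreover have "(\<Oplus>\<^bsub>M i\<^esub>j\<in>insert j A. f j i) = f j i \<oplus>\<^bsub>M i\<^esub> (\<Oplus>\<^bsub>M i\<^esub>j\<in>A. f j i)"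
      using insert component[OF _ i] by (intro Mi.M.finsum_insert) auto
    ultimately show ?case using insert i by (simp add: sum_add)
  qed
qed

definition embed :: "'i \<Rightarrow> 'c \<Rightarrow> 'i \<Rightarrow> 'c" where
  "embed i a = (\<lambda>j\<in>I. if j = i then a else \<zero>\<^bsub>M j\<^esub>)"

lemma embed_closed: "i \<in> I \<Longrightarrow> a \<in> carrier (M i) \<Longrightarrow> embed i a \<in> carrier N"
  unfolding embed_def
  by (rule sum_memI) (simp add: abelian_monoid.zero_closed[OF abelian_group.axioms(1)[OF abelian_groups]])

lemma embed_zero: "embed i \<zero>\<^bsub>M i\<^esub> = \<zero>\<^bsub>N\<^esub>"
  unfolding embed_def sum_zero by (rule restrict_ext) simp

lemma embed_component: "i \<in> I \<Longrightarrow> embed i a i = a"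
  by (simp add: embed_def)

lemma embed_add:
  assumes "i \<in> I" "a \<in> carrier (M i)" "b \<in> carrier (M i)"
  shows "embed i (a \<oplus>\<^bsub>M i\<^esub> b) = embed i a \<oplus>\<^bsub>N\<^esub> embed i b"
  unfolding embed_def sum_add
  by (rule restrict_ext) (auto simp: abelian_monoid.l_zero[OF abelian_group.axioms(1)[OF abelian_groups]]
      abelian_monoid.zero_closed[OF abelian_group.axioms(1)[OF abelian_groups]])

lemma embed_smult:
  assumes "i \<in> I" "r \<in> carrier R" "a \<in> carrier (M i)"
  shows "embed i (r \<odot>\<^bsub>M i\<^esub> a) = r \<odot>\<^bsub>N\<^esub> embed i a"
  unfolding embed_def sum_smult
  by (rule restrict_ext) (auto simp: assms(2) module.smult_r_null[OF modules])

lemma sum_nonzero: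
  assumes "i \<in> I" "nonzero_module (M i)"
  shows "nonzero_module N"
proof -
  interpret Mi: module R "M i" by (rule modules[OF assms(1)])
  obtain a where a: "a \<in> carrier (M i)" "a \<noteq> \<zero>\<^bsub>M i\<^esub>"
    using assms(2) Mi.M.zero_closed unfolding nonzero_module_def by blast
  have "embed i a \<noteq> \<zero>\<^bsub>N\<^esub>"
    using a(2) embed_component[OF assms(1), of a] assms(1) by (auto simp: sum_zero)
  then show ?thesis using embed_closed[OF assms(1) a(1)] unfolding nonzero_module_def by blast
qed

lemma sum_spanned:
  assumes "\<And>i. i \<in> I \<Longrightarrow> spanned_by R (M i) (A i)"
  shows "spanned_by R N (\<Union>i\<in>I. embed i ` A i)"
  unfolding spanned_by_def
proof (intro conjI allI impI, goal_cases)
  case 1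
  then show ?case using finite_I assms by (auto simp: spanned_by_def)
next
  case 2
  then show ?case using embed_closed assms by (auto simp: spanned_by_def)
next
  case (3 W)
  then have W: "submodule W R N" "(\<Union>i\<in>I. embed i ` A i) \<subseteq> W" by auto
  have emb: "embed i a \<in> W" if i: "i \<in> I" and a: "a \<in> carrier (M i)" for i a
  proof -
    interpret Mi: module R "M i" by (rule modules[OF i])
    \<comment> \<open>The preimage of W under \<open>embed i\<close> is a submodule of
      \<open>M i\<close> containing the generators \<open>A i\<close>, hence everything.\<close>
    let ?W = "{a \<in> carrier (M i). embed i a \<in> W}"
    have "submodule ?W R (M i)"
    proof (rule Mi.submoduleI)
      fix a assume a: "a \<in> ?W"
      have "embed i (\<ominus>\<^bsub>M i\<^esub> a) = (\<ominus> \<one>) \<odot>\<^bsub>N\<^esub> embed i a"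
        using embed_smult[OF i, of "\<ominus> \<one>" a] a by (simp add: Mi.smult_l_minus)
      then show "\<ominus>\<^bsub>M i\<^esub> a \<in> ?W" using a S.submoduleE(4)[OF W(1)] by simp
    qed (use embed_zero S.submodule_zero[OF W(1)] embed_add[OF i] embed_smult[OF i]
        S.submoduleE(4,5)[OF W(1)] in auto)
    moreover have "A i \<subseteq> ?W" using assms[OF i] W(2) i by (auto simp: spanned_by_def)
    moreover have "\<forall>W. submodule W R (M i) \<and> A i \<subseteq> W \<longrightarrow> W = carrier (M i)"
      using assms[OF i] unfolding spanned_by_def by (elim conjE)
    ultimately have "?W = carrier (M i)" by (elim allE[of _ ?W]) (rule mp, assumption, rule conjI)
    then show ?thesis using a by blast
  qed
  show ?case
  proof
    show "W \<subseteq> carrier N" by (rule S.submoduleE(1)[OF W(1)])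
    show "carrier N \<subseteq> W"
    proof
      fix x assume x: "x \<in> carrier N"
      \<comment> \<open>x is assembled from its components, one index at a time.\<close>
      have "(\<lambda>j\<in>I. if j \<in> T then x j else \<zero>\<^bsub>M j\<^esub>) \<in> W" if "finite T" "T \<subseteq> I" for T
        using that
      proof (induction T)
        case empty
        then show ?case using S.submodule_zero[OF W(1)] by (simp add: sum_zero restrict_def)
      next
        case (insert i T)
        then have i: "i \<in> I" by simp
        have IH: "(\<lambda>j\<in>I. if j \<in> T then x j else \<zero>\<^bsub>M j\<^esub>) \<in> W"
          by (rule insert.IH) (use insert.prems in simp)
        have eq: "(\<lambda>j\<in>I. if j \<in> insert i T then x j else \<zero>\<^bsub>M j\<^esub>)
          = embed i (x i) \<oplus>\<^bsub>N\<^esub> (\<lambda>j\<in>I. if j \<in> T then x j else \<zero>\<^bsub>M j\<^esub>)"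
          unfolding embed_def sum_add
        proof (rule restrict_ext)
          fix j assume j: "j \<in> I"
          interpret Mi: module R "M i" by (rule modules[OF i])
          interpret Mj: module R "M j" by (rule modules[OF j])
          show "(if j \<in> insert i T then x j else \<zero>\<^bsub>M j\<^esub>) = (\<lambda>j\<in>I. if j = i then x i else \<zero>\<^bsub>M j\<^esub>) j
            \<oplus>\<^bsub>M j\<^esub> (\<lambda>j\<in>I. if j \<in> T then x j else \<zero>\<^bsub>M j\<^esub>) j"
            using j insert.hyps(2) component[OF x j] by auto
        qed
        show ?case
          unfolding eq by (rule S.submoduleE(5)[OF W(1) emb[OF i component[OF x i]] IH])
      qed
      from this[OF finite_I order_refl] have "(\<lambda>j\<in>I. if j \<in> I then x j else \<zero>\<^bsub>M j\<^esub>) \<in> W" .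
      moreover have "(\<lambda>j\<in>I. if j \<in> I then x j else \<zero>\<^bsub>M j\<^esub>) = x"
        using x unfolding sum_carrier by (auto simp: restrict_def PiE_def extensional_def fun_eq_iff)
      ultimately show "x \<in> W" by simp
    qed
  qed
qed

text \<open>The annihilator of x is the intersection of the annihilators of its components; being
  prime, it contains one of them and so equals it. Conversely, \<open>embed\<close> preserves
  annihilators.\<close>

lemma associated_primes_sum: "associated_primes R N = (\<Union>i\<in>I. associated_primes R (M i))"
proof (intro equalityI subsetI)
  fix P assume "P \<in> associated_primes R N"
  then obtain x where P: "primeideal P R" and x: "x \<in> carrier N" and Px: "P = {r \<in> carrier R. r \<odot>\<^bsub>N\<^esub> x = \<zero>\<^bsub>N\<^esub>}"
    unfolding associated_primes_def by blast
  define J where "J i = annihilator R (M i) {\<zero>\<^bsub>M i\<^esub>} (x i)" for i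
  have J: "ideal (J i) R" if "i \<in> I" for i
    unfolding J_def using component[OF x that]
    by (intro module.ideal_annihilator module.submodule_zero_set modules that)
  have PJ: "r \<in> P \<longleftrightarrow> r \<in> carrier R \<and> (\<forall>i\<in>I. r \<in> J i)" for r
  proof -
    have "r \<odot>\<^bsub>N\<^esub> x = \<zero>\<^bsub>N\<^esub> \<longleftrightarrow> (\<forall>i\<in>I. r \<odot>\<^bsub>M i\<^esub> x i = \<zero>\<^bsub>M i\<^esub>)"
      unfolding sum_smult sum_zero by (auto simp: restrict_def fun_eq_iff)
    then show ?thesis by (auto simp: Px J_def annihilator_def)
  qed
  have "\<exists>i\<in>I. J i \<subseteq> P"
  proof (rule ccontr)
    assume none: "\<not> (\<exists>i\<in>I. J i \<subseteq> P)"
    have "\<exists>c\<in>carrier R. c \<notin> P \<and> (\<forall>P'\<in>J ` I. c \<in> P')"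
      by (rule S.prime_not_contains_Int[OF P]) (use finite_I J none in auto)
    then show False using PJ by blast
  qed
  then obtain i where i: "i \<in> I" "J i \<subseteq> P" by blast
  then have "P = J i" using PJ by blast
  then have "P = {r \<in> carrier R. r \<odot>\<^bsub>M i\<^esub> x i = \<zero>\<^bsub>M i\<^esub>}" by (simp add: J_def annihilator_def)
  then show "P \<in> (\<Union>i\<in>I. associated_primes R (M i))"
    using P i(1) component[OF x i(1)] unfolding associated_primes_def by blast
next
  fix P assume "P \<in> (\<Union>i\<in>I. associated_primes R (M i))"
  then obtain i z where i: "i \<in> I" and P: "primeideal P R" and z: "z \<in> carrier (M i)"
    and Pz: "P = {r \<in> carrier R. r \<odot>\<^bsub>M i\<^esub> z = \<zero>\<^bsub>M i\<^esub>}"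
    unfolding associated_primes_def by blast
  have "r \<odot>\<^bsub>N\<^esub> embed i z = \<zero>\<^bsub>N\<^esub> \<longleftrightarrow> r \<odot>\<^bsub>M i\<^esub> z = \<zero>\<^bsub>M i\<^esub>" if r: "r \<in> carrier R" for r
  proof
    assume "r \<odot>\<^bsub>N\<^esub> embed i z = \<zero>\<^bsub>N\<^esub>"
    then have "embed i (r \<odot>\<^bsub>M i\<^esub> z) i = \<zero>\<^bsub>N\<^esub> i" using embed_smult[OF i r z] by simp
    then show "r \<odot>\<^bsub>M i\<^esub> z = \<zero>\<^bsub>M i\<^esub>" using i by (simp add: embed_component sum_zero)
  next
    assume "r \<odot>\<^bsub>M i\<^esub> z = \<zero>\<^bsub>M i\<^esub>"
    then show "r \<odot>\<^bsub>N\<^esub> embed i z = \<zero>\<^bsub>N\<^esub>" using embed_smult[OF i r z] embed_zero by metis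
  qed
  then have "P = {r \<in> carrier R. r \<odot>\<^bsub>N\<^esub> embed i z = \<zero>\<^bsub>N\<^esub>}" unfolding Pz by blast
  then show "P \<in> associated_primes R N"
    using P embed_closed[OF i z] unfolding associated_primes_def by blast
qed

text \<open>\<open>kdiff\<close> acts componentwise. From the sum to \<open>M i\<close>, a cocycle
  is embedded and the component at i of a primitive is taken; conversely, primitives in the summands
  are collected into a family.\<close>

lemma koszul_exact_sum_iff:
  fixes y :: "nat \<Rightarrow> 'a"
  assumes y: "\<And>j. j \<in> {1..n} \<Longrightarrow> y j \<in> carrier R"
  shows "koszul.koszul_exact R N y n k {\<zero>\<^bsub>N\<^esub>} m \<longleftrightarrow> (\<forall>i\<in>I. koszul.koszul_exact R (M i) y n k {\<zero>\<^bsub>M i\<^esub>} m)"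
proof -
  have kos: "koszul R (M i) y n" if "i \<in> I" for i
    by (intro koszul.intro koszul_axioms.intro modules that y)
  interpret N: koszul R N y n by (intro koszul.intro koszul_axioms.intro sum_module y)
  have kdiff: "N.kdiff k a J i = koszul.kdiff R (M i) y k (\<lambda>J. a J i) J"
    if J: "J \<subseteq> {1..n}" and a: "\<And>J. a J \<in> carrier N" and i: "i \<in> I" for a J i
  proof -
    interpret Mi: koszul R "M i" y n by (rule kos[OF i])
    have c: "N.coeff k J j \<in> carrier R" if "j \<in> J" for j using J that by auto
    have "N.kdiff k a J i = (\<Oplus>\<^bsub>M i\<^esub>j\<in>J. (N.coeff k J j \<odot>\<^bsub>N\<^esub> a (J - {j})) i)"
      unfolding N.kdiff_def using finite_subset[OF J] c a i by (intro sum_finsum) auto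
    also have "\<dots> = Mi.kdiff k (\<lambda>J. a J i) J"
      unfolding Mi.kdiff_def using c component[OF a i] i by (intro Mi.M.finsum_cong') (auto simp: sum_smult)
    finally show ?thesis .
  qed
  show ?thesis
  proof
    assume ex: "N.koszul_exact k {\<zero>\<^bsub>N\<^esub>} m"
    show "\<forall>i\<in>I. koszul.koszul_exact R (M i) y n k {\<zero>\<^bsub>M i\<^esub>} m"
    proof
      fix i assume i: "i \<in> I"
      interpret Mi: koszul R "M i" y n by (rule kos[OF i])
      show "Mi.koszul_exact k {\<zero>\<^bsub>M i\<^esub>} m"
        unfolding Mi.koszul_exact_zero_iff
      proof (intro allI impI, elim conjE)
        fix a assume a: "\<forall>J. a J \<in> carrier (M i)" and cyc: "\<forall>J\<in>N.face_sets (Suc m). Mi.kdiff k a J = \<zero>\<^bsub>M i\<^esub>"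
        let ?a = "\<lambda>J. embed i (a J)"
        have ac: "?a J \<in> carrier N" for J using embed_closed[OF i] a by simp
        have "N.kdiff k ?a J = \<zero>\<^bsub>N\<^esub>" if J: "J \<in> N.face_sets (Suc m)" for J
        proof (rule sum_ext[OF N.kdiff_closed[OF N.face_sets_subset[OF J] ac] S.M.zero_closed])
          fix j assume j: "j \<in> I"
          interpret Mj: koszul R "M j" y n by (rule kos[OF j])
          have "N.kdiff k ?a J j = Mj.kdiff k (\<lambda>J. ?a J j) J" by (rule kdiff[OF N.face_sets_subset[OF J] ac j])
          also have "\<dots> = \<zero>\<^bsub>M j\<^esub>"
          proof (cases "j = i")
            case True
            then show ?thesis using cyc J i by (simp add: embed_def)
          next
            case False
            then show ?thesis using Mj.kdiff_zero[OF N.face_sets_subset[OF J]] j by (simp add: embed_def)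
          qed
          finally show "N.kdiff k ?a J j = \<zero>\<^bsub>N\<^esub> j" using j by (simp add: sum_zero)
        qed
        then have "\<exists>b. (\<forall>J. b J \<in> carrier N) \<and> (\<forall>J\<in>N.face_sets m. ?a J = N.kdiff k b J)"
          using ex unfolding N.koszul_exact_zero_iff by (elim allE[of _ ?a] impE) (use ac in auto)
        then obtain b where b: "\<forall>J. b J \<in> carrier N" "\<forall>J\<in>N.face_sets m. ?a J = N.kdiff k b J" by (elim exE conjE)
        have bc: "b J \<in> carrier N" for J using b(1) by simp
        have "a J = Mi.kdiff k (\<lambda>J. b J i) J" if J: "J \<in> N.face_sets m" for J
        proof -
          have "?a J = N.kdiff k b J" using b(2) J by (rule bspec)
          then have "?a J i = N.kdiff k b J i" by (rule arg_cong)
          then show ?thesis by (simp only: embed_component[OF i] kdiff[OF N.face_sets_subset[OF J] bc i])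
        qed
        then show "\<exists>b. (\<forall>J. b J \<in> carrier (M i)) \<and> (\<forall>J\<in>N.face_sets m. a J = Mi.kdiff k b J)"
          using component[OF bc i] by (intro exI[of _ "\<lambda>J. b J i"]) simp
      qed
    qed
  next
    assume ex: "\<forall>i\<in>I. koszul.koszul_exact R (M i) y n k {\<zero>\<^bsub>M i\<^esub>} m"
    show "N.koszul_exact k {\<zero>\<^bsub>N\<^esub>} m"
      unfolding N.koszul_exact_zero_iff
    proof (intro allI impI, elim conjE)
      fix a assume a': "\<forall>J. a J \<in> carrier N" and cyc: "\<forall>J\<in>N.face_sets (Suc m). N.kdiff k a J = \<zero>\<^bsub>N\<^esub>"
      have a: "a J \<in> carrier N" for J using a' by simp
      have "\<forall>i\<in>I. \<exists>b. (\<forall>J. b J \<in> carrier (M i)) \<and> (\<forall>J\<in>N.face_sets m. a J i = koszul.kdiff R (M i) y k b J)"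
      proof
        fix i assume i: "i \<in> I"
        interpret Mi: koszul R "M i" y n by (rule kos[OF i])
        have "Mi.kdiff k (\<lambda>J. a J i) J = \<zero>\<^bsub>M i\<^esub>" if J: "J \<in> N.face_sets (Suc m)" for J
          using kdiff[where a = a, OF N.face_sets_subset[OF J] a i] cyc J i by (simp add: sum_zero)
        moreover have "Mi.koszul_exact k {\<zero>\<^bsub>M i\<^esub>} m" using ex i by simp
        ultimately show "\<exists>b. (\<forall>J. b J \<in> carrier (M i)) \<and> (\<forall>J\<in>N.face_sets m. a J i = Mi.kdiff k b J)"
          unfolding Mi.koszul_exact_zero_iff by (elim allE[of _ "\<lambda>J. a J i"] impE) (use component[OF a i] in auto)
      qed
      then obtain b where b: "\<forall>i\<in>I. (\<forall>J. b i J \<in> carrier (M i)) \<and> (\<forall>J\<in>N.face_sets m. a J i = koszul.kdiff R (M i) y k (b i) J)"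
        by (rule bchoice[THEN exE])
      let ?b = "\<lambda>J. \<lambda>i\<in>I. b i J"
      have bc: "?b J \<in> carrier N" for J by (rule sum_memI) (use b in simp)
      have "a J = N.kdiff k ?b J" if J: "J \<in> N.face_sets m" for J
      proof (rule sum_ext[OF a N.kdiff_closed[OF N.face_sets_subset[OF J] bc]])
        fix i assume i: "i \<in> I"
        then show "a J i = N.kdiff k ?b J i"
          using kdiff[OF N.face_sets_subset[OF J] bc i] b J by simp
      qed
      then show "\<exists>b. (\<forall>J. b J \<in> carrier N) \<and> (\<forall>J\<in>N.face_sets m. a J = N.kdiff k b J)"
        using bc by (intro exI[of _ ?b]) simp
    qed
  qed
qed

lemma y_filtration_sum:
  fixes y :: "nat \<Rightarrow> 'a"
  assumes y: "\<And>j. j \<in> {1..n} \<Longrightarrow> y j \<in> carrier R"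
    and F: "\<And>i. i \<in> I \<Longrightarrow> koszul.y_filtration R (M i) y n (F i)"
  shows "koszul.y_filtration R N y n (\<lambda>d. {x \<in> carrier N. \<forall>i\<in>I. x i \<in> F i d})"
proof -
  have kos: "koszul R (M i) y n" if "i \<in> I" for i
    by (intro koszul.intro koszul_axioms.intro modules that y)
  interpret N: koszul R N y n by (intro koszul.intro koszul_axioms.intro sum_module y)
  have F_def: "(\<forall>d. submodule (F i d) R (M i)) \<and> F i 0 = carrier (M i) \<and>
     (\<forall>j\<in>{1..n}. \<forall>d. \<forall>x\<in>F i d. y j \<odot>\<^bsub>M i\<^esub> x \<in> F i (Suc d)) \<and> (\<Inter>d. F i d) = {\<zero>\<^bsub>M i\<^esub>}" if "i \<in> I" for i
    using F[OF that] unfolding koszul.y_filtration_def[OF kos[OF that]] .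
  have sub: "submodule (F i d) R (M i)" if "i \<in> I" for i d using F_def[OF that] by simp
  let ?F = "\<lambda>d. {x \<in> carrier N. \<forall>i\<in>I. x i \<in> F i d}"
  show ?thesis
    unfolding N.y_filtration_def
  proof (intro conjI allI ballI)
    fix d
    show "submodule (?F d) R N"
    proof (rule S.submoduleI)
      show "\<zero>\<^bsub>N\<^esub> \<in> ?F d"
        using S.M.zero_closed module.submodule_zero[OF modules sub] by (simp add: sum_zero)
      fix x assume x: "x \<in> ?F d"
      have smult: "r \<odot>\<^bsub>N\<^esub> x \<in> ?F d" if "r \<in> carrier R" for r
        using x that module.submoduleE(4)[OF modules sub] S.smult_closed[OF that] by (simp add: sum_smult)
      have "\<ominus>\<^bsub>N\<^esub> x = (\<ominus> \<one>) \<odot>\<^bsub>N\<^esub> x" using x by (simp add: S.smult_l_minus)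
      then show "\<ominus>\<^bsub>N\<^esub> x \<in> ?F d" using smult[of "\<ominus> \<one>"] by simp
      show "r \<odot>\<^bsub>N\<^esub> x \<in> ?F d" if "r \<in> carrier R" for r by (rule smult[OF that])
      fix z assume z: "z \<in> ?F d"
      show "x \<oplus>\<^bsub>N\<^esub> z \<in> ?F d"
        using x z module.submoduleE(5)[OF modules sub] S.M.a_closed[of x z] by (simp add: sum_add)
    qed auto
    show "?F 0 = carrier N" using F_def component by auto
    show "y j \<odot>\<^bsub>N\<^esub> x \<in> ?F (Suc d)" if "j \<in> {1..n}" "x \<in> ?F d" for j x
    proof -
      have "y j \<odot>\<^bsub>N\<^esub> x \<in> carrier N" using that y by (intro S.smult_closed) auto
      moreover have "y j \<odot>\<^bsub>M i\<^esub> x i \<in> F i (Suc d)" if "i \<in> I" for i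
        using F_def[OF that] \<open>j \<in> {1..n}\<close> \<open>x \<in> ?F d\<close> that by blast
      ultimately show ?thesis by (simp add: sum_smult)
    qed
  next
    have "x = \<zero>\<^bsub>N\<^esub>" if x: "x \<in> (\<Inter>d. ?F d)" for x
    proof (rule sum_ext)
      show "x \<in> carrier N" using x by auto
      fix i assume i: "i \<in> I"
      have "x i \<in> (\<Inter>d. F i d)" using x i by auto
      then show "x i = \<zero>\<^bsub>N\<^esub> i" using F_def[OF i] i by (simp add: sum_zero)
    qed simp
    moreover have "\<zero>\<^bsub>N\<^esub> \<in> ?F d" for d
      using S.M.zero_closed module.submodule_zero[OF modules sub] by (simp add: sum_zero)
    ultimately show "(\<Inter>d. ?F d) = {\<zero>\<^bsub>N\<^esub>}" by blast
  qed
qed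

end

section \<open>The filtration by y-degree\<close>

text \<open>Sums of homogeneous elements of y-degree at least D, built one summand at a time. D is
  an integer because degrees may be negative; the x-degree is unrestricted.\<close>

inductive_set span_ge ::
    "('r, 'a, 'c) module_scheme \<Rightarrow> (int \<times> int \<Rightarrow> 'a set) \<Rightarrow> int \<Rightarrow> 'a set"
  for M :: "('r, 'a, 'c) module_scheme" and G :: "int \<times> int \<Rightarrow> 'a set" and D :: int where
  zero: "\<zero>\<^bsub>M\<^esub> \<in> span_ge M G D"
| add: "x \<in> span_ge M G D \<Longrightarrow> g \<in> G e \<Longrightarrow> D \<le> snd e \<Longrightarrow> x \<oplus>\<^bsub>M\<^esub> g \<in> span_ge M G D"

declare split_paired_All [simp del] split_paired_Ex [simp del]

locale bigraded =
  fixes m n :: nat and M :: "('k::field bipoly, 'a) module" and G :: "int \<times> int \<Rightarrow> 'a set"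
  assumes bigraded: "bigraded_module m n M G"
begin

lemma is_module: "module (S_ring m n) M"
  using bigraded by (simp add: bigraded_module_def)

sublocale koszul "S_ring m n" M y_var n
  by (intro koszul.intro koszul_axioms.intro is_module y_var_closed)

lemma component_subgroup: "subgroup (G e) (add_monoid M)"
  using bigraded by (simp add: bigraded_module_def)

lemma component_closed: "g \<in> G e \<Longrightarrow> g \<in> carrier M"
  using subgroup.mem_carrier[OF component_subgroup] by simp

lemma component_add: "g \<in> G e \<Longrightarrow> h \<in> G e \<Longrightarrow> g \<oplus>\<^bsub>M\<^esub> h \<in> G e"
  using subgroup.m_closed[OF component_subgroup] by simp

lemma component_zero: "\<zero>\<^bsub>M\<^esub> \<in> G e"
  using subgroup.one_closed[OF component_subgroup] by simp

lemma component_neg: "g \<in> G e \<Longrightarrow> \<ominus>\<^bsub>M\<^esub> g \<in> G e"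
  using subgroup.m_inv_closed[OF component_subgroup] by (simp add: a_inv_def)

lemma component_smult: "p \<in> S_component m n d \<Longrightarrow> g \<in> G e \<Longrightarrow> p \<odot>\<^bsub>M\<^esub> g \<in> G (fst d + fst e, snd d + snd e)"
  using bigraded by (simp add: bigraded_module_def)

lemma span_ge_closed: "x \<in> span_ge M G D \<Longrightarrow> x \<in> carrier M"
  by (induction rule: span_ge.induct) (auto intro: component_closed)

lemma span_ge_add:
  assumes x: "x \<in> span_ge M G D"
  shows "z \<in> span_ge M G D \<Longrightarrow> x \<oplus>\<^bsub>M\<^esub> z \<in> span_ge M G D"
proof (induction rule: span_ge.induct)
  case zero
  then show ?case using x span_ge_closed[OF x] by simp
next
  case (add z g e)
  have "x \<oplus>\<^bsub>M\<^esub> (z \<oplus>\<^bsub>M\<^esub> g) = (x \<oplus>\<^bsub>M\<^esub> z) \<oplus>\<^bsub>M\<^esub> g"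
    using span_ge_closed[OF x] span_ge_closed[OF add(1)] component_closed[OF add(2)] by (simp add: M.a_assoc)
  then show ?case using span_ge.add[OF add(4,2,3)] by simp
qed

lemma span_ge_neg: "x \<in> span_ge M G D \<Longrightarrow> \<ominus>\<^bsub>M\<^esub> x \<in> span_ge M G D"
proof (induction rule: span_ge.induct)
  case zero
  have "\<ominus>\<^bsub>M\<^esub> \<zero>\<^bsub>M\<^esub> = \<zero>\<^bsub>M\<^esub>" using M.diff_zero[OF M.zero_closed] by (simp add: a_minus_def)
  then show ?case by (simp only: span_ge.zero)
next
  case (add x g e)
  have "\<ominus>\<^bsub>M\<^esub> (x \<oplus>\<^bsub>M\<^esub> g) = \<ominus>\<^bsub>M\<^esub> x \<oplus>\<^bsub>M\<^esub> \<ominus>\<^bsub>M\<^esub> g"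
    using span_ge_closed[OF add(1)] component_closed[OF add(2)] by (simp add: M.minus_add)
  then show ?case using span_ge.add[OF add(4) component_neg[OF add(2)] add(3)] by simp
qed

text \<open>Applied with s = 0 to monomials and with s = 1 to the y_j.\<close>

lemma span_ge_homogeneous_smult:
  assumes p: "p \<in> S_component m n d" and s: "s \<le> snd d"
  shows "x \<in> span_ge M G D \<Longrightarrow> p \<odot>\<^bsub>M\<^esub> x \<in> span_ge M G (D + s)"
proof (induction rule: span_ge.induct)
  case zero
  have "p \<in> carrier (S_ring m n)" using p by (simp add: S_component_def)
  then show ?case using span_ge.zero[of M G "D + s"] by simp
next
  case (add x g e)
  have pc: "p \<in> carrier (S_ring m n)" using p by (simp add: S_component_def)
  have "p \<odot>\<^bsub>M\<^esub> (x \<oplus>\<^bsub>M\<^esub> g) = p \<odot>\<^bsub>M\<^esub> x \<oplus>\<^bsub>M\<^esub> p \<odot>\<^bsub>M\<^esub> g"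
    using span_ge_closed[OF add(1)] component_closed[OF add(2)] pc by (simp add: smult_r_distr)
  moreover have "D + s \<le> snd (fst d + fst e, snd d + snd e)" using s add(3) by simp
  ultimately show ?case using span_ge.add[OF add(4) component_smult[OF p add(2)]] by simp
qed

lemma monomial_component:
  assumes "Poly_Mapping.keys t \<subseteq> Inl ` {1..m} \<union> Inr ` {1..n}"
  shows "Poly_Mapping.single t c \<in> S_component m n (int (\<Sum>i\<in>{1..m}. Poly_Mapping.lookup t (Inl i)),
     int (\<Sum>j\<in>{1..n}. Poly_Mapping.lookup t (Inr j)))"
  using assms by (simp add: S_component_def S_ring_def)

text \<open>A polynomial is a sum of monomials, and these have nonnegative y-degree.\<close>

lemma span_ge_smult:
  assumes r: "r \<in> carrier (S_ring m n)" and x: "x \<in> span_ge M G D"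
  shows "r \<odot>\<^bsub>M\<^esub> x \<in> span_ge M G D"
proof -
  let ?p = "\<lambda>T. \<Sum>t\<in>T. Poly_Mapping.single t (Poly_Mapping.lookup r t)"
  have "?p T \<in> carrier (S_ring m n) \<and> ?p T \<odot>\<^bsub>M\<^esub> x \<in> span_ge M G D"
    if "finite T" "T \<subseteq> Poly_Mapping.keys r" for T
    using that
  proof (induction T)
    case empty
    have z: "(0 :: 'k bipoly) = \<zero>\<^bsub>S_ring m n\<^esub>" by (simp add: S_ring_def)
    show ?case
      unfolding sum.empty z using span_ge_closed[OF x] span_ge.zero[of M G D] by simp
  next
    case (insert t T)
    let ?s = "Poly_Mapping.single t (Poly_Mapping.lookup r t)"
    have t: "Poly_Mapping.keys t \<subseteq> Inl ` {1..m} \<union> Inr ` {1..n}"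
      using r insert.prems by (simp add: S_ring_def)
    note s = monomial_component[OF t, of "Poly_Mapping.lookup r t"]
    have sc: "?s \<in> carrier (S_ring m n)" using s by (simp add: S_component_def)
    have sx: "?s \<odot>\<^bsub>M\<^esub> x \<in> span_ge M G D"
      using span_ge_homogeneous_smult[OF s, of 0 x D] x by (simp del: of_nat_sum)
    have IH: "?p T \<in> carrier (S_ring m n)" "?p T \<odot>\<^bsub>M\<^esub> x \<in> span_ge M G D" using insert by auto
    have eq: "?p (insert t T) = ?s \<oplus>\<^bsub>S_ring m n\<^esub> ?p T"
      using insert.hyps by (simp add: S_ring_def)
    show ?case
      unfolding eq using sc IH span_ge_add[OF sx IH(2)] span_ge_closed[OF x] by (simp add: smult_l_distr)
  qed
  from this[OF finite_keys order_refl] show ?thesis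
    unfolding sum_monomials[of r, symmetric] by simp
qed

lemma submodule_span_ge: "submodule (span_ge M G D) (S_ring m n) M"
  by (intro submoduleI) (auto intro: span_ge_closed span_ge.zero span_ge_neg span_ge_add span_ge_smult)

lemma span_ge_antimono:
  assumes "D \<le> D'"
  shows "span_ge M G D' \<subseteq> span_ge M G D"
proof
  fix x assume "x \<in> span_ge M G D'"
  then show "x \<in> span_ge M G D"
  proof (induction rule: span_ge.induct)
    case (add x g e)
    then show ?case using assms by (intro span_ge.add) auto
  qed (rule span_ge.zero)
qed

text \<open>Summands of equal degree are merged, so that the uniqueness of homogeneous
  decompositions can be applied.\<close>

lemma span_ge_decomposition:
  assumes "x \<in> span_ge M G D"
  shows "\<exists>c A. finite A \<and> (\<forall>e. c e \<in> G e) \<and> (\<forall>e. c e \<noteq> \<zero>\<^bsub>M\<^esub> \<longrightarrow> e \<in> A) \<and> (\<forall>e\<in>A. D \<le> snd e) \<and>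
    x = (\<Oplus>\<^bsub>M\<^esub>e\<in>A. c e)"
  using assms
proof (induction rule: span_ge.induct)
  case zero
  then show ?case
    using component_zero by (intro exI[of _ "\<lambda>_. \<zero>\<^bsub>M\<^esub>"] exI[of _ "{}"]) simp
next
  case (add x g e)
  then obtain c A where c: "finite A" "\<forall>e. c e \<in> G e" "\<forall>e. c e \<noteq> \<zero>\<^bsub>M\<^esub> \<longrightarrow> e \<in> A" "\<forall>e\<in>A. D \<le> snd e"
    "x = (\<Oplus>\<^bsub>M\<^esub>e\<in>A. c e)" by (elim exE conjE)
  have cc: "c e \<in> carrier M" for e using c(2) component_closed by blast
  have gc: "g \<in> carrier M" by (rule component_closed[OF add(2)])
  \<comment> \<open>The new summand g goes into component e, whether or not e already occurs in A;
    \<open>?B\<close> sets that component aside.\<close>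
  let ?c = "c(e := c e \<oplus>\<^bsub>M\<^esub> g)" and ?B = "A - {e}"
  let ?S = "\<Oplus>\<^bsub>M\<^esub>e\<in>?B. c e"
  have S: "?S \<in> carrier M" using cc by (intro M.finsum_closed) auto
  have x: "x = c e \<oplus>\<^bsub>M\<^esub> ?S"
  proof (cases "e \<in> A")
    case True
    then have "A = insert e ?B" by auto
    then have "x = (\<Oplus>\<^bsub>M\<^esub>e\<in>insert e ?B. c e)" using c(5) by simp
    also have "\<dots> = c e \<oplus>\<^bsub>M\<^esub> ?S" using c(1) cc by (intro M.finsum_insert) auto
    finally show ?thesis .
  next
    case False
    then have "c e = \<zero>\<^bsub>M\<^esub>" "?B = A" using c(3) by auto
    then show ?thesis using c(5) S by simp
  qed
  have "(\<Oplus>\<^bsub>M\<^esub>e\<in>insert e ?B. ?c e) = ?c e \<oplus>\<^bsub>M\<^esub> (\<Oplus>\<^bsub>M\<^esub>e\<in>?B. ?c e)"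
    using c(1) cc gc by (intro M.finsum_insert) auto
  also have "(\<Oplus>\<^bsub>M\<^esub>e\<in>?B. ?c e) = ?S" using cc by (intro M.finsum_cong') auto
  also have "?c e \<oplus>\<^bsub>M\<^esub> ?S = x \<oplus>\<^bsub>M\<^esub> g"
    unfolding x using cc gc S by (simp add: M.a_ac)
  finally have "x \<oplus>\<^bsub>M\<^esub> g = (\<Oplus>\<^bsub>M\<^esub>e\<in>insert e ?B. ?c e)" by simp
  moreover have "\<forall>e. ?c e \<in> G e" using c(2) component_add add(2) by simp
  ultimately show ?case
    using c(1,3,4) add(3) by (intro exI[of _ ?c] exI[of _ "insert e ?B"]) auto
qed

lemma decomposition_exists:
  assumes "x \<in> carrier M"
  shows "\<exists>!c. (\<forall>d. c d \<in> G d) \<and> finite {d. c d \<noteq> \<zero>\<^bsub>M\<^esub>} \<and> x = (\<Oplus>\<^bsub>M\<^esub>d\<in>{d. c d \<noteq> \<zero>\<^bsub>M\<^esub>}. c d)"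
  using bigraded assms by (simp add: bigraded_module_def)

text \<open>By uniqueness, the decomposition obtained at each bound D + d is the decomposition of x
  itself. A nonzero component would therefore have y-degree above every bound.\<close>

lemma span_ge_separated:
  assumes "\<And>d::nat. x \<in> span_ge M G (D + int d)"
  shows "x = \<zero>\<^bsub>M\<^esub>"
proof -
  have x: "x \<in> carrier M" using assms[of 0] by (rule span_ge_closed)
  from decomposition_exists[OF x] obtain c where
    c: "\<forall>d. c d \<in> G d" "finite {d. c d \<noteq> \<zero>\<^bsub>M\<^esub>}" "x = (\<Oplus>\<^bsub>M\<^esub>d\<in>{d. c d \<noteq> \<zero>\<^bsub>M\<^esub>}. c d)"
    and uniq: "\<And>c'. (\<forall>d. c' d \<in> G d) \<and> finite {d. c' d \<noteq> \<zero>\<^bsub>M\<^esub>} \<and> x = (\<Oplus>\<^bsub>M\<^esub>d\<in>{d. c' d \<noteq> \<zero>\<^bsub>M\<^esub>}. c' d) \<Longrightarrow> c' = c"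
    by (elim ex1E) blast
  have bound: "D + int d \<le> snd e" if e: "c e \<noteq> \<zero>\<^bsub>M\<^esub>" for d e
  proof -
    from span_ge_decomposition[OF assms[of d]] obtain c' A where
      c': "finite A" "\<forall>e. c' e \<in> G e" "\<forall>e. c' e \<noteq> \<zero>\<^bsub>M\<^esub> \<longrightarrow> e \<in> A" "\<forall>e\<in>A. D + int d \<le> snd e"
      "x = (\<Oplus>\<^bsub>M\<^esub>e\<in>A. c' e)" by (elim exE conjE)
    have sub: "{d. c' d \<noteq> \<zero>\<^bsub>M\<^esub>} \<subseteq> A" using c'(3) by auto
    have cc: "c' e \<in> carrier M" for e using c'(2) component_closed by blast
    have "(\<Oplus>\<^bsub>M\<^esub>d\<in>{d. c' d \<noteq> \<zero>\<^bsub>M\<^esub>}. c' d) = (\<Oplus>\<^bsub>M\<^esub>e\<in>A. c' e)"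
      using sub c'(1) cc by (intro M.add.finprod_mono_neutral_cong_left) auto
    then have "c' = c" using c'(2,5) finite_subset[OF sub c'(1)] by (intro uniq) simp
    then show ?thesis using c'(3,4) e by blast
  qed
  have "c e = \<zero>\<^bsub>M\<^esub>" for e
  proof (rule ccontr)
    assume "c e \<noteq> \<zero>\<^bsub>M\<^esub>"
    from bound[OF this, of "nat (snd e - D + 1)"] show False by linarith
  qed
  then show ?thesis using c(3) by simp
qed

text \<open>An element has finitely many homogeneous components, so every generator lies in some
  \<open>span_ge M G D\<close>; the smallest of finitely many D serves for all.\<close>

lemma span_ge_exhausts:
  assumes "spanned_by (S_ring m n) M A"
  shows "\<exists>D. span_ge M G D = carrier M"
proof -
  have point: "\<exists>D. x \<in> span_ge M G D" if x: "x \<in> carrier M" for x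
  proof -
    from decomposition_exists[OF x] obtain c where
      c: "\<forall>d. c d \<in> G d" "finite {d. c d \<noteq> \<zero>\<^bsub>M\<^esub>}" "x = (\<Oplus>\<^bsub>M\<^esub>d\<in>{d. c d \<noteq> \<zero>\<^bsub>M\<^esub>}. c d)"
      by (elim ex1E conjE)
    have cc: "c e \<in> carrier M" for e using c(1) component_closed by blast
    have "\<exists>D. (\<Oplus>\<^bsub>M\<^esub>d\<in>T. c d) \<in> span_ge M G D" if "finite T" for T
      using that
    proof (induction T)
      case empty
      then show ?case using span_ge.zero[of M G] by simp
    next
      case (insert e T)
      then obtain D where D: "(\<Oplus>\<^bsub>M\<^esub>d\<in>T. c d) \<in> span_ge M G D" by blast
      have "(\<Oplus>\<^bsub>M\<^esub>d\<in>insert e T. c d) = (\<Oplus>\<^bsub>M\<^esub>d\<in>T. c d) \<oplus>\<^bsub>M\<^esub> c e"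
        using insert.hyps cc by (simp add: M.a_comm M.finsum_closed Pi_def)
      moreover have "(\<Oplus>\<^bsub>M\<^esub>d\<in>T. c d) \<in> span_ge M G (min D (snd e))"
        using D span_ge_antimono[of "min D (snd e)" D] by auto
      then have "(\<Oplus>\<^bsub>M\<^esub>d\<in>T. c d) \<oplus>\<^bsub>M\<^esub> c e \<in> span_ge M G (min D (snd e))"
        by (rule span_ge.add) (use c(1) in auto)
      ultimately show ?case by metis
    qed
    from this[OF c(2)] show ?thesis using c(3) by simp
  qed
  have A: "finite A" "A \<subseteq> carrier M" "\<And>W. submodule W (S_ring m n) M \<Longrightarrow> A \<subseteq> W \<Longrightarrow> W = carrier M"
    using assms by (auto simp: spanned_by_def)
  have "\<exists>D. A \<subseteq> span_ge M G D"
    using A(1,2)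
  proof (induction A)
    case (insert a A)
    then obtain D where D: "A \<subseteq> span_ge M G D" by auto
    obtain D' where "a \<in> span_ge M G D'" using point[of a] insert.prems by auto
    then have "insert a A \<subseteq> span_ge M G (min D D')"
      using D span_ge_antimono[of "min D D'" D] span_ge_antimono[of "min D D'" D'] by auto
    then show ?case by blast
  qed auto
  then show ?thesis using A(3)[OF submodule_span_ge] by blast
qed

lemma y_filtration_exists:
  assumes "spanned_by (S_ring m n) M A"
  shows "\<exists>F. y_filtration F"
proof -
  obtain D where D: "span_ge M G D = carrier M" using span_ge_exhausts[OF assms] by blast
  have yc: "y_var j \<in> S_component m n (0, 1)" if j: "j \<in> {1..n}" for j
  proof -
    let ?t = "Poly_Mapping.single (Inr j) 1 :: nat + nat \<Rightarrow>\<^sub>0 nat"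
    have t: "Poly_Mapping.keys ?t \<subseteq> Inl ` {1..m} \<union> Inr ` {1..n}" using j by auto
    have "(\<Sum>i\<in>{1..m}. Poly_Mapping.lookup ?t (Inl i)) = 0"
      by (simp add: lookup_single)
    moreover have "(\<Sum>i\<in>{1..n}. Poly_Mapping.lookup ?t (Inr i)) = 1"
      using j by (simp add: lookup_single when_def)
    ultimately show ?thesis
      using monomial_component[OF t, of 1] by (simp add: y_var_def)
  qed
  \<comment> \<open>The index is shifted to start at the D for which the span is all of M, so that
    step 0 is M.\<close>
  have "y_filtration (\<lambda>d. span_ge M G (D + int d))"
    unfolding y_filtration_def
  proof (intro conjI allI ballI)
    show "submodule (span_ge M G (D + int d)) (S_ring m n) M" for d by (rule submodule_span_ge)
    show "span_ge M G (D + int 0) = carrier M" using D by simp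
    show "y_var j \<odot>\<^bsub>M\<^esub> x \<in> span_ge M G (D + int (Suc d))"
      if "j \<in> {1..n}" "x \<in> span_ge M G (D + int d)" for j d x
      using span_ge_homogeneous_smult[OF yc[OF that(1)], of 1 x "D + int d"] that(2) by (simp add: add_ac)
    show "(\<Inter>d. span_ge M G (D + int d)) = {\<zero>\<^bsub>M\<^esub>}"
      using span_ge_separated[of _ D] span_ge.zero[of M G] by blast
  qed
  then show ?thesis by blast
qed

end

theorem proposition3p5:
  fixes m n r :: nat
    and M :: "nat \<Rightarrow> ('k::field bipoly, 'a) module"
    and G :: "nat \<Rightarrow> int \<times> int \<Rightarrow> 'a set"
  assumes "1 \<le> r"
    and "\<And>i. i \<in> {1..r} \<Longrightarrow> bigraded_module m n (M i) (G i)"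
    and "\<And>i. i \<in> {1..r} \<Longrightarrow> finitely_generated_module (S_ring m n) (M i)"
    and "\<And>i. i \<in> {1..r} \<Longrightarrow> nonzero_module (M i)"
  shows "Q_maximal_depth m n (direct_sum {1..r} M) \<longleftrightarrow>
    (\<exists>j\<in>{1..r}. (\<forall>k\<in>{1..r}. Q_grade m n (M j) \<le> Q_grade m n (M k)) \<and>
       Q_maximal_depth m n (M j))"
proof -
  let ?R = "S_ring m n :: 'k bipoly ring" and ?I = "{1..r}" and ?N = "direct_sum {1..r} M"
  let ?cd = "\<lambda>\<pp>. Q_cd m n (quotient_module (regular_module ?R) \<pp>)"
  have big: "bigraded m n (M i) (G i)" if "i \<in> ?I" for i
    using assms(2)[OF that] by (rule bigraded.intro)
  have mods: "module ?R (M i)" if "i \<in> ?I" for i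
    by (rule bigraded.is_module[OF big[OF that]])
  have kos: "koszul ?R (M i) y_var n" if "i \<in> ?I" for i
    by (intro koszul.intro koszul_axioms.intro mods that y_var_closed)
  interpret fam: module_family ?R ?I M
    by (intro module_family.intro module_family_axioms.intro cring_S_ring mods) auto
  interpret N: koszul ?R ?N y_var n
    by (intro koszul.intro koszul_axioms.intro fam.sum_module y_var_closed)
  have "\<forall>i\<in>?I. \<exists>A. spanned_by ?R (M i) A"
    using module.spanned_by_if_finitely_generated[OF mods assms(3)] by blast
  from bchoice[OF this] obtain A where A: "\<forall>i\<in>?I. spanned_by ?R (M i) (A i)" ..
  have spN: "spanned_by ?R ?N (\<Union>i\<in>?I. fam.embed i ` A i)"
    using A by (intro fam.sum_spanned) blast
  have "\<forall>i\<in>?I. \<exists>F. koszul.y_filtration ?R (M i) y_var n F"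
    using bigraded.y_filtration_exists[OF big] A by blast
  from bchoice[OF this] obtain F where F: "\<forall>i\<in>?I. koszul.y_filtration ?R (M i) y_var n (F i)" ..
  have FN: "N.y_filtration (\<lambda>d. {x \<in> carrier ?N. \<forall>i\<in>?I. x i \<in> F i d})"
    using F by (intro fam.y_filtration_sum y_var_closed) auto
  note accR = acc_ideals_S_ring[of m n, where 'a = 'k]
  have acc: "acc_submodules ?R (M i) (carrier (M i))" if "i \<in> ?I" for i
    using A that unfolding spanned_by_def
    by (intro module.acc_submodules_if_finitely_generated[OF mods[OF that] accR, of "A i"]) auto
  have accN: "acc_submodules ?R ?N (carrier ?N)"
    using spN unfolding spanned_by_def
    by (intro module.acc_submodules_if_finitely_generated[OF fam.sum_module accR, of "\<Union>i\<in>?I. fam.embed i ` A i"]) auto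
  have nzN: "nonzero_module ?N"
    using assms(1) by (intro fam.sum_nonzero[of 1] assms(4)) auto
  have le_M: "g \<le> Q_grade m n (M i) \<longleftrightarrow> (\<forall>l<g. koszul.koszul_exact ?R (M i) y_var n 1 {\<zero>\<^bsub>M i\<^esub>} l)"
    if i: "i \<in> ?I" for g i
    unfolding Q_grade_def Q_ideal_def
    by (rule koszul.le_grade_iff[OF kos[OF i] F[rule_format, OF i] assms(4)[OF i] accR acc[OF i]])
  \<comment> \<open>The grade of the sum is the minimum of the grades, expressed through lower
    bounds.\<close>
  have le_N: "g \<le> Q_grade m n ?N \<longleftrightarrow> (\<forall>i\<in>?I. g \<le> Q_grade m n (M i))" for g
  proof -
    have "g \<le> Q_grade m n ?N \<longleftrightarrow> (\<forall>l<g. N.koszul_exact 1 {\<zero>\<^bsub>?N\<^esub>} l)"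
      unfolding Q_grade_def Q_ideal_def by (rule N.le_grade_iff[OF FN nzN accR accN])
    also have "\<dots> \<longleftrightarrow> (\<forall>l<g. \<forall>i\<in>?I. koszul.koszul_exact ?R (M i) y_var n 1 {\<zero>\<^bsub>M i\<^esub>} l)"
      using fam.koszul_exact_sum_iff[of n y_var 1] y_var_closed by simp
    also have "\<dots> \<longleftrightarrow> (\<forall>i\<in>?I. g \<le> Q_grade m n (M i))" using le_M by blast
    finally show ?thesis .
  qed
  have grade_le_cd: "Q_grade m n (M i) \<le> ?cd \<pp>"
    if "i \<in> ?I" "\<pp> \<in> associated_primes ?R (M i)" for i \<pp>
    unfolding Q_grade_def Q_ideal_def Q_cd_def
    using that by (intro koszul.grade_le_cohomological_dimension[OF kos, of i "F i"] F[rule_format] assms(4) accR acc)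
  have ass_ne: "associated_primes ?R (M i) \<noteq> {}" if "i \<in> ?I" for i
    by (rule module.associated_primes_nonempty[OF mods[OF that] accR assms(4)[OF that]])
  have grade_le: "Q_grade m n (M i) \<le> Q_mgrade m n (M i)" if "i \<in> ?I" for i
    unfolding Q_mgrade_def using grade_le_cd that ass_ne by (intro cINF_greatest) auto
  have mgrade_le: "Q_mgrade m n (M i) \<le> ?cd \<pp>" if "i \<in> ?I" "\<pp> \<in> associated_primes ?R (M i)" for i \<pp>
    unfolding Q_mgrade_def using that(2) by (intro cINF_lower) auto
  have mgrade_N_le: "Q_mgrade m n ?N \<le> Q_mgrade m n (M i)" if "i \<in> ?I" for i
    unfolding Q_mgrade_def fam.associated_primes_sum
    by (rule cINF_superset_mono[OF ass_ne[OF that]]) (use that in auto)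
  have "associated_primes ?R ?N \<noteq> {}"
    unfolding fam.associated_primes_sum using ass_ne assms(1) by fastforce
  \<comment> \<open>The minimum is attained at a prime of some summand \<open>M i\<close>; this i is
    the witness in the forward direction.\<close>
  then have "Q_mgrade m n ?N \<in> ?cd ` associated_primes ?R ?N"
    unfolding Q_mgrade_def by (intro Inf_nat_def1) simp
  then obtain \<pp> i where i: "i \<in> ?I" "\<pp> \<in> associated_primes ?R (M i)" "Q_mgrade m n ?N = ?cd \<pp>"
    unfolding fam.associated_primes_sum by blast
  show ?thesis
  proof
    assume "Q_maximal_depth m n ?N"
    then have eq: "Q_grade m n ?N = Q_mgrade m n ?N" by (simp add: Q_maximal_depth_def)
    have min: "Q_grade m n ?N \<le> Q_grade m n (M k)" if "k \<in> ?I" for k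
      using le_N[of "Q_grade m n ?N"] that by blast
    \<comment> \<open>With N the sum and p the prime found above: mgrade(M i) \<le> cd(S/p) =
      mgrade(N) = grade(N) \<le> grade(M i) \<le> mgrade(M i), so equality holds throughout.\<close>
    have "Q_mgrade m n (M i) \<le> Q_grade m n ?N" using mgrade_le[OF i(1,2)] i(3) eq by simp
    then have "Q_grade m n (M i) = Q_mgrade m n (M i)" "Q_grade m n (M i) \<le> Q_grade m n ?N"
      using grade_le[OF i(1)] min[OF i(1)] by auto
    then show "\<exists>j\<in>?I. (\<forall>k\<in>?I. Q_grade m n (M j) \<le> Q_grade m n (M k)) \<and> Q_maximal_depth m n (M j)"
      using i(1) min by (intro bexI[of _ i]) (auto simp: Q_maximal_depth_def intro: le_trans)
  next
    assume "\<exists>j\<in>?I. (\<forall>k\<in>?I. Q_grade m n (M j) \<le> Q_grade m n (M k)) \<and> Q_maximal_depth m n (M j)"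
    then obtain j where j: "j \<in> ?I" "\<And>k. k \<in> ?I \<Longrightarrow> Q_grade m n (M j) \<le> Q_grade m n (M k)"
      "Q_grade m n (M j) = Q_mgrade m n (M j)" by (auto simp: Q_maximal_depth_def)
    have "Q_grade m n ?N = Q_grade m n (M j)"
      using le_N[of "Q_grade m n ?N"] le_N[of "Q_grade m n (M j)"] j(1,2) by (meson le_antisym order_refl)
    \<comment> \<open>The chain mgrade(N) \<le> mgrade(M j) = grade(M j) \<le> grade(M i) \<le>
      cd(S/p) = mgrade(N) closes up.\<close>
    moreover have "Q_mgrade m n ?N = Q_grade m n (M j)"
      using mgrade_N_le[OF j(1)] j(2)[OF i(1)] j(3) grade_le_cd[OF i(1,2)] i(3) by simp
    ultimately show "Q_maximal_depth m n ?N" by (simp add: Q_maximal_depth_def)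
  qed
qed

end
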